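(* Let $A$ be a semisimple approximately unital operator algebra such that every closed left ideal $J$ in $A$ is contractively $A$-complemented, or equivalently equals $Ap$ for a projection $p\in M(A)$. Then $A$ is completely isometrically isomorphic to an annihilator $C^*$-algebra.
   Context: An operator algebra is a norm closed subalgebra of $B(H)$ for a Hilbert space $H$; it is approximately unital if it has a contractive two-sided approximate identity. Semisimple means zero Jacobson radical. A left ideal in $A$ is contractively $A$-complemented if it is the range of a contractive idempotent left $A$-module map $A\to A$. $M(A)=\{x\in A^{**}:xA\subset A,\ Ax\subset A\}$ is the two-sided multiplier algebra, and projections are orthogonal projections. An annihilator $C^*$-algebra is a $c_0$-direct sum of $C^*$-algebras $\mathbb{K}(H_i)$ of compact operators on Hilbert spaces $H_i$. *)

theory Defs
  imports "HOL-Analysis.Analysis"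
begin

section \<open>Complex Hilbert spaces and their operators\<close>

text \<open>The real Hilbert space structure (norm, topology, \<^term>\<open>inner\<close>) is the one underlying the
  complex one. The complex inner product is linear in its first argument.\<close>

class complex_hilbert_space = real_inner + complete_space +
  fixes scaleC :: "complex \<Rightarrow> 'a \<Rightarrow> 'a"
    and cinner :: "'a \<Rightarrow> 'a \<Rightarrow> complex"
  assumes scaleC_add_right: "scaleC c (x + y) = scaleC c x + scaleC c y"
    and scaleC_add_left: "scaleC (c + d) x = scaleC c x + scaleC d x"
    and scaleC_scaleC: "scaleC c (scaleC d x) = scaleC (c * d) x"
    and scaleC_of_real: "scaleC (complex_of_real r) x = scaleR r x"
    and cinner_commute: "cinner x y = cnj (cinner y x)"
    and cinner_add_left: "cinner (x + y) z = cinner x z + cinner y z"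
    and cinner_scaleC_left: "cinner (scaleC c x) y = c * cinner x y"
    and inner_eq_Re_cinner: "inner x y = Re (cinner x y)"

lemma norm_scaleC:
  fixes x :: "'a::complex_hilbert_space"
  shows "norm (scaleC c x) = cmod c * norm x"
proof -
  have "cinner (scaleC c x) (scaleC c x) = c * (cnj c * cnj (cinner x x))"
    by (metis cinner_commute cinner_scaleC_left complex_cnj_mult)
  also have "\<dots> = complex_of_real ((cmod c)\<^sup>2) * cinner x x"
    by (metis cinner_commute complex_norm_square mult.assoc)
  finally have "inner (scaleC c x) (scaleC c x) = (cmod c)\<^sup>2 * inner x x"
    by (simp add: inner_eq_Re_cinner)
  then show ?thesis
    by (simp add: norm_eq_sqrt_inner real_sqrt_mult)
qed

lemma bounded_linear_scaleC:
  "bounded_linear (scaleC c :: 'a::complex_hilbert_space \<Rightarrow> 'a)"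
proof (rule bounded_linear_intro[where K = "cmod c"])
  fix x y :: 'a and r :: real
  show "scaleC c (x + y) = scaleC c x + scaleC c y"
    by (rule scaleC_add_right)
  show "scaleC c (r *\<^sub>R x) = r *\<^sub>R scaleC c x"
    by (metis mult.commute scaleC_of_real scaleC_scaleC)
  show "norm (scaleC c x) \<le> norm x * cmod c"
    by (simp add: norm_scaleC)
qed

definition csubspace :: "'h::complex_hilbert_space set \<Rightarrow> bool" where
  "csubspace S \<longleftrightarrow> 0 \<in> S \<and> (\<forall>x\<in>S. \<forall>y\<in>S. x + y \<in> S) \<and> (\<forall>c. \<forall>x\<in>S. scaleC c x \<in> S)"

text \<open>The type \<^typ>\<open>'h \<Rightarrow>\<^sub>L 'h\<close> consists of the real-linear bounded operators; \<open>B(H)\<close> is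
  the set of complex-linear ones.\<close>

definition B_ops :: "('h::complex_hilbert_space \<Rightarrow>\<^sub>L 'h) set" where
  "B_ops = {T. \<forall>c x. blinfun_apply T (scaleC c x) = scaleC c (blinfun_apply T x)}"

definition op_scale :: "complex \<Rightarrow> ('h::complex_hilbert_space \<Rightarrow>\<^sub>L 'h) \<Rightarrow> ('h \<Rightarrow>\<^sub>L 'h)" where
  "op_scale c T = Blinfun (\<lambda>x. scaleC c (blinfun_apply T x))"

lemma op_scale_apply: "blinfun_apply (op_scale c T) x = scaleC c (blinfun_apply T x)"
  unfolding op_scale_def
  by (simp add: bounded_linear_Blinfun_apply
      bounded_linear_compose[OF bounded_linear_scaleC blinfun.bounded_linear_right])

definition op_adj :: "('h::complex_hilbert_space \<Rightarrow>\<^sub>L 'h) \<Rightarrow> ('h \<Rightarrow>\<^sub>L 'h)" where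
  "op_adj T = (THE S. \<forall>x y. cinner (blinfun_apply T x) y = cinner x (blinfun_apply S y))"

text \<open>The norm of an \<open>n \<times> n\<close> matrix of operators, acting on the Hilbert space sum of \<open>n\<close>
  copies of \<open>H\<close>.\<close>

definition op_mat_norm :: "nat \<Rightarrow> (nat \<Rightarrow> nat \<Rightarrow> ('h::complex_hilbert_space \<Rightarrow>\<^sub>L 'h)) \<Rightarrow> real" where
  "op_mat_norm n T =
     Sup {sqrt (\<Sum>i<n. (norm (\<Sum>j<n. blinfun_apply (T i j) (v j)))\<^sup>2) | v.
            (\<Sum>j<n. (norm (v j))\<^sup>2) \<le> 1}"


section \<open>Operator algebras\<close>

definition op_subspace :: "('h::complex_hilbert_space \<Rightarrow>\<^sub>L 'h) set \<Rightarrow> bool" where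
  "op_subspace V \<longleftrightarrow> 0 \<in> V \<and> (\<forall>a\<in>V. \<forall>b\<in>V. a + b \<in> V) \<and> (\<forall>c. \<forall>a\<in>V. op_scale c a \<in> V)"

definition operator_algebra :: "('h::complex_hilbert_space \<Rightarrow>\<^sub>L 'h) set \<Rightarrow> bool" where
  "operator_algebra A \<longleftrightarrow>
     A \<subseteq> B_ops \<and> op_subspace A \<and> (\<forall>a\<in>A. \<forall>b\<in>A. a o\<^sub>L b \<in> A) \<and> closed A"

text \<open>The approximate identity is given as a filter instead of a net.\<close>

definition approximately_unital :: "('h::complex_hilbert_space \<Rightarrow>\<^sub>L 'h) set \<Rightarrow> bool" where
  "approximately_unital A \<longleftrightarrow>
     (\<exists>F. F \<noteq> bot \<and> (\<forall>\<^sub>F e in F. e \<in> A \<and> norm e \<le> 1) \<and>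
        (\<forall>a\<in>A. ((\<lambda>e. e o\<^sub>L a) \<longlongrightarrow> a) F \<and> ((\<lambda>e. a o\<^sub>L e) \<longlongrightarrow> a) F))"

definition left_ideal ::
  "('h::complex_hilbert_space \<Rightarrow>\<^sub>L 'h) set \<Rightarrow> ('h \<Rightarrow>\<^sub>L 'h) set \<Rightarrow> bool" where
  "left_ideal A J \<longleftrightarrow> J \<subseteq> A \<and> op_subspace J \<and> (\<forall>a\<in>A. \<forall>b\<in>J. a o\<^sub>L b \<in> J)"

text \<open>The algebra need not have a unit, so the Jacobson radical is the intersection of the maximal
  \<^emph>\<open>modular\<close> left ideals, and the whole algebra if there are none.\<close>

definition maximal_modular_left_ideal ::
  "('h::complex_hilbert_space \<Rightarrow>\<^sub>L 'h) set \<Rightarrow> ('h \<Rightarrow>\<^sub>L 'h) set \<Rightarrow> bool" where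
  "maximal_modular_left_ideal A L \<longleftrightarrow>
     left_ideal A L \<and> L \<noteq> A \<and> (\<exists>u\<in>A. \<forall>a\<in>A. a - (a o\<^sub>L u) \<in> L) \<and>
     (\<forall>L'. left_ideal A L' \<and> L \<subseteq> L' \<longrightarrow> L' = L \<or> L' = A)"

definition jacobson_radical ::
  "('h::complex_hilbert_space \<Rightarrow>\<^sub>L 'h) set \<Rightarrow> ('h \<Rightarrow>\<^sub>L 'h) set" where
  "jacobson_radical A = {a \<in> A. \<forall>L. maximal_modular_left_ideal A L \<longrightarrow> a \<in> L}"

definition semisimple :: "('h::complex_hilbert_space \<Rightarrow>\<^sub>L 'h) set \<Rightarrow> bool" where
  "semisimple A \<longleftrightarrow> jacobson_radical A = {0}"

definition contractively_complemented ::
  "('h::complex_hilbert_space \<Rightarrow>\<^sub>L 'h) set \<Rightarrow> ('h \<Rightarrow>\<^sub>L 'h) set \<Rightarrow> bool" where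
  "contractively_complemented A J \<longleftrightarrow>
     (\<exists>P. (\<forall>a\<in>A. P a \<in> A) \<and>
          (\<forall>a\<in>A. \<forall>b\<in>A. P (a + b) = P a + P b) \<and>
          (\<forall>c. \<forall>a\<in>A. P (op_scale c a) = op_scale c (P a)) \<and>
          (\<forall>a\<in>A. \<forall>b\<in>A. P (a o\<^sub>L b) = a o\<^sub>L P b) \<and>
          (\<forall>a\<in>A. norm (P a) \<le> norm a) \<and>
          (\<forall>a\<in>A. P (P a) = P a) \<and>
          P ` A = J)"


section \<open>The bidual and the multiplier algebra\<close>

text \<open>Functionals on a carrier set are represented by functions that vanish off it.\<close>

definition restr :: "'a set \<Rightarrow> ('a \<Rightarrow> complex) \<Rightarrow> 'a \<Rightarrow> complex" where
  "restr D f = (\<lambda>x. if x \<in> D then f x else 0)"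

definition op_dual :: "('h::complex_hilbert_space \<Rightarrow>\<^sub>L 'h) set \<Rightarrow> (('h \<Rightarrow>\<^sub>L 'h) \<Rightarrow> complex) set" where
  "op_dual A =
     {f. (\<forall>a\<in>A. \<forall>b\<in>A. f (a + b) = f a + f b) \<and>
         (\<forall>c. \<forall>a\<in>A. f (op_scale c a) = c * f a) \<and>
         (\<exists>K. \<forall>a\<in>A. cmod (f a) \<le> K * norm a) \<and>
         (\<forall>a. a \<notin> A \<longrightarrow> f a = 0)}"

definition dual_norm ::
  "('h::complex_hilbert_space \<Rightarrow>\<^sub>L 'h) set \<Rightarrow> (('h \<Rightarrow>\<^sub>L 'h) \<Rightarrow> complex) \<Rightarrow> real" where
  "dual_norm A f = Sup {cmod (f a) | a. a \<in> A \<and> norm a \<le> 1}"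

definition op_bidual ::
  "('h::complex_hilbert_space \<Rightarrow>\<^sub>L 'h) set \<Rightarrow> ((('h \<Rightarrow>\<^sub>L 'h) \<Rightarrow> complex) \<Rightarrow> complex) set" where
  "op_bidual A =
     {x. (\<forall>f\<in>op_dual A. \<forall>g\<in>op_dual A. x (\<lambda>a. f a + g a) = x f + x g) \<and>
         (\<forall>c. \<forall>f\<in>op_dual A. x (\<lambda>a. c * f a) = c * x f) \<and>
         (\<exists>K. \<forall>f\<in>op_dual A. cmod (x f) \<le> K * dual_norm A f) \<and>
         (\<forall>f. f \<notin> op_dual A \<longrightarrow> x f = 0)}"

definition canon ::
  "('h::complex_hilbert_space \<Rightarrow>\<^sub>L 'h) set \<Rightarrow> ('h \<Rightarrow>\<^sub>L 'h) \<Rightarrow> (('h \<Rightarrow>\<^sub>L 'h) \<Rightarrow> complex) \<Rightarrow> complex" where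
  "canon A a = restr (op_dual A) (\<lambda>f. f a)"

text \<open>The product of the bidual is the first Arens product \<open>(x y)(f) = x (y \<cdot> f)\<close>, where
  \<open>(y \<cdot> f)(a) = y (f \<cdot> a)\<close> and \<open>(f \<cdot> a)(b) = f (a b)\<close>; operator algebras are Arens regular, so that
  the second Arens product is the same.\<close>

definition arens ::
  "('h::complex_hilbert_space \<Rightarrow>\<^sub>L 'h) set
     \<Rightarrow> ((('h \<Rightarrow>\<^sub>L 'h) \<Rightarrow> complex) \<Rightarrow> complex) \<Rightarrow> ((('h \<Rightarrow>\<^sub>L 'h) \<Rightarrow> complex) \<Rightarrow> complex)
     \<Rightarrow> (('h \<Rightarrow>\<^sub>L 'h) \<Rightarrow> complex) \<Rightarrow> complex" where
  "arens A x y =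
     restr (op_dual A) (\<lambda>f. x (restr A (\<lambda>a. y (restr A (\<lambda>b. f (a o\<^sub>L b))))))"

definition multiplier_algebra ::
  "('h::complex_hilbert_space \<Rightarrow>\<^sub>L 'h) set \<Rightarrow> ((('h \<Rightarrow>\<^sub>L 'h) \<Rightarrow> complex) \<Rightarrow> complex) set" where
  "multiplier_algebra A =
     {x \<in> op_bidual A. \<forall>a\<in>A. arens A x (canon A a) \<in> canon A ` A \<and>
                             arens A (canon A a) x \<in> canon A ` A}"

text \<open>\<open>A**\<close> is a subalgebra of the von Neumann algebra \<open>B(H)**\<close>, in which \<open>x\<close> is the functional
  \<open>\<phi> \<mapsto> x (\<phi>|A)\<close> on \<open>B(H)*\<close>. The involution of \<open>B(H)**\<close> is \<open>x*(\<phi>) = cnj (x (\<phi>*))\<close> with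
  \<open>\<phi>*(T) = cnj (\<phi> (T*))\<close>. An orthogonal projection in \<open>A**\<close> is an idempotent that is self-adjoint
  in \<open>B(H)**\<close>.\<close>

definition functional_adj ::
  "(('h::complex_hilbert_space \<Rightarrow>\<^sub>L 'h) \<Rightarrow> complex) \<Rightarrow> ('h \<Rightarrow>\<^sub>L 'h) \<Rightarrow> complex" where
  "functional_adj \<phi> = restr B_ops (\<lambda>T. cnj (\<phi> (op_adj T)))"

definition orth_projection ::
  "('h::complex_hilbert_space \<Rightarrow>\<^sub>L 'h) set \<Rightarrow> ((('h \<Rightarrow>\<^sub>L 'h) \<Rightarrow> complex) \<Rightarrow> complex) \<Rightarrow> bool" where
  "orth_projection A p \<longleftrightarrow>
     p \<in> op_bidual A \<and> arens A p p = p \<and>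
     (\<forall>\<phi>\<in>op_dual B_ops. cnj (p (restr A (functional_adj \<phi>))) = p (restr A \<phi>))"


section \<open>Complete isometries and annihilator C*-algebras\<close>

record 'a matrix_normed_algebra =
  carr :: "'a set"
  add_op :: "'a \<Rightarrow> 'a \<Rightarrow> 'a"
  scale_op :: "complex \<Rightarrow> 'a \<Rightarrow> 'a"
  mult_op :: "'a \<Rightarrow> 'a \<Rightarrow> 'a"
  mat_norm :: "nat \<Rightarrow> (nat \<Rightarrow> nat \<Rightarrow> 'a) \<Rightarrow> real"

definition completely_isometrically_isomorphic ::
  "'a matrix_normed_algebra \<Rightarrow> 'b matrix_normed_algebra \<Rightarrow> bool" where
  "completely_isometrically_isomorphic X Y \<longleftrightarrow>
     (\<exists>\<theta>. bij_betw \<theta> (carr X) (carr Y) \<and>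
          (\<forall>a\<in>carr X. \<forall>b\<in>carr X. \<theta> (add_op X a b) = add_op Y (\<theta> a) (\<theta> b)) \<and>
          (\<forall>c. \<forall>a\<in>carr X. \<theta> (scale_op X c a) = scale_op Y c (\<theta> a)) \<and>
          (\<forall>a\<in>carr X. \<forall>b\<in>carr X. \<theta> (mult_op X a b) = mult_op Y (\<theta> a) (\<theta> b)) \<and>
          (\<forall>n m. (\<forall>i<n. \<forall>j<n. m i j \<in> carr X) \<longrightarrow>
                 mat_norm Y n (\<lambda>i j. \<theta> (m i j)) = mat_norm X n m))"

definition op_alg ::
  "('h::complex_hilbert_space \<Rightarrow>\<^sub>L 'h) set \<Rightarrow> ('h \<Rightarrow>\<^sub>L 'h) matrix_normed_algebra" where
  "op_alg A = \<lparr>carr = A, add_op = (+), scale_op = op_scale, mult_op = (o\<^sub>L), mat_norm = op_mat_norm\<rparr>"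

text \<open>For a closed subspace \<open>S\<close> of \<open>H\<close>, a compact operator on the Hilbert space \<open>S\<close> is
  represented by its extension to \<open>H\<close> by zero on the orthogonal complement of \<open>S\<close>. This preserves
  the algebraic operations and all matrix norms.\<close>

definition K_ops :: "'h::complex_hilbert_space set \<Rightarrow> ('h \<Rightarrow>\<^sub>L 'h) set" where
  "K_ops S = {T \<in> B_ops. range (blinfun_apply T) \<subseteq> S \<and>
                         (\<forall>x. (\<forall>y\<in>S. cinner x y = 0) \<longrightarrow> blinfun_apply T x = 0) \<and>
                         compact (closure (blinfun_apply T ` cball 0 1))}"

definition c0_sum_compacts ::
  "'i set \<Rightarrow> ('i \<Rightarrow> 'h::complex_hilbert_space set) \<Rightarrow> ('i \<Rightarrow> ('h \<Rightarrow>\<^sub>L 'h)) matrix_normed_algebra" where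
  "c0_sum_compacts I S =
     \<lparr>carr = {x. (\<forall>i\<in>I. x i \<in> K_ops (S i)) \<and> (\<forall>i. i \<notin> I \<longrightarrow> x i = 0) \<and>
                 (\<forall>\<epsilon>>0. finite {i \<in> I. norm (x i) \<ge> \<epsilon>})},
      add_op = (\<lambda>x y i. x i + y i),
      scale_op = (\<lambda>c x i. op_scale c (x i)),
      mult_op = (\<lambda>x y i. x i o\<^sub>L y i),
      mat_norm = (\<lambda>n m. Sup (insert 0 ((\<lambda>k. op_mat_norm n (\<lambda>i j. m i j k)) ` I)))\<rparr>"

text \<open>The Hilbert spaces \<open>H\<^sub>i\<close> are closed subspaces of a common Hilbert space; they need not be
  mutually orthogonal, the direct sum being external.\<close>

definition annihilator_cstar_algebra ::
  "('i \<Rightarrow> ('h::complex_hilbert_space \<Rightarrow>\<^sub>L 'h)) matrix_normed_algebra \<Rightarrow> bool" where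
  "annihilator_cstar_algebra X \<longleftrightarrow>
     (\<exists>I S. (\<forall>i\<in>I. csubspace (S i) \<and> closed (S i)) \<and> X = c0_sum_compacts I S)"

end

theory Submission
  imports Defs "HOL-Complex_Analysis.Cauchy_Integral_Formula"
begin

text \<open>If \<open>R\<close> is a contractive idempotent left module map of \<open>A\<close> onto \<open>J\<close>, then a weak* limit \<open>p\<close> of \<open>R e\<close>
  along a contractive approximate identity satisfies \<open>R a = a p\<close>. Averages of suitably chosen \<open>R e\<close> are almost
  self-adjoint in norm, so \<open>p\<close> is an orthogonal projection; it acts on \<open>H\<close> as a projection \<open>P\<close> with \<open>R a = a P\<close>,
  and the parallelogram law shows that \<open>P A \<subseteq> A\<close>.

  Suppose that all closed left ideals are of the form \<open>A P\<close>. The complement of the projection of a maximal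
  modular left ideal is a projection \<open>Q \<in> A\<close> with \<open>Q A Q = \<complex> Q\<close>. For \<open>x \<in> A Q\<close> with \<open>Q x = Q\<close> the range
  projection of \<open>x\<close> is another one, \<open>Q'\<close>, and \<open>Q' Q\<close> is a nonzero multiple of \<open>x\<close>; hence \<open>x\<^sup>* \<in> A\<close>. Since \<open>A\<close>
  is semisimple, the subspaces \<open>A Q\<close> span a dense subspace of \<open>A\<close>, so \<open>A\<close> is self-adjoint. It acts irreducibly
  and by compact operators on each \<open>A \<eta>\<close> with \<open>Q \<eta> = \<eta>\<close>, and these subspaces exhaust the nondegenerate part of \<open>H\<close>.\<close>

section \<open>Complex Hilbert spaces\<close>

text \<open>The obstacle is that \<open>A\<close> is not self-adjoint at the outset: adjoints of its
  elements exist in \<open>B_ops\<close>, and their membership in \<open>A\<close> is a conclusion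
  (\<open>A_adjoint\<close>), not a tool. Up to that point orthogonality is available only in
  \<open>B_ops\<close> or through functionals on it. A contractive idempotent operator is
  automatically an orthogonal projection, but \<open>p\<close> is a weak* limit, products involving
  adjoints do not pass to such limits, and self-adjointness must be tested against every functional
  on \<open>B_ops\<close>. This is why that step works with norm estimates for elements of
  \<open>A\<close> that approximate \<open>p\<close>. After it, the structure of \<open>A\<close> is
  read off from the operator \<open>P\<close> on \<open>H\<close>. Two features of the given
  representation shape the rest. \<open>A\<close> may act degenerately, so the complement of
  \<open>P\<close> is taken inside a projection \<open>E\<close> that acts as a unit of
  \<open>A\<close>, and totality of a family of subspaces means only that \<open>A\<close> kills
  their orthogonal complement. Also, \<open>H\<close> may contain many copies of one irreducible
  representation; norms agree on all copies, also at matrix level, so one copy per class is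
  kept.\<close>

instance complex_hilbert_space \<subseteq> banach ..

lemma scaleC_zero_right [simp]: "scaleC c (0::'h::complex_hilbert_space) = 0"
  using bounded_linear_scaleC[of c, where 'a='h] by (rule linear_simps(3))

lemma scaleC_diff_right: "scaleC c (x - y) = scaleC c x - scaleC c (y::'h::complex_hilbert_space)"
  using bounded_linear_scaleC[of c, where 'a='h] by (rule linear_simps(2))

lemma scaleC_one [simp]: "scaleC 1 (x::'h::complex_hilbert_space) = x"
  using scaleC_of_real[of 1 x] by simp

lemma scaleC_zero_left [simp]: "scaleC 0 (x::'h::complex_hilbert_space) = 0"
  using scaleC_of_real[of 0 x] by simp

lemma scaleC_minus_left: "scaleC (- c) x = - scaleC c (x::'h::complex_hilbert_space)"
  using scaleC_add_left[of c "-c" x] by (simp add: eq_neg_iff_add_eq_0 add.commute)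

lemma scaleC_diff_left: "scaleC (c - d) x = scaleC c x - scaleC d (x::'h::complex_hilbert_space)"
  using scaleC_add_left[of c "-d" x] by (simp add: scaleC_minus_left)

lemma scaleC_minus_one: "scaleC (-1) (x::'h::complex_hilbert_space) = - x"
  by (simp add: scaleC_minus_left)

lemma scaleC_sum_right:
  "scaleC c (\<Sum>i\<in>I. f i) = (\<Sum>i\<in>I. scaleC c (f i :: 'h::complex_hilbert_space))"
  by (induction I rule: infinite_finite_induct) (simp_all add: scaleC_add_right)

lemma cinner_add_right: "cinner x (y + z) = cinner x y + cinner x (z::'h::complex_hilbert_space)"
  by (metis cinner_commute cinner_add_left complex_cnj_add)

lemma cinner_scaleC_right: "cinner x (scaleC c y) = cnj c * cinner x (y::'h::complex_hilbert_space)"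
  by (metis cinner_commute cinner_scaleC_left complex_cnj_mult)

lemma cinner_zero_left [simp]: "cinner 0 (y::'h::complex_hilbert_space) = 0"
  using cinner_scaleC_left[of 0 0 y] by simp

lemma cinner_zero_right [simp]: "cinner (y::'h::complex_hilbert_space) 0 = 0"
  using cinner_scaleC_right[of y 0 0] by simp

lemma cinner_minus_left: "cinner (- x) y = - cinner x (y::'h::complex_hilbert_space)"
  using cinner_scaleC_left[of "-1" x y] by (simp add: scaleC_minus_one)

lemma cinner_minus_right: "cinner x (- y) = - cinner x (y::'h::complex_hilbert_space)"
  using cinner_scaleC_right[of x "-1" y] by (simp add: scaleC_minus_one)

lemma cinner_diff_left: "cinner (x - y) z = cinner x z - cinner y (z::'h::complex_hilbert_space)"
  using cinner_add_left[of x "-y" z] by (simp add: cinner_minus_left)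

lemma cinner_diff_right: "cinner x (y - z) = cinner x y - cinner x (z::'h::complex_hilbert_space)"
  using cinner_add_right[of x y "-z"] by (simp add: cinner_minus_right)

lemma cinner_same: "cinner x x = of_real ((norm (x::'h::complex_hilbert_space))\<^sup>2)"
proof -
  have "Im (cinner x x) = 0"
    using cinner_commute[of x x] by (simp add: complex_eq_iff)
  then show ?thesis
    by (simp add: complex_eq_iff inner_eq_Re_cinner[symmetric] power2_norm_eq_inner)
qed

text \<open>Multiplying \<open>x\<close> by a phase \<open>c\<close> that makes the complex inner
  product real and nonnegative reduces this to the real Cauchy-Schwarz inequality.\<close>

lemma norm_cinner_le: "cmod (cinner x y) \<le> norm x * norm (y::'h::complex_hilbert_space)"
proof -
  obtain c where c: "cmod c = 1" "c * cinner x y = of_real (cmod (cinner x y))"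
  proof (cases "cinner x y = 0")
    case False
    then show ?thesis
      by (intro that[of "cnj (cinner x y) / of_real (cmod (cinner x y))"])
        (simp_all add: norm_divide complex_norm_square[symmetric] power2_eq_square mult.commute[of "cnj _"])
  qed (auto intro: that[of 1])
  have "cmod (cinner x y) = Re (cinner (scaleC c x) y)"
    by (simp add: cinner_scaleC_left c(2))
  also have "\<dots> = inner (scaleC c x) y"
    by (simp add: inner_eq_Re_cinner)
  also have "\<dots> \<le> norm (scaleC c x) * norm y"
    by (rule norm_cauchy_schwarz)
  finally show ?thesis by (simp add: norm_scaleC c(1))
qed

lemma bounded_bilinear_cinner: "bounded_bilinear (cinner :: 'h::complex_hilbert_space \<Rightarrow> 'h \<Rightarrow> complex)"
proof
  fix a a' b b' :: 'h and r :: real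
  show "cinner (a + a') b = cinner a b + cinner a' b" by (rule cinner_add_left)
  show "cinner a (b + b') = cinner a b + cinner a b'" by (rule cinner_add_right)
  show "cinner (r *\<^sub>R a) b = r *\<^sub>R cinner a b"
    by (simp add: scaleC_of_real[symmetric] cinner_scaleC_left scaleR_conv_of_real)
  show "cinner a (r *\<^sub>R b) = r *\<^sub>R cinner a b"
    by (simp add: scaleC_of_real[symmetric] cinner_scaleC_right scaleR_conv_of_real)
  show "\<exists>K. \<forall>a b::'h. norm (cinner a b) \<le> norm a * norm b * K"
    by (rule exI[of _ 1]) (simp add: norm_cinner_le)
qed

lemma cinner_eqI: "x = y" if "\<And>z. cinner x z = cinner y (z::'h::complex_hilbert_space)"
proof -
  have "cinner (x - y) (x - y) = 0" using that by (simp add: cinner_diff_left)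
  then show ?thesis by (simp add: cinner_same)
qed

lemma cinner_eqI2: "x = y" if "\<And>z. cinner z x = cinner z (y::'h::complex_hilbert_space)"
  by (rule cinner_eqI) (metis cinner_commute that)

lemma norm_diff_sq: "(norm (x - y))\<^sup>2 = (norm x)\<^sup>2 - 2 * Re (cinner x y) + (norm (y::'h::complex_hilbert_space))\<^sup>2"
  by (simp add: power2_norm_eq_inner inner_diff_left inner_diff_right inner_commute[of y x]
      inner_eq_Re_cinner[of x y])

lemma parallelogram_law:
  "(norm (x + y))\<^sup>2 + (norm (x - y))\<^sup>2 = 2 * (norm x)\<^sup>2 + 2 * (norm (y::'a::real_inner))\<^sup>2"
  by (simp add: power2_norm_eq_inner inner_simps)

lemma norm_diff_scaleR_sq:
  fixes u z :: "'a::real_inner"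
  shows "(norm (u - t *\<^sub>R z))\<^sup>2 = (norm u)\<^sup>2 - 2 * t * inner u z + t\<^sup>2 * inner z z"
proof -
  have "inner (u - t *\<^sub>R z) (u - t *\<^sub>R z) = inner u u - t * inner u z - (t * inner z u - t * (t * inner z z))"
    by (simp only: inner_diff_left inner_diff_right inner_scaleR_left inner_scaleR_right right_diff_distrib)
  then show ?thesis
    unfolding power2_norm_eq_inner by (simp add: inner_commute[of z u] power2_eq_square)
qed

lemma norm_sum_orthogonal:
  fixes f :: "'i \<Rightarrow> 'a::real_inner"
  assumes "finite F" "\<And>i j. i \<in> F \<Longrightarrow> j \<in> F \<Longrightarrow> i \<noteq> j \<Longrightarrow> inner (f i) (f j) = 0"
  shows "(norm (\<Sum>i\<in>F. f i))\<^sup>2 = (\<Sum>i\<in>F. (norm (f i))\<^sup>2)"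
  using assms
proof (induction F rule: finite_induct)
  case (insert i F)
  have "inner (f i) (\<Sum>j\<in>F. f j) = 0"
    using insert by (force simp: inner_sum_right intro!: sum.neutral)
  then show ?case
    using insert by (simp add: power2_norm_eq_inner inner_simps inner_commute)
qed simp

lemma csubspace_imp_subspace: "csubspace S \<Longrightarrow> subspace S"
  unfolding csubspace_def subspace_def by (metis scaleC_of_real)

lemma csubspace_diff: "csubspace S \<Longrightarrow> x \<in> S \<Longrightarrow> y \<in> S \<Longrightarrow> x - y \<in> S"
  by (simp add: csubspace_imp_subspace subspace_diff)

lemma csubspace_sum: "csubspace S \<Longrightarrow> (\<And>i. i \<in> I \<Longrightarrow> f i \<in> S) \<Longrightarrow> (\<Sum>i\<in>I. f i) \<in> S"
  by (simp add: csubspace_imp_subspace subspace_sum)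

text \<open>A minimizing sequence is Cauchy: the midpoint of two of its terms lies in
  \<open>S\<close>, hence at distance at least \<open>d\<close> from \<open>x\<close>, and the
  parallelogram law then bounds the gap between the terms.\<close>

lemma closed_subspace_nearest:
  fixes S :: "'a::{real_inner, complete_space} set"
  assumes S: "subspace S" "closed S"
  obtains y where "y \<in> S" "\<And>z. z \<in> S \<Longrightarrow> norm (x - y) \<le> norm (x - z)"
proof -
  have ne: "S \<noteq> {}" using subspace_0[OF S(1)] by blast
  define d where "d = Inf ((\<lambda>z. norm (x - z)) ` S)"
  have d_le: "d \<le> norm (x - z)" if "z \<in> S" for z
    unfolding d_def using that by (intro cInf_lower) (auto intro!: bdd_belowI[of _ 0])
  have d0: "0 \<le> d" unfolding d_def using ne by (intro cInf_greatest) auto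
  have "\<exists>z\<in>S. norm (x - z) < d + 1 / real (Suc n)" for n
  proof (rule ccontr)
    assume "\<not> ?thesis"
    then have "d + 1 / real (Suc n) \<le> d"
      unfolding d_def using ne by (intro cInf_greatest) (auto simp: not_less)
    then show False by (simp add: field_simps)
  qed
  then obtain y where y: "\<And>n. y n \<in> S" "\<And>n. norm (x - y n) < d + 1 / real (Suc n)" by metis
  have lim: "(\<lambda>n. norm (x - y n)) \<longlonglongrightarrow> d"
  proof (rule tendsto_sandwich)
    show "\<forall>\<^sub>F n in sequentially. d \<le> norm (x - y n)" using d_le y(1) by simp
    show "\<forall>\<^sub>F n in sequentially. norm (x - y n) \<le> d + 1 / real (Suc n)"
      using y(2) by (simp add: less_imp_le)
    show "(\<lambda>n. d + 1 / real (Suc n)) \<longlonglongrightarrow> d"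
      using tendsto_add[OF tendsto_const LIMSEQ_inverse_real_of_nat, of d] by (simp add: inverse_eq_divide)
  qed simp
  have est: "(norm (y m - y n))\<^sup>2 \<le> 2 * (norm (x - y m))\<^sup>2 + 2 * (norm (x - y n))\<^sup>2 - 4 * d\<^sup>2" for m n
  proof -
    have "(1/2) *\<^sub>R (y m + y n) \<in> S"
      using y(1) S(1) by (simp add: subspace_add subspace_scale)
    from d_le[OF this] have "2 * d \<le> norm (2 *\<^sub>R (x - (1/2) *\<^sub>R (y m + y n)))" by simp
    also have "2 *\<^sub>R (x - (1/2) *\<^sub>R (y m + y n)) = (x - y m) + (x - y n)"
      by (simp add: algebra_simps scaleR_2)
    finally have "(2 * d)\<^sup>2 \<le> (norm ((x - y m) + (x - y n)))\<^sup>2"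
      using d0 by (intro power_mono) auto
    moreover have "norm ((x - y m) - (x - y n)) = norm (y m - y n)"
      by (simp add: norm_minus_commute)
    ultimately show ?thesis
      using parallelogram_law[of "x - y m" "x - y n"] by (simp add: power_mult_distrib)
  qed
  have "Cauchy y"
  proof (rule metric_CauchyI)
    fix e :: real assume e: "0 < e"
    \<comment> \<open>Each of the two squared distances enters \<open>est\<close> with factor 2, so
      an excess of a quarter of the squared tolerance in each is exactly affordable.\<close>
    have "(\<lambda>n. (norm (x - y n))\<^sup>2) \<longlonglongrightarrow> d\<^sup>2" by (intro tendsto_intros lim)
    from order_tendstoD(2)[OF this, of "d\<^sup>2 + e\<^sup>2 / 4"] e
    obtain M where M: "\<And>n. n \<ge> M \<Longrightarrow> (norm (x - y n))\<^sup>2 < d\<^sup>2 + e\<^sup>2 / 4"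
      by (auto simp: eventually_sequentially)
    have "dist (y m) (y n) < e" if "m \<ge> M" "n \<ge> M" for m n
    proof -
      have "(norm (y m - y n))\<^sup>2 < e\<^sup>2"
        using est[of m n] M[OF that(1)] M[OF that(2)] by simp
      then show ?thesis using e by (simp add: dist_norm power_less_imp_less_base)
    qed
    then show "\<exists>M. \<forall>m\<ge>M. \<forall>n\<ge>M. dist (y m) (y n) < e" by blast
  qed
  then obtain l where l: "y \<longlonglongrightarrow> l" by (metis Cauchy_convergent convergent_def)
  have "l \<in> S" using closed_sequentially[OF S(2) _ l] y(1) by blast
  moreover have "norm (x - l) = d"
    using LIMSEQ_unique[OF tendsto_norm[OF tendsto_diff[OF tendsto_const l]] lim] .
  ultimately show ?thesis using that d_le by metis
qed

text \<open>Real perturbations of the nearest point kill the real inner product with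
  \<open>z\<close>; applying this to \<i> times \<open>z\<close> kills the imaginary part.\<close>

lemma orthogonal_decomposition:
  fixes S :: "'h::complex_hilbert_space set"
  assumes S: "csubspace S" "closed S"
  obtains y where "y \<in> S" "\<And>z. z \<in> S \<Longrightarrow> cinner (x - y) z = 0"
proof -
  note sub = csubspace_imp_subspace[OF S(1)]
  obtain y where y: "y \<in> S" "\<And>z. z \<in> S \<Longrightarrow> norm (x - y) \<le> norm (x - z)"
    using closed_subspace_nearest[OF sub S(2)] by blast
  have inn: "inner (x - y) z = 0" if "z \<in> S" for z
  proof -
    \<comment> \<open>The minimizer of the quadratic polynomial in
      \<open>norm_diff_scaleR_sq\<close>.\<close>
    define t where "t = inner (x - y) z / inner z z"
    show ?thesis
    proof (cases "z = 0")
      case False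
      then have zz: "inner z z > 0" by simp
      have "y + t *\<^sub>R z \<in> S" using that y(1) sub by (simp add: subspace_add subspace_scale)
      from y(2)[OF this] have "(norm (x - y))\<^sup>2 \<le> (norm (x - (y + t *\<^sub>R z)))\<^sup>2"
        by (intro power_mono) auto
      also have "x - (y + t *\<^sub>R z) = (x - y) - t *\<^sub>R z" by simp
      also have "(norm \<dots>)\<^sup>2 = (norm (x - y))\<^sup>2 - 2 * t * inner (x - y) z + t\<^sup>2 * inner z z"
        by (rule norm_diff_scaleR_sq)
      finally have "2 * t * inner (x - y) z \<le> t\<^sup>2 * inner z z" by simp
      then have "2 * (inner (x - y) z)\<^sup>2 / inner z z \<le> (inner (x - y) z)\<^sup>2 / inner z z"
        using zz by (simp add: t_def power2_eq_square)
      then have "(inner (x - y) z)\<^sup>2 \<le> 0"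
        using zz by (simp add: divide_le_cancel)
      then show ?thesis by simp
    qed simp
  qed
  have "cinner (x - y) z = 0" if "z \<in> S" for z
  proof (rule complex_eqI)
    have "scaleC \<i> z \<in> S" using S(1) that by (simp add: csubspace_def)
    from inn[OF this] show "Im (cinner (x - y) z) = Im 0"
      by (simp add: inner_eq_Re_cinner cinner_scaleC_right)
    show "Re (cinner (x - y) z) = Re 0"
      using inn[OF that] by (simp add: inner_eq_Re_cinner)
  qed
  with y(1) show ?thesis by (rule that)
qed

text \<open>A vector \<open>u\<close> orthogonal to the kernel of \<open>f\<close> represents
  \<open>f\<close> up to a scalar, because subtracting \<open>(f x / f u) u\<close> from
  \<open>x\<close> lands in the kernel.\<close>

lemma riesz_representation:
  fixes f :: "'h::complex_hilbert_space \<Rightarrow> complex"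
  assumes add: "\<And>x y. f (x + y) = f x + f y"
    and scale: "\<And>c x. f (scaleC c x) = c * f x"
    and bound: "\<And>x. cmod (f x) \<le> K * norm x"
  obtains y where "\<And>x. f x = cinner x y"
proof (cases "\<forall>x. f x = 0")
  case True
  then show ?thesis by (intro that[of 0]) simp
next
  case False
  then obtain x0 where x0: "f x0 \<noteq> 0" by blast
  have "bounded_linear f"
  proof (rule bounded_linear_intro[where K = K])
    show "f (r *\<^sub>R x) = r *\<^sub>R f x" for r x
      by (simp add: scaleC_of_real[symmetric] scale scaleR_conv_of_real)
  qed (use add bound in \<open>simp_all add: mult.commute\<close>)
  then have cont: "continuous_on UNIV f" by (rule linear_continuous_on)
  define S where "S = {x. f x = 0}"
  have f0: "f 0 = 0" using scale[of 0 0] by simp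
  have S: "csubspace S" unfolding csubspace_def S_def by (simp add: add scale f0)
  have "closed S" unfolding S_def using cont by (intro closed_Collect_eq) auto
  then obtain p where p: "p \<in> S" "\<And>z. z \<in> S \<Longrightarrow> cinner (x0 - p) z = 0"
    using orthogonal_decomposition[OF S] by blast
  define u where "u = x0 - p"
  have "f u = f x0"
    using add[of "x0 - p" p] p(1) by (simp add: u_def S_def)
  then have fu: "f u \<noteq> 0" using x0 by simp
  have "u \<noteq> 0" using fu f0 by auto
  then have nu: "cinner u u \<noteq> 0" by (simp add: cinner_same)
  have key: "f x * cinner u u = f u * cinner x u" for x
  proof -
    have "f (x + scaleC (- (f x / f u)) u) = 0"
      by (simp only: add scale) (use fu in simp)
    then have "x + scaleC (- (f x / f u)) u \<in> S" by (simp add: S_def)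
    then have "cinner u (x + scaleC (- (f x / f u)) u) = 0" using p(2) u_def by blast
    then have "cinner (x + scaleC (- (f x / f u)) u) u = 0"
      by (metis cinner_commute complex_cnj_zero)
    then have "cinner x u = f x / f u * cinner u u"
      by (simp add: cinner_add_left cinner_scaleC_left)
    then show ?thesis using fu by simp
  qed
  show ?thesis
  proof (rule that)
    fix x show "f x = cinner x (scaleC (cnj (f u / cinner u u)) u)"
      using key[of x] nu by (simp add: cinner_scaleC_right field_simps)
  qed
qed

section \<open>Operators and adjoints\<close>

lemma B_opsD: "T \<in> B_ops \<Longrightarrow> blinfun_apply T (scaleC c x) = scaleC c (blinfun_apply T x)"
  by (simp add: B_ops_def)

text \<open>Source of the operators that are not given by a formula: adjoints, and the operator
  through which an element of the bidual acts on \<open>H\<close>.\<close>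

lemma sesquilinear_form_operator:
  fixes B :: "'h::complex_hilbert_space \<Rightarrow> 'h \<Rightarrow> complex"
  assumes add1: "\<And>x x' y. B (x + x') y = B x y + B x' y"
    and sc1: "\<And>c x y. B (scaleC c x) y = c * B x y"
    and add2: "\<And>x y y'. B x (y + y') = B x y + B x y'"
    and sc2: "\<And>c x y. B x (scaleC c y) = cnj c * B x y"
    and bound: "\<And>x y. cmod (B x y) \<le> K * norm x * norm y"
  obtains T where "T \<in> B_ops" "\<And>x y. cinner (blinfun_apply T x) y = B x y" "norm T \<le> \<bar>K\<bar>"
proof -
  have "\<exists>t. \<forall>y. B x y = cinner t y" for x
  proof -
    \<comment> \<open>\<open>B x\<close> is conjugate linear in its second argument, so Riesz
      applies to its conjugate.\<close>
    obtain t where t: "\<And>y. cnj (B x y) = cinner y t"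
      by (rule riesz_representation[of "\<lambda>y. cnj (B x y)" "K * norm x"])
        (use bound[of x] in \<open>simp_all add: add2 sc2\<close>)
    then have "B x y = cinner t y" for y
      by (metis cinner_commute complex_cnj_cnj)
    then show ?thesis by blast
  qed
  then obtain t where t: "\<And>x y. B x y = cinner (t x) y" by metis
  have add: "t (x + x') = t x + t x'" for x x'
    by (rule cinner_eqI) (simp add: t[symmetric] add1 cinner_add_left)
  have sc: "t (scaleC c x) = scaleC c (t x)" for c x
    by (rule cinner_eqI) (simp add: t[symmetric] sc1 cinner_scaleC_left)
  have bd: "norm (t x) \<le> norm x * \<bar>K\<bar>" for x
  proof (cases "t x = 0")
    case False
    have "(norm (t x))\<^sup>2 = cmod (B x (t x))"
      by (simp add: t cinner_same norm_power)
    also have "\<dots> \<le> \<bar>K\<bar> * norm x * norm (t x)"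
      by (rule order_trans[OF bound]) (simp add: mult_right_mono)
    finally show ?thesis using False by (simp add: power2_eq_square mult.commute)
  qed simp
  have bl: "bounded_linear t"
  proof (rule bounded_linear_intro[where K = "\<bar>K\<bar>"])
    show "t (r *\<^sub>R x) = r *\<^sub>R t x" for r x
      using sc[of "complex_of_real r" x] by (simp add: scaleC_of_real)
  qed (use add bd in auto)
  show ?thesis
  proof (rule that[of "Blinfun t"])
    show "norm (Blinfun t) \<le> \<bar>K\<bar>"
      by (rule norm_blinfun_bound) (use bd in \<open>simp_all add: bounded_linear_Blinfun_apply[OF bl] mult.commute\<close>)
  qed (simp_all add: B_ops_def bounded_linear_Blinfun_apply[OF bl] sc t)
qed

lemma op_adj_exists:
  assumes "T \<in> B_ops"
  obtains S where "S \<in> B_ops" "\<And>x y. cinner (blinfun_apply T x) y = cinner x (blinfun_apply S y)"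
proof -
  obtain S where S: "S \<in> B_ops" "\<And>x y. cinner (blinfun_apply S x) y = cinner x (blinfun_apply T y)"
  proof (rule sesquilinear_form_operator[of "\<lambda>x y. cinner x (blinfun_apply T y)" "norm T"])
    show "cmod (cinner x (blinfun_apply T y)) \<le> norm T * norm x * norm y" for x y
      using order_trans[OF norm_cinner_le[of x "blinfun_apply T y"] mult_left_mono[OF norm_blinfun[of T y] norm_ge_zero[of x]]]
      by (simp add: mult_ac)
  qed (simp_all add: cinner_add_left cinner_add_right cinner_scaleC_left cinner_scaleC_right
      blinfun.add_right B_opsD[OF assms])
  show ?thesis
    by (rule that[OF S(1)]) (metis S(2) cinner_commute)
qed

lemma op_adj_eqI:
  assumes "\<And>x y. cinner (blinfun_apply T x) y = cinner x (blinfun_apply S y)"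
  shows "op_adj T = S"
  unfolding op_adj_def
proof (rule the_equality)
  fix S' assume "\<forall>x y. cinner (blinfun_apply T x) y = cinner x (blinfun_apply S' y)"
  then show "S' = S"
    by (intro blinfun_eqI cinner_eqI2) (metis assms)
qed (use assms in blast)

lemma op_adj_B_ops: "T \<in> B_ops \<Longrightarrow> op_adj T \<in> B_ops"
  and cinner_op_adj_right: "T \<in> B_ops \<Longrightarrow> cinner x (blinfun_apply (op_adj T) y) = cinner (blinfun_apply T x) y"
  by (metis op_adj_exists op_adj_eqI)+

lemma cinner_op_adj_left:
  "T \<in> B_ops \<Longrightarrow> cinner (blinfun_apply (op_adj T) x) y = cinner x (blinfun_apply T y)"
  by (metis cinner_op_adj_right cinner_commute)

lemma B_ops_compose: "S \<in> B_ops \<Longrightarrow> T \<in> B_ops \<Longrightarrow> S o\<^sub>L T \<in> B_ops"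
  by (simp add: B_ops_def)

lemma B_ops_add: "S \<in> B_ops \<Longrightarrow> T \<in> B_ops \<Longrightarrow> S + T \<in> B_ops"
  by (simp add: B_ops_def blinfun.add_left scaleC_add_right)

lemma B_ops_diff: "S \<in> B_ops \<Longrightarrow> T \<in> B_ops \<Longrightarrow> S - T \<in> B_ops"
  by (simp add: B_ops_def blinfun.diff_left scaleC_diff_right)

lemma B_ops_scale: "T \<in> B_ops \<Longrightarrow> op_scale c T \<in> B_ops"
  by (simp add: B_ops_def op_scale_apply scaleC_scaleC mult.commute)

lemma B_ops_zero [simp]: "0 \<in> B_ops"
  by (simp add: B_ops_def)

lemma B_ops_id [simp]: "id_blinfun \<in> B_ops"
  by (simp add: B_ops_def)

lemma op_adj_adj: "T \<in> B_ops \<Longrightarrow> op_adj (op_adj T) = T"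
  by (rule op_adj_eqI) (simp add: cinner_op_adj_left)

lemma op_adj_compose: "S \<in> B_ops \<Longrightarrow> T \<in> B_ops \<Longrightarrow> op_adj (S o\<^sub>L T) = op_adj T o\<^sub>L op_adj S"
  by (rule op_adj_eqI) (simp add: cinner_op_adj_right)

lemma op_adj_add: "S \<in> B_ops \<Longrightarrow> T \<in> B_ops \<Longrightarrow> op_adj (S + T) = op_adj S + op_adj T"
  by (rule op_adj_eqI) (simp add: cinner_op_adj_right blinfun.add_left cinner_add_left cinner_add_right)

lemma op_adj_diff: "S \<in> B_ops \<Longrightarrow> T \<in> B_ops \<Longrightarrow> op_adj (S - T) = op_adj S - op_adj T"
  by (rule op_adj_eqI) (simp add: cinner_op_adj_right blinfun.diff_left cinner_diff_left cinner_diff_right)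

lemma op_adj_scale: "T \<in> B_ops \<Longrightarrow> op_adj (op_scale c T) = op_scale (cnj c) (op_adj T)"
  by (rule op_adj_eqI) (simp add: cinner_op_adj_right op_scale_apply cinner_scaleC_left cinner_scaleC_right)

lemma op_adj_zero [simp]: "op_adj 0 = (0 :: 'h::complex_hilbert_space \<Rightarrow>\<^sub>L 'h)"
  by (rule op_adj_eqI) simp

lemma norm_op_adj_le: "T \<in> B_ops \<Longrightarrow> norm (op_adj T) \<le> norm T"
proof (rule norm_blinfun_bound)
  fix x assume T: "T \<in> B_ops"
  have "(norm (op_adj T x))\<^sup>2 = cmod (cinner (op_adj T x) (op_adj T x))"
    by (simp add: cinner_same norm_power)
  also have "\<dots> = cmod (cinner x (T (op_adj T x)))"
    by (simp add: T cinner_op_adj_left)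
  also have "\<dots> \<le> norm x * (norm T * norm (op_adj T x))"
    by (rule order_trans[OF norm_cinner_le]) (simp add: mult_left_mono norm_blinfun)
  finally show "norm (op_adj T x) \<le> norm T * norm x"
    by (cases "op_adj T x = 0") (simp_all add: power2_eq_square mult_ac)
qed simp

lemma norm_op_adj: "T \<in> B_ops \<Longrightarrow> norm (op_adj T) = norm T"
  by (metis norm_op_adj_le op_adj_adj op_adj_B_ops order_antisym)

lemma norm_op_scale: "norm (op_scale c T) = cmod c * norm T"
proof -
  have le: "norm (op_scale c T) \<le> cmod c * norm T" for c and T :: "'h::complex_hilbert_space \<Rightarrow>\<^sub>L 'h"
    by (rule norm_blinfun_bound)
      (simp_all add: op_scale_apply norm_scaleC mult.assoc mult_left_mono norm_blinfun)
  show ?thesis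
  proof (cases "c = 0")
    case False
    have "T = op_scale (inverse c) (op_scale c T)"
      using False by (intro blinfun_eqI) (simp add: op_scale_apply scaleC_scaleC)
    then have "norm T \<le> cmod (inverse c) * norm (op_scale c T)" using le by metis
    then have "cmod c * norm T \<le> norm (op_scale c T)"
      using False mult_left_mono[of "norm T" "inverse (cmod c) * norm (op_scale c T)" "cmod c"]
      by (simp add: norm_inverse mult.assoc[symmetric])
    with le show ?thesis by (rule order_antisym)
  qed (use le[of 0 T] in simp)
qed

lemma op_scale_simps:
  "op_scale c (S + T) = op_scale c S + op_scale c T"
  "op_scale c (S - T) = op_scale c S - op_scale c T"
  "op_scale (c + d) T = op_scale c T + op_scale d T"
  "op_scale c (op_scale d T) = op_scale (c * d) T"
  "op_scale 1 T = T" "op_scale 0 T = 0" "op_scale c 0 = 0" "op_scale (-1) T = - T"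
  by (rule blinfun_eqI, simp add: op_scale_apply blinfun.bilinear_simps scaleC_add_right scaleC_diff_right
      scaleC_add_left scaleC_scaleC scaleC_minus_one)+

lemma op_scale_compose_left: "op_scale c S o\<^sub>L T = op_scale c (S o\<^sub>L T)"
  by (rule blinfun_eqI) (simp add: op_scale_apply)

lemma op_scale_compose_right: "S \<in> B_ops \<Longrightarrow> S o\<^sub>L op_scale c T = op_scale c (S o\<^sub>L T)"
  by (rule blinfun_eqI) (simp add: op_scale_apply B_opsD)

lemma blinfun_compose_assoc: "(R o\<^sub>L S) o\<^sub>L T = R o\<^sub>L (S o\<^sub>L T)"
  by (rule blinfun_eqI) simp

lemmas blinfun_compose_simps = bounded_bilinear.add_left[OF bounded_bilinear_blinfun_compose]
  bounded_bilinear.add_right[OF bounded_bilinear_blinfun_compose]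
  bounded_bilinear.diff_left[OF bounded_bilinear_blinfun_compose]
  bounded_bilinear.diff_right[OF bounded_bilinear_blinfun_compose]
  bounded_bilinear.minus_left[OF bounded_bilinear_blinfun_compose]
  bounded_bilinear.minus_right[OF bounded_bilinear_blinfun_compose]

lemmas tendsto_blinfun_compose = bounded_bilinear.tendsto[OF bounded_bilinear_blinfun_compose]

lemma orthogonal_projection_norm_le_1:
  assumes "P \<in> B_ops" "P o\<^sub>L P = P" "op_adj P = P"
  shows "norm (blinfun_apply P x) \<le> norm x" "norm P \<le> 1"
proof -
  show le: "norm (blinfun_apply P x) \<le> norm x" for x
  proof -
    have "(norm (P x))\<^sup>2 = cmod (cinner (P x) (P x))" by (simp add: cinner_same norm_power)
    also have "cinner (P x) (P x) = cinner (P (P x)) x"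
      by (metis assms(1,3) cinner_op_adj_left)
    also have "P (P x) = P x" by (metis assms(2) blinfun_apply_blinfun_compose)
    also have "cmod (cinner (P x) x) \<le> norm (P x) * norm x" by (rule norm_cinner_le)
    finally show ?thesis
      by (cases "P x = 0") (simp_all add: power2_eq_square)
  qed
  show "norm P \<le> 1" by (rule norm_blinfun_bound) (simp_all add: le)
qed

section \<open>Ultrafilters\<close>

text \<open>Along an ultrafilter every bounded scalar function converges. This provides weak* limits
  against all functionals at once, with no passage to subnets.\<close>

definition ultra :: "'a filter \<Rightarrow> bool" where
  "ultra U \<longleftrightarrow> U \<noteq> bot \<and> (\<forall>P. eventually P U \<or> eventually (\<lambda>x. \<not> P x) U)"

lemma ultrafilter_exists:
  assumes "F \<noteq> (bot :: 'a filter)"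
  obtains U where "U \<le> F" "ultra U"
proof -
  define \<A> where "\<A> = {G. G \<le> F \<and> G \<noteq> bot}"
  let ?r = "relation_of (\<lambda>a u. u \<le> a) \<A>"
  have "\<exists>m\<in>\<A>. \<forall>a\<in>\<A>. a \<le> m \<longrightarrow> a = m"
  \<comment> \<open>The order is reversed: finer filters count as larger, so an upper bound of a
    chain is its infimum.\<close>
  proof (rule predicate_Zorn)
    show "partial_order_on \<A> ?r"
      by (auto simp: partial_order_on_def preorder_on_def refl_on_def trans_def antisym_def relation_of_def)
    fix C assume C: "C \<in> Chains ?r"
    then have CA: "C \<subseteq> \<A>" and tot: "\<And>a b. a \<in> C \<Longrightarrow> b \<in> C \<Longrightarrow> a \<le> b \<or> b \<le> a"
      unfolding Chains_def relation_of_def by auto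
    show "\<exists>u\<in>\<A>. \<forall>a\<in>C. u \<le> a"
    proof (cases "C = {}")
      case True
      then show ?thesis using assms by (auto simp: \<A>_def)
    next
      case False
      \<comment> \<open>A chain is a filter base, so an event of the infimum is already an event of
        some member. Applied to the false event, this shows that the infimum is proper.\<close>
      have "eventually P (Inf C) \<longleftrightarrow> (\<exists>b\<in>C. eventually P b)" for P
        using False tot by (intro eventually_Inf_base) (metis inf.absorb1 inf.absorb2 order_refl)+
      from this[of "\<lambda>_. False"] have "Inf C \<noteq> bot"
        using CA by (auto simp: trivial_limit_def \<A>_def)
      moreover have "Inf C \<le> F"
        using False CA by (auto simp: \<A>_def intro: Inf_lower2)
      ultimately show ?thesis
        by (intro bexI[of _ "Inf C"]) (auto simp: \<A>_def intro: Inf_lower)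
    qed
  qed
  then obtain m where m: "m \<le> F" "m \<noteq> bot" "\<And>a. a \<le> m \<Longrightarrow> a \<noteq> bot \<Longrightarrow> a = m"
    unfolding \<A>_def by (metis (mono_tags, lifting) mem_Collect_eq order_trans)
  have "eventually P m \<or> eventually (\<lambda>x. \<not> P x) m" for P
  proof (rule disjCI)
    assume n: "\<not> eventually (\<lambda>x. \<not> P x) m"
    have "inf m (principal {x. P x}) \<noteq> bot"
      using n by (auto simp: trivial_limit_def eventually_inf_principal)
    then have "inf m (principal {x. P x}) = m" using m(3) by simp
    moreover have "eventually P (inf m (principal {x. P x}))" by (simp add: eventually_inf_principal)
    ultimately show "eventually P m" by simp
  qed
  with m show ?thesis by (intro that[of m]) (auto simp: ultra_def)
qed

text \<open>Compactness gives a cluster point; the dichotomy of an ultrafilter upgrades it to a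
  limit.\<close>

lemma ultra_tendsto_compact:
  fixes g :: "'a \<Rightarrow> 'b::t2_space"
  assumes U: "ultra U" and K: "compact K" and ev: "\<forall>\<^sub>F x in U. g x \<in> K"
  obtains l where "(g \<longlongrightarrow> l) U"
proof -
  have "filtermap g U \<noteq> bot" using U by (simp add: ultra_def filtermap_bot_iff)
  moreover have "eventually (\<lambda>y. y \<in> K) (filtermap g U)" using ev by (simp add: eventually_filtermap)
  ultimately obtain l where l: "inf (nhds l) (filtermap g U) \<noteq> bot"
    using K unfolding compact_filter by blast
  have "(g \<longlongrightarrow> l) U"
  proof (rule topological_tendstoI)
    fix S assume S: "open S" "l \<in> S"
    have "\<not> eventually (\<lambda>x. g x \<notin> S) U"
    proof
      assume "eventually (\<lambda>x. g x \<notin> S) U"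
      then have "eventually (\<lambda>y. y \<notin> S) (filtermap g U)" by (simp add: eventually_filtermap)
      moreover have "eventually (\<lambda>y. y \<in> S) (nhds l)" using S by (rule eventually_nhds_in_open)
      ultimately have "eventually (\<lambda>_. False) (inf (nhds l) (filtermap g U))"
        unfolding eventually_inf by blast
      with l show False by (simp add: trivial_limit_def)
    qed
    then show "\<forall>\<^sub>F x in U. g x \<in> S" using U by (auto simp: ultra_def)
  qed
  then show ?thesis by (rule that)
qed

section \<open>Functionals on an operator algebra\<close>

lemma restr_in: "x \<in> D \<Longrightarrow> restr D f x = f x"
  by (simp add: restr_def)

lemma op_subspaceD:
  assumes "op_subspace V"
  shows "0 \<in> V" "a \<in> V \<Longrightarrow> b \<in> V \<Longrightarrow> a + b \<in> V" "a \<in> V \<Longrightarrow> op_scale c a \<in> V"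
    "a \<in> V \<Longrightarrow> b \<in> V \<Longrightarrow> a - b \<in> V" "a \<in> V \<Longrightarrow> - a \<in> V"
proof -
  show 1: "0 \<in> V" "a \<in> V \<Longrightarrow> b \<in> V \<Longrightarrow> a + b \<in> V" "a \<in> V \<Longrightarrow> op_scale c a \<in> V" for a b c
    using assms by (auto simp: op_subspace_def)
  show 2: "a \<in> V \<Longrightarrow> - a \<in> V" for a using 1(3)[of a "-1"] by (simp add: op_scale_simps)
  show "a \<in> V \<Longrightarrow> b \<in> V \<Longrightarrow> a - b \<in> V" using 1(2)[of a "-b"] 2 by simp
qed

lemma op_subspace_B_ops: "op_subspace B_ops"
  by (simp add: op_subspace_def B_ops_add B_ops_scale)

lemma op_dualD:
  assumes "f \<in> op_dual A"
  shows "a \<in> A \<Longrightarrow> b \<in> A \<Longrightarrow> f (a + b) = f a + f b" "a \<in> A \<Longrightarrow> f (op_scale c a) = c * f a"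
    "a \<notin> A \<Longrightarrow> f a = 0"
  using assms by (auto simp: op_dual_def)

lemma op_dual_bound:
  assumes "f \<in> op_dual A"
  obtains K where "K \<ge> 0" "\<And>a. cmod (f a) \<le> K * norm a"
proof -
  obtain K where K: "\<And>a. a \<in> A \<Longrightarrow> cmod (f a) \<le> K * norm a"
    using assms unfolding op_dual_def by blast
  have "cmod (f a) \<le> \<bar>K\<bar> * norm a" for a
  proof (cases "a \<in> A")
    case True
    have "cmod (f a) \<le> K * norm a" using K True .
    also have "\<dots> \<le> \<bar>K\<bar> * norm a" by (simp add: mult_right_mono)
    finally show ?thesis .
  next
    case False
    then show ?thesis using op_dualD(3)[OF assms] by simp
  qed
  then show ?thesis using that[of "\<bar>K\<bar>"] by simp
qed

lemma op_dualI:
  assumes "\<And>a b. a \<in> A \<Longrightarrow> b \<in> A \<Longrightarrow> f (a + b) = f a + f b"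
    "\<And>c a. a \<in> A \<Longrightarrow> f (op_scale c a) = c * f a"
    "\<And>a. a \<in> A \<Longrightarrow> cmod (f a) \<le> K * norm a" "\<And>a. a \<notin> A \<Longrightarrow> f a = 0"
  shows "f \<in> op_dual A"
  using assms unfolding op_dual_def by blast

lemma op_dual_zero:
  assumes "f \<in> op_dual A" "op_subspace A"
  shows "f 0 = 0"
  using op_dualD(2)[OF assms(1) op_subspaceD(1)[OF assms(2)], of 0] by (simp add: op_scale_simps)

lemma op_dual_diff:
  assumes "f \<in> op_dual A" "op_subspace A" "a \<in> A" "b \<in> A"
  shows "f (a - b) = f a - f b"
  using op_dualD(1)[OF assms(1), of "a - b" b] op_subspaceD(4)[OF assms(2-4)] assms(4) by simp

lemma op_dual_sum:
  assumes "f \<in> op_dual A" "op_subspace A" "\<And>i. i \<in> I \<Longrightarrow> a i \<in> A"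
  shows "(\<Sum>i\<in>I. a i) \<in> A \<and> f (\<Sum>i\<in>I. a i) = (\<Sum>i\<in>I. f (a i))"
  using assms(3)
  by (induction I rule: infinite_finite_induct)
    (simp_all add: op_dual_zero[OF assms(1,2)] op_subspaceD[OF assms(2)] op_dualD(1)[OF assms(1)])

lemma op_dual_tendsto:
  assumes f: "f \<in> op_dual A" and A: "op_subspace A" "closed A" and F: "F \<noteq> bot"
    and g: "(g \<longlongrightarrow> a) F" "\<forall>\<^sub>F x in F. g x \<in> A"
  shows "((\<lambda>x. f (g x)) \<longlongrightarrow> f a) F"
proof -
  obtain K where K: "K \<ge> 0" "\<And>a. cmod (f a) \<le> K * norm a" using op_dual_bound[OF f] by blast
  have a: "a \<in> A" using Lim_in_closed_set[OF A(2) g(2) F g(1)] .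
  have "((\<lambda>x. f (g x) - f a) \<longlongrightarrow> 0) F"
  proof (rule Lim_null_comparison)
    show "\<forall>\<^sub>F x in F. norm (f (g x) - f a) \<le> K * norm (g x - a)"
      using g(2) by eventually_elim (use K(2) op_dual_diff[OF f A(1) _ a] in metis)
    show "((\<lambda>x. K * norm (g x - a)) \<longlongrightarrow> 0) F"
      using tendsto_mult[OF tendsto_const tendsto_norm[OF LIM_zero[OF g(1)]], of K] by simp
  qed
  then show ?thesis by (rule LIM_zero_cancel)
qed

lemma dual_norm_upper:
  assumes "f \<in> op_dual A" "a \<in> A" "norm a \<le> 1"
  shows "cmod (f a) \<le> dual_norm A f"
proof -
  obtain K where K: "K \<ge> 0" "\<And>a. cmod (f a) \<le> K * norm a" using op_dual_bound[OF assms(1)] by blast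
  have "cmod (f b) \<le> K" if "norm b \<le> 1" for b
    using K(2)[of b] mult_left_mono[OF that K(1)] by simp
  then show ?thesis
    unfolding dual_norm_def using assms by (intro cSup_upper) (auto simp: bdd_above_def)
qed

lemma dual_norm_nonneg:
  assumes "f \<in> op_dual A" "0 \<in> A"
  shows "0 \<le> dual_norm A f"
  using order_trans[OF norm_ge_zero dual_norm_upper[OF assms]] by simp

lemma dual_norm_least:
  assumes "0 \<in> A" "K \<ge> 0" "\<And>a. a \<in> A \<Longrightarrow> cmod (f a) \<le> K * norm a"
  shows "dual_norm A f \<le> K"
  unfolding dual_norm_def
proof (rule cSup_least)
  show "{cmod (f a) |a. a \<in> A \<and> norm a \<le> 1} \<noteq> {}" using assms(1) by force
  fix x assume "x \<in> {cmod (f a) |a. a \<in> A \<and> norm a \<le> 1}"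
  then obtain a where a: "x = cmod (f a)" "a \<in> A" "norm a \<le> 1" by blast
  then show "x \<le> K" using assms(3)[OF a(2)] mult_left_mono[OF a(3) assms(2)] by simp
qed

text \<open>The functionals of the weak operator topology. They separate the elements of
  \<open>A\<close>, and the values of a bidual element on them determine the operator by which it
  acts on \<open>H\<close>.\<close>

definition vector_functional ::
  "('h::complex_hilbert_space \<Rightarrow>\<^sub>L 'h) set \<Rightarrow> 'h \<Rightarrow> 'h \<Rightarrow> ('h \<Rightarrow>\<^sub>L 'h) \<Rightarrow> complex" where
  "vector_functional A x y = restr A (\<lambda>a. cinner (blinfun_apply a x) y)"

lemma vector_functional_bound:
  "cmod (cinner (blinfun_apply a x) y) \<le> norm x * norm y * norm (a :: 'h::complex_hilbert_space \<Rightarrow>\<^sub>L 'h)"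
  using order_trans[OF norm_cinner_le[of "a x" y] mult_right_mono[OF norm_blinfun[of a x] norm_ge_zero[of y]]]
  by (simp add: mult_ac)

lemma vector_functional_dual:
  assumes "op_subspace A"
  shows "vector_functional A x y \<in> op_dual A"
  using op_subspaceD[OF assms]
  by (intro op_dualI[where K = "norm x * norm y"])
    (simp_all add: vector_functional_def restr_def blinfun.add_left cinner_add_left op_scale_apply
      cinner_scaleC_left vector_functional_bound)

lemma vector_functional_dual_norm:
  assumes "op_subspace A"
  shows "dual_norm A (vector_functional A x y) \<le> norm x * norm y"
  using op_subspaceD[OF assms]
  by (intro dual_norm_least) (simp_all add: vector_functional_def restr_def vector_functional_bound)

section \<open>Bidual elements as operators on \<open>H\<close>\<close>

locale op_algebra =
  fixes A :: "('h::complex_hilbert_space \<Rightarrow>\<^sub>L 'h) set"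
  assumes op_algebra: "operator_algebra A"
begin

lemma A_B: "a \<in> A \<Longrightarrow> a \<in> B_ops"
  and A_subspace: "op_subspace A"
  and A_comp: "a \<in> A \<Longrightarrow> b \<in> A \<Longrightarrow> a o\<^sub>L b \<in> A"
  and A_closed: "closed A"
  using op_algebra by (auto simp: operator_algebra_def)

lemmas A_zero = op_subspaceD(1)[OF A_subspace]
  and A_add = op_subspaceD(2)[OF A_subspace]
  and A_scale = op_subspaceD(3)[OF A_subspace]
  and A_diff = op_subspaceD(4)[OF A_subspace]

lemma A_sum: "(\<And>i. i \<in> I \<Longrightarrow> f i \<in> A) \<Longrightarrow> (\<Sum>i\<in>I. f i) \<in> A"
  by (induction I rule: infinite_finite_induct) (simp_all add: A_zero A_add)

lemma canon_eqD:
  assumes "canon A a = canon A b" "a \<in> A" "b \<in> A"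
  shows "a = b"
proof (rule blinfun_eqI, rule cinner_eqI)
  fix x y
  have "canon A a (vector_functional A x y) = canon A b (vector_functional A x y)"
    using assms(1) by simp
  then show "cinner (blinfun_apply a x) y = cinner (blinfun_apply b x) y"
    using vector_functional_dual[OF A_subspace] assms(2,3)
    by (simp add: canon_def restr_def vector_functional_def)
qed

lemma translate_functional_dual:
  assumes "f \<in> op_dual A" "a \<in> A"
  shows "restr A (\<lambda>b. f (a o\<^sub>L b)) \<in> op_dual A"
proof -
  obtain K where K: "K \<ge> 0" "\<And>a. cmod (f a) \<le> K * norm a" using op_dual_bound[OF assms(1)] by blast
  show ?thesis
  proof (rule op_dualI[where K = "K * norm a"])
    show "cmod (restr A (\<lambda>b. f (a o\<^sub>L b)) b) \<le> K * norm a * norm b" if "b \<in> A" for b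
      using that order_trans[OF K(2) mult_left_mono[OF norm_blinfun_compose K(1)]]
      by (simp add: restr_def mult.assoc)
  qed (simp_all add: restr_def A_add A_scale blinfun_compose_simps op_dualD[OF assms(1)] A_comp assms(2)
      op_scale_compose_right[OF A_B])
qed

text \<open>This function of \<open>a\<close> is the argument of the outer bidual element in the
  first Arens product. A bidual element is 0 by convention off the dual, so the product would be
  meaningless without this membership.\<close>

lemma bidual_translate_dual:
  assumes p: "p \<in> op_bidual A" and f: "f \<in> op_dual A"
  shows "restr A (\<lambda>a. p (restr A (\<lambda>b. f (a o\<^sub>L b)))) \<in> op_dual A"
proof -
  obtain K where K: "K \<ge> 0" "\<And>a. cmod (f a) \<le> K * norm a" using op_dual_bound[OF f] by blast
  obtain L where L: "\<And>g. g \<in> op_dual A \<Longrightarrow> cmod (p g) \<le> L * dual_norm A g"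
    using p unfolding op_bidual_def by blast
  have p_add: "p (\<lambda>a. g a + h a) = p g + p h" if "g \<in> op_dual A" "h \<in> op_dual A" for g h
    using p that by (simp add: op_bidual_def)
  have p_sc: "p (\<lambda>a. c * g a) = c * p g" if "g \<in> op_dual A" for g c
    using p that by (simp add: op_bidual_def)
  note tr = translate_functional_dual[OF f]
  show ?thesis
  proof (rule op_dualI[where K = "\<bar>L\<bar> * K"])
    fix a b assume ab: "a \<in> A" "b \<in> A"
    have "restr A (\<lambda>c. f ((a + b) o\<^sub>L c)) = (\<lambda>c. restr A (\<lambda>c. f (a o\<^sub>L c)) c + restr A (\<lambda>c. f (b o\<^sub>L c)) c)"
      using ab by (auto simp: restr_def blinfun_compose_simps op_dualD(1)[OF f] A_comp)
    then show "restr A (\<lambda>a. p (restr A (\<lambda>b. f (a o\<^sub>L b)))) (a + b) =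
      restr A (\<lambda>a. p (restr A (\<lambda>b. f (a o\<^sub>L b)))) a + restr A (\<lambda>a. p (restr A (\<lambda>b. f (a o\<^sub>L b)))) b"
      using ab A_add p_add[OF tr[OF ab(1)] tr[OF ab(2)]] by (simp add: restr_def[of A "\<lambda>a. p (f' a)" for f'])
  next
    fix a c assume a: "a \<in> A"
    have "restr A (\<lambda>d. f (op_scale c a o\<^sub>L d)) = (\<lambda>d. c * restr A (\<lambda>d. f (a o\<^sub>L d)) d)"
      using a by (auto simp: restr_def op_scale_compose_left op_dualD(2)[OF f] A_comp)
    then show "restr A (\<lambda>a. p (restr A (\<lambda>b. f (a o\<^sub>L b)))) (op_scale c a) =
      c * restr A (\<lambda>a. p (restr A (\<lambda>b. f (a o\<^sub>L b)))) a"
      using a A_scale p_sc[OF tr[OF a]] by (simp add: restr_def[of A "\<lambda>a. p (f' a)" for f'])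
  next
    fix a assume a: "a \<in> A"
    have "dual_norm A (restr A (\<lambda>d. f (a o\<^sub>L d))) \<le> K * norm a"
      using order_trans[OF K(2) mult_left_mono[OF norm_blinfun_compose K(1)]]
      by (intro dual_norm_least) (simp_all add: A_zero K(1) restr_def mult.assoc)
    moreover have "0 \<le> dual_norm A (restr A (\<lambda>d. f (a o\<^sub>L d)))"
      by (rule dual_norm_nonneg[OF tr[OF a] A_zero])
    ultimately have "L * dual_norm A (restr A (\<lambda>d. f (a o\<^sub>L d))) \<le> \<bar>L\<bar> * (K * norm a)"
      by (intro mult_mono) auto
    with L[OF tr[OF a]] a show "cmod (restr A (\<lambda>a. p (restr A (\<lambda>b. f (a o\<^sub>L b)))) a) \<le> \<bar>L\<bar> * K * norm a"
      by (simp add: restr_def[of A "\<lambda>a. p (f' a)" for f'] mult.assoc)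
  qed (simp add: restr_def)
qed

lemma translate_vector_functional:
  assumes "a \<in> A"
  shows "restr A (\<lambda>b. vector_functional A x y (a o\<^sub>L b)) = vector_functional A x (blinfun_apply (op_adj a) y)"
  using assms by (auto simp: vector_functional_def restr_def A_comp cinner_op_adj_right A_B)

text \<open>Restricting \<open>p\<close> to vector functionals gives a bounded sesquilinear form,
  since the dual norm of such a functional is at most \<open>norm x * norm y\<close>.\<close>

lemma bidual_operator:
  assumes p: "p \<in> op_bidual A"
  obtains P where "P \<in> B_ops" "\<And>x y. p (vector_functional A x y) = cinner (blinfun_apply P x) y"
proof -
  obtain L where L: "\<And>g. g \<in> op_dual A \<Longrightarrow> cmod (p g) \<le> L * dual_norm A g"
    using p unfolding op_bidual_def by blast
  have p_add: "p (\<lambda>a. g a + h a) = p g + p h" if "g \<in> op_dual A" "h \<in> op_dual A" for g h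
    using p that by (simp add: op_bidual_def)
  have p_sc: "p (\<lambda>a. c * g a) = c * p g" if "g \<in> op_dual A" for g c
    using p that by (simp add: op_bidual_def)
  note vd = vector_functional_dual[OF A_subspace]
  show ?thesis
  proof (rule sesquilinear_form_operator[of "\<lambda>x y. p (vector_functional A x y)" "\<bar>L\<bar>"])
    show "p (vector_functional A (x + x') y) = p (vector_functional A x y) + p (vector_functional A x' y)" for x x' y
      unfolding p_add[OF vd vd, symmetric]
      by (rule arg_cong[of _ _ p]) (auto simp: vector_functional_def restr_def blinfun.add_right cinner_add_left)
    show "p (vector_functional A x (y + y')) = p (vector_functional A x y) + p (vector_functional A x y')" for x y y'
      unfolding p_add[OF vd vd, symmetric]
      by (rule arg_cong[of _ _ p]) (auto simp: vector_functional_def restr_def cinner_add_right)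
    show "p (vector_functional A (scaleC c x) y) = c * p (vector_functional A x y)" for c x y
      unfolding p_sc[OF vd, symmetric]
      by (rule arg_cong[of _ _ p]) (auto simp: vector_functional_def restr_def B_opsD[OF A_B] cinner_scaleC_left)
    show "p (vector_functional A x (scaleC c y)) = cnj c * p (vector_functional A x y)" for c x y
      unfolding p_sc[OF vd, symmetric]
      by (rule arg_cong[of _ _ p]) (auto simp: vector_functional_def restr_def cinner_scaleC_right)
    show "cmod (p (vector_functional A x y)) \<le> \<bar>L\<bar> * norm x * norm y" for x y
    proof -
      have "0 \<le> dual_norm A (vector_functional A x y)"
        by (rule dual_norm_nonneg[OF vd A_zero])
      then have "L * dual_norm A (vector_functional A x y) \<le> \<bar>L\<bar> * (norm x * norm y)"
        using vector_functional_dual_norm[OF A_subspace] by (intro mult_mono) auto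
      with L[OF vd, of x y] show ?thesis by (simp add: mult.assoc)
    qed
  next
    fix T assume T: "T \<in> B_ops" "\<And>x y. cinner (blinfun_apply T x) y = p (vector_functional A x y)"
    show thesis by (rule that[of T]) (simp_all add: T)
  qed
qed

text \<open>Translating a vector functional by \<open>a\<close> moves the adjoint of
  \<open>a\<close>, taken in \<open>B_ops\<close>, onto the second vector and so yields a vector
  functional again. Hence the Arens product acts on \<open>H\<close> as the product of operators;
  \<open>arens_self_vector\<close> is the same computation for \<open>p\<close> with itself.\<close>

lemma arens_canon_left_vector:
  assumes "a \<in> A" "\<And>x y. p (vector_functional A x y) = cinner (blinfun_apply P x) y"
  shows "arens A (canon A a) p (vector_functional A x y) = cinner (blinfun_apply (a o\<^sub>L P) x) y"
proof -
  have eq: "restr A (\<lambda>b. p (restr A (\<lambda>d. vector_functional A x y (b o\<^sub>L d)))) =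
      vector_functional A (blinfun_apply P x) y"
    by (auto simp: restr_def[of A "\<lambda>a. p (f' a)" for f'] translate_vector_functional assms(2)
        vector_functional_def[of A "blinfun_apply P x"] restr_def[of A "\<lambda>a. cinner (f' a) y" for f'] cinner_op_adj_right A_B)
  show ?thesis
    using assms(1) vector_functional_dual[OF A_subspace]
    by (simp add: arens_def restr_def[of "op_dual A"] eq canon_def)
      (simp add: vector_functional_def restr_def)
qed

lemma arens_self_vector:
  assumes "\<And>x y. p (vector_functional A x y) = cinner (blinfun_apply P x) y"
  shows "arens A p p (vector_functional A x y) = cinner (blinfun_apply (P o\<^sub>L P) x) y"
proof -
  have eq: "restr A (\<lambda>b. p (restr A (\<lambda>d. vector_functional A x y (b o\<^sub>L d)))) =
      vector_functional A (blinfun_apply P x) y"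
    by (auto simp: restr_def[of A "\<lambda>a. p (f' a)" for f'] translate_vector_functional assms
        vector_functional_def[of A "blinfun_apply P x"] restr_def[of A "\<lambda>a. cinner (f' a) y" for f'] cinner_op_adj_right A_B)
  show ?thesis
    using vector_functional_dual[OF A_subspace]
    by (simp add: arens_def restr_def[of "op_dual A"] eq assms)
qed

lemma arens_canon_right:
  assumes "a \<in> A" "f \<in> op_dual A"
  shows "arens A p (canon A a) f = p (restr A (\<lambda>b. f (b o\<^sub>L a)))"
proof -
  have "canon A a (restr A (\<lambda>d. f (b o\<^sub>L d))) = f (b o\<^sub>L a)" if "b \<in> A" for b
    using translate_functional_dual[OF assms(2) that] assms(1) by (simp add: canon_def restr_in)
  then have "restr A (\<lambda>b. canon A a (restr A (\<lambda>d. f (b o\<^sub>L d)))) = restr A (\<lambda>b. f (b o\<^sub>L a))"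
    by (auto simp: restr_def[of A "\<lambda>b. canon A a (f' b)" for f'] restr_def[of A "\<lambda>b. f (b o\<^sub>L a)"])
  then show ?thesis using assms(2) by (simp add: arens_def restr_def[of "op_dual A"])
qed

lemma orth_projection_operator:
  assumes p: "p \<in> op_bidual A" "orth_projection A p"
    and P: "P \<in> B_ops" "\<And>x y. p (vector_functional A x y) = cinner (blinfun_apply P x) y"
  shows "P o\<^sub>L P = P" "op_adj P = P"
proof -
  show "P o\<^sub>L P = P"
    using p(2) arens_self_vector[of p P, OF P(2)]
    by (intro blinfun_eqI cinner_eqI) (metis orth_projection_def P(2))
  show "op_adj P = P"
  proof (rule op_adj_eqI)
    fix x y :: 'h
    let ?\<phi> = "vector_functional (B_ops :: ('h \<Rightarrow>\<^sub>L 'h) set) x y"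
    have "?\<phi> \<in> op_dual B_ops" by (rule vector_functional_dual[OF op_subspace_B_ops])
    then have "cnj (p (restr A (functional_adj ?\<phi>))) = p (restr A ?\<phi>)"
      using p(2) by (simp add: orth_projection_def)
    moreover have "restr A ?\<phi> = vector_functional A x y"
      by (auto simp: vector_functional_def restr_def A_B)
    \<comment> \<open>The adjoint of a vector functional is the vector functional with its two
      vectors exchanged.\<close>
    moreover have "functional_adj ?\<phi> a = cinner (a y) x" if "a \<in> A" for a
      using A_B[OF that]
      by (simp add: vector_functional_def restr_in functional_adj_def op_adj_B_ops cinner_op_adj_left
          cinner_commute[of x])
    then have "restr A (functional_adj ?\<phi>) = vector_functional A y x"
      by (auto simp: vector_functional_def restr_def[of A])
    ultimately show "cinner (P x) y = cinner x (P y)"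
      using P(2) by (metis cinner_commute)
  qed
qed

text \<open>The last two conclusions transfer one-sided relations that hold throughout
  \<open>A\<close> to \<open>P\<close>: \<open>p\<close> depends only on the restrictions of vector
  functionals to \<open>A\<close>, and under such a relation these restrictions coincide or vanish.
  They play the role of \<open>P\<close> being a weak limit of elements of \<open>A\<close>.\<close>

lemma multiplier_operator:
  assumes p: "p \<in> multiplier_algebra A" "orth_projection A p"
  obtains P where "P \<in> B_ops" "P o\<^sub>L P = P" "op_adj P = P"
    "\<And>a. a \<in> A \<Longrightarrow> a o\<^sub>L P \<in> A" "\<And>a. a \<in> A \<Longrightarrow> P o\<^sub>L a \<in> A"
    "\<And>a. a \<in> A \<Longrightarrow> arens A (canon A a) p = canon A (a o\<^sub>L P)"
    "\<And>S. S \<in> B_ops \<Longrightarrow> (\<And>a. a \<in> A \<Longrightarrow> S o\<^sub>L a = a) \<Longrightarrow> S o\<^sub>L P = P"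
    "\<And>D :: 'h \<Rightarrow>\<^sub>L 'h. (\<And>a. a \<in> A \<Longrightarrow> a o\<^sub>L D = 0) \<Longrightarrow> P o\<^sub>L D = 0"
proof -
  have pb: "p \<in> op_bidual A" using p(1) by (simp add: multiplier_algebra_def)
  obtain P where P: "P \<in> B_ops" "\<And>x y. p (vector_functional A x y) = cinner (blinfun_apply P x) y"
    using bidual_operator[OF pb] by blast
  note vd = vector_functional_dual[OF A_subspace]
  have aP: "a o\<^sub>L P \<in> A \<and> arens A (canon A a) p = canon A (a o\<^sub>L P)" if a: "a \<in> A" for a
  proof -
    obtain c where c: "c \<in> A" "arens A (canon A a) p = canon A c"
      using p(1) a by (auto simp: multiplier_algebra_def)
    have "c = a o\<^sub>L P"
    proof (intro blinfun_eqI cinner_eqI)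
      fix x y
      have "cinner (blinfun_apply (a o\<^sub>L P) x) y = canon A c (vector_functional A x y)" for x y
        using arens_canon_left_vector[OF a P(2)] c(2) by simp
      then show "cinner (blinfun_apply c x) y = cinner (blinfun_apply (a o\<^sub>L P) x) y"
        using vd c(1) by (simp add: canon_def restr_def vector_functional_def)
    qed
    with c show ?thesis by simp
  qed
  have Pa: "P o\<^sub>L a \<in> A" if a: "a \<in> A" for a
  proof -
    obtain c where c: "c \<in> A" "arens A p (canon A a) = canon A c"
      using p(1) a by (auto simp: multiplier_algebra_def)
    have "c = P o\<^sub>L a"
    proof (intro blinfun_eqI cinner_eqI)
      fix x y
      have "restr A (\<lambda>b. vector_functional A x y (b o\<^sub>L a)) = vector_functional A (a x) y"
        using a by (auto simp: vector_functional_def restr_def A_comp)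
      then have "cinner (P (a x)) y = canon A c (vector_functional A x y)"
        using arens_canon_right[OF a vd, of p x y] c(2) P(2) by simp
      then show "cinner (blinfun_apply c x) y = cinner (blinfun_apply (P o\<^sub>L a) x) y"
        using vd c(1) by (simp add: canon_def restr_def vector_functional_def)
    qed
    with c show ?thesis by simp
  qed
  have SP: "S o\<^sub>L P = P" if S: "S \<in> B_ops" "\<And>a. a \<in> A \<Longrightarrow> S o\<^sub>L a = a" for S
  proof (intro blinfun_eqI cinner_eqI)
    fix x y
    have "cinner (a x) (op_adj S y) = cinner (a x) y" if "a \<in> A" for a
      by (metis S cinner_op_adj_right that blinfun_apply_blinfun_compose)
    then have "vector_functional A x (op_adj S y) = vector_functional A x y"
      by (auto simp: vector_functional_def restr_def)
    then show "cinner (blinfun_apply (S o\<^sub>L P) x) y = cinner (blinfun_apply P x) y"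
      by (simp add: P(2)[symmetric] cinner_op_adj_right[OF S(1), symmetric])
  qed
  have PD: "P o\<^sub>L D = 0" if "\<And>a. a \<in> A \<Longrightarrow> a o\<^sub>L D = 0" for D :: "'h \<Rightarrow>\<^sub>L 'h"
  proof (intro blinfun_eqI cinner_eqI)
    fix x y
    have "blinfun_apply a (D x) = 0" if "a \<in> A" for a
      using \<open>\<And>a. a \<in> A \<Longrightarrow> a o\<^sub>L D = 0\<close>[OF that] by (metis blinfun_apply_blinfun_compose zero_blinfun.rep_eq)
    \<comment> \<open>Written as a multiple by 0 so that homogeneity of \<open>p\<close> gives the
      value 0.\<close>
    then have "vector_functional A (D x) y = (\<lambda>a. 0 * vector_functional A (D x) y a)"
      by (auto simp: vector_functional_def restr_def)
    moreover have "p (\<lambda>a. 0 * vector_functional A (D x) y a) = 0 * p (vector_functional A (D x) y)"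
      using pb vd[of "D x" y] unfolding op_bidual_def by blast
    ultimately have "p (vector_functional A (D x) y) = 0" by simp
    then show "cinner (blinfun_apply (P o\<^sub>L D) x) y = cinner (blinfun_apply 0 x) y"
      by (simp add: P(2))
  qed
  show ?thesis
  proof (rule that[OF P(1) orth_projection_operator[OF pb p(2) P]])
    show "S o\<^sub>L P = P" if "S \<in> B_ops" "\<And>a. a \<in> A \<Longrightarrow> S o\<^sub>L a = a" for S
      by (rule SP) (rule that)+
    show "P o\<^sub>L D = 0" if "\<And>a. a \<in> A \<Longrightarrow> a o\<^sub>L D = 0" for D :: "'h \<Rightarrow>\<^sub>L 'h"
      by (rule PD) (rule that)
  qed (use aP Pa in auto)
qed

text \<open>Right multiplication by the operator \<open>P\<close> is the required module map;
  injectivity of \<open>canon\<close> on \<open>A\<close> carries the equation of images from the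
  bidual back to \<open>A\<close>.\<close>

lemma contractively_complemented_of_multiplier:
  assumes J: "left_ideal A J" and p: "p \<in> multiplier_algebra A" "orth_projection A p"
    and eq: "canon A ` J = (\<lambda>a. arens A (canon A a) p) ` A"
  shows "contractively_complemented A J"
proof -
  obtain P where P: "P \<in> B_ops" "P o\<^sub>L P = P" "op_adj P = P" "\<And>a. a \<in> A \<Longrightarrow> a o\<^sub>L P \<in> A"
    "\<And>a. a \<in> A \<Longrightarrow> arens A (canon A a) p = canon A (a o\<^sub>L P)"
    using multiplier_operator[OF p] by metis
  have JA: "J \<subseteq> A" using J by (simp add: left_ideal_def)
  have "canon A ` J = canon A ` (\<lambda>a. a o\<^sub>L P) ` A"
    using eq P(5) by (auto simp: image_image)
  moreover have "inj_on (canon A) A" using canon_eqD by (auto simp: inj_on_def)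
  ultimately have im: "(\<lambda>a. a o\<^sub>L P) ` A = J"
    using JA P(4) by (intro inj_on_image_eq_iff[THEN iffD1, of "canon A" A]) auto
  have "norm (a o\<^sub>L P) \<le> norm a" for a :: "'h \<Rightarrow>\<^sub>L 'h"
    using order_trans[OF norm_blinfun_compose mult_left_mono[OF orthogonal_projection_norm_le_1(2)[OF P(1-3)] norm_ge_zero]]
    by simp
  with im P(4) show ?thesis
    unfolding contractively_complemented_def
    by (intro exI[of _ "\<lambda>a. a o\<^sub>L P"])
      (simp add: blinfun_compose_simps op_scale_compose_left blinfun_compose_assoc P(2))
qed

end

section \<open>Complemented left ideals and multiplier projections\<close>

lemma B_ops_sum: "(\<And>i. i \<in> I \<Longrightarrow> T i \<in> B_ops) \<Longrightarrow> (\<Sum>i\<in>I. T i) \<in> B_ops"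
  by (induction I rule: infinite_finite_induct) (simp_all add: B_ops_add)

lemma op_adj_sum: "(\<And>i. i \<in> I \<Longrightarrow> T i \<in> B_ops) \<Longrightarrow> op_adj (\<Sum>i\<in>I. T i) = (\<Sum>i\<in>I. op_adj (T i))"
  by (induction I rule: infinite_finite_induct) (simp_all add: op_adj_add B_ops_sum)

lemma blinfun_sum_apply: "blinfun_apply (\<Sum>i\<in>I. T i) x = (\<Sum>i\<in>I. blinfun_apply (T i) x)"
  by (induction I rule: infinite_finite_induct) (simp_all add: blinfun.add_left)

text \<open>Up to \<open>\<epsilon>\<close>, the operators \<open>z\<^sub>i\<^sup>* z\<^sub>i\<close> increase with \<open>i\<close>, and
  \<open>\<parallel>(z\<^sub>i\<^sup>* z\<^sub>i - z\<^sub>i\<^sub>+\<^sub>1) x\<parallel>\<^sup>2\<close> is bounded by the increment; so the sum over \<open>i\<close> telescopes.\<close>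

lemma norm_sum_almost_absorbing:
  fixes z :: "nat \<Rightarrow> 'h::complex_hilbert_space \<Rightarrow>\<^sub>L 'h"
  assumes B: "\<And>i. z i \<in> B_ops" and n1: "\<And>i. norm (z i) \<le> 1"
    and ab: "\<And>i. norm ((z i o\<^sub>L z (Suc i)) - z i) \<le> \<epsilon>"
  shows "norm (\<Sum>i<n. (op_adj (z i) o\<^sub>L z i) - z (Suc i)) \<le> sqrt (real n * (1 + 2 * real n * \<epsilon>))"
proof (rule norm_blinfun_bound)
  have e0: "0 \<le> \<epsilon>" using order_trans[OF norm_ge_zero ab] .
  then have nn: "0 \<le> real n * (1 + 2 * real n * \<epsilon>)" by simp
  then show "0 \<le> sqrt (real n * (1 + 2 * real n * \<epsilon>))" by simp
  fix x
  have zx: "norm (z i y) \<le> norm y" for i y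
    using order_trans[OF norm_blinfun mult_right_mono[OF n1 norm_ge_zero]] by simp
  define d where "d i = norm (op_adj (z i) (z i x) - z (Suc i) x)" for i
  have step: "(d i)\<^sup>2 \<le> ((norm (z (Suc i) x))\<^sup>2 - (norm (z i x))\<^sup>2) + 2 * \<epsilon> * (norm x)\<^sup>2" for i
  proof -
    have adj1: "norm (op_adj (z i) (z i x)) \<le> norm (z i x)"
      using order_trans[OF norm_blinfun mult_right_mono[OF _ norm_ge_zero], of "op_adj (z i)" 1 "z i x"]
        n1[of i] B[of i] by (simp add: norm_op_adj)
    \<comment> \<open>\<open>z i\<close> nearly absorbs \<open>z (Suc i)\<close>, so the cross term
      is the squared norm of \<open>z i x\<close> up to \<epsilon>. As the first vector is no longer
      than \<open>z i x\<close>, expanding the square leaves the increment.\<close>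
    have c: "cinner (op_adj (z i) (z i x)) (z (Suc i) x) =
        cinner (z i x) (z i x) + cinner (z i x) (((z i o\<^sub>L z (Suc i)) - z i) x)"
      by (simp add: cinner_op_adj_left B blinfun.diff_left cinner_diff_right)
    have "cmod (cinner (z i x) (((z i o\<^sub>L z (Suc i)) - z i) x)) \<le> norm x * (\<epsilon> * norm x)"
      by (intro order_trans[OF norm_cinner_le] mult_mono zx order_trans[OF norm_blinfun] mult_right_mono ab) auto
    then have "- (\<epsilon> * (norm x)\<^sup>2) \<le> Re (cinner (z i x) (((z i o\<^sub>L z (Suc i)) - z i) x))"
      using abs_Re_le_cmod[of "cinner (z i x) (((z i o\<^sub>L z (Suc i)) - z i) x)"]
      by (simp add: power2_eq_square mult_ac)
    then have "(norm (z i x))\<^sup>2 - \<epsilon> * (norm x)\<^sup>2 \<le> Re (cinner (op_adj (z i) (z i x)) (z (Suc i) x))"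
      unfolding c by (simp add: cinner_same)
    moreover have "(norm (op_adj (z i) (z i x)))\<^sup>2 \<le> (norm (z i x))\<^sup>2"
      using adj1 by (intro power_mono) auto
    ultimately show ?thesis
      unfolding d_def norm_diff_sq by linarith
  qed
  have "(\<Sum>i<n. (d i)\<^sup>2) \<le> (\<Sum>i<n. ((norm (z (Suc i) x))\<^sup>2 - (norm (z i x))\<^sup>2) + 2 * \<epsilon> * (norm x)\<^sup>2)"
    by (intro sum_mono step)
  also have "\<dots> = (norm (z n x))\<^sup>2 - (norm (z 0 x))\<^sup>2 + real n * (2 * \<epsilon> * (norm x)\<^sup>2)"
    by (simp only: sum.distrib sum_lessThan_telescope[of "\<lambda>i. (norm (z i x))\<^sup>2"]) simp
  also have "\<dots> \<le> (norm x)\<^sup>2 + real n * (2 * \<epsilon> * (norm x)\<^sup>2)"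
    using power_mono[OF zx norm_ge_zero, of n x 2] by (simp add: add_increasing2 diff_le_eq)
  finally have S: "(\<Sum>i<n. (d i)\<^sup>2) \<le> (1 + 2 * real n * \<epsilon>) * (norm x)\<^sup>2"
    by (simp add: algebra_simps)
  have "(norm ((\<Sum>i<n. (op_adj (z i) o\<^sub>L z i) - z (Suc i)) x))\<^sup>2 \<le> (\<Sum>i<n. d i)\<^sup>2"
    by (intro power_mono) (simp_all add: blinfun_sum_apply blinfun.diff_left d_def norm_sum)
  \<comment> \<open>Cauchy-Schwarz over the \<open>n\<close> summands: the sum of the squares is
    bounded by telescoping, so the sum itself grows like the square root of \<open>n\<close> instead
    of \<open>n\<close>. This gain makes the averages nearly self-adjoint.\<close>
  also have "\<dots> \<le> (\<Sum>i<n. (d i)\<^sup>2) * real (card {..<n})"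
    by (rule sum_squared_le_sum_of_squares)
  also have "\<dots> \<le> (1 + 2 * real n * \<epsilon>) * (norm x)\<^sup>2 * real n"
    using mult_right_mono[OF S, of "real n"] by simp
  also have "\<dots> = (sqrt (real n * (1 + 2 * real n * \<epsilon>)) * norm x)\<^sup>2"
    using nn by (simp add: power_mult_distrib)
  finally show "norm ((\<Sum>i<n. (op_adj (z i) o\<^sub>L z i) - z (Suc i)) x) \<le> sqrt (real n * (1 + 2 * real n * \<epsilon>)) * norm x"
    by (rule power2_le_imp_le) (use nn in simp)
qed

text \<open>Averages of the operators \<open>g e\<close> are almost self-adjoint in norm, by the telescoping estimate.\<close>

lemma absorbing_limit_self_adjoint:
  fixes \<phi> :: "('h::complex_hilbert_space \<Rightarrow>\<^sub>L 'h) \<Rightarrow> complex"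
  assumes U: "U \<noteq> bot" and \<phi>: "\<phi> \<in> op_dual B_ops"
    and g: "\<forall>\<^sub>F e in U. g e \<in> B_ops \<and> norm (g e) \<le> 1 \<and> ((\<lambda>e'. g e o\<^sub>L g e') \<longlongrightarrow> g e) U"
    and \<alpha>: "((\<lambda>e. \<phi> (g e)) \<longlongrightarrow> \<alpha>) U" and \<beta>: "((\<lambda>e. \<phi> (op_adj (g e))) \<longlongrightarrow> \<beta>) U"
  shows "\<alpha> = \<beta>"
proof -
  obtain K where K: "K \<ge> 0" "\<And>a. cmod (\<phi> a) \<le> K * norm a" using op_dual_bound[OF \<phi>] by blast
  have bound: "cmod (\<alpha> - \<beta>) * sqrt (real n) \<le> 2 + 2 * K * sqrt 3" if n: "n > 0" for n
  proof -
    \<comment> \<open>With this tolerance the \<open>n\<close> errors in the values of \<phi> add up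
      to at most 2, and the factor \<open>1 + 2 * n * \<epsilon>\<close> of the telescoping estimate
      is 3.\<close>
    define \<epsilon> where "\<epsilon> = 1 / real n"
    have e: "\<epsilon> > 0" using n by (simp add: \<epsilon>_def)
    define good where "good u \<longleftrightarrow> u \<in> B_ops \<and> norm u \<le> 1 \<and> ((\<lambda>e'. u o\<^sub>L g e') \<longlongrightarrow> u) U \<and>
      cmod (\<phi> u - \<alpha>) < \<epsilon> \<and> cmod (\<phi> (op_adj u) - \<beta>) < \<epsilon>" for u
    have ev: "\<forall>\<^sub>F e in U. good (g e)"
      using g tendstoD[OF \<alpha> e] tendstoD[OF \<beta> e] by eventually_elim (simp add: good_def dist_norm)
    have ex: "\<exists>v. good v \<and> norm ((u o\<^sub>L v) - u) \<le> \<epsilon>" if "good u" for u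
    proof -
      have "((\<lambda>e'. u o\<^sub>L g e') \<longlongrightarrow> u) U" using that by (simp add: good_def)
      from tendstoD[OF this e] ev have "\<forall>\<^sub>F e in U. good (g e) \<and> norm ((u o\<^sub>L g e) - u) \<le> \<epsilon>"
        by eventually_elim (simp add: dist_norm)
      from eventually_happens'[OF U this] show ?thesis by blast
    qed
    have "\<exists>u. good u" using eventually_happens'[OF U ev] by blast
    then obtain z where z: "\<And>i. good (z i)" "\<And>i. norm ((z i o\<^sub>L z (Suc i)) - z i) \<le> \<epsilon>"
      using dependent_nat_choice[of "\<lambda>_. good" "\<lambda>_ u v. norm ((u o\<^sub>L v) - u) \<le> \<epsilon>"] ex by metis
    have zB: "z i \<in> B_ops" for i using z(1) by (simp add: good_def)
    define D where "D = (\<Sum>i<n. (op_adj (z i) o\<^sub>L z i) - z (Suc i))"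
    have dB: "(op_adj (z i) o\<^sub>L z i) - z (Suc i) \<in> B_ops" for i
      by (intro B_ops_diff B_ops_compose op_adj_B_ops zB)
    then have DB: "D \<in> B_ops" unfolding D_def by (intro B_ops_sum)
    have "op_adj D = (\<Sum>i<n. (op_adj (z i) o\<^sub>L z i) - op_adj (z (Suc i)))"
      unfolding D_def using dB
      by (simp add: op_adj_sum op_adj_diff B_ops_compose op_adj_B_ops zB op_adj_compose op_adj_adj)
    \<comment> \<open>The operators \<open>z\<^sup>* z\<close> are self-adjoint and cancel, which
      leaves only the differences of \<open>z\<close> and its adjoint.\<close>
    then have "D - op_adj D = (\<Sum>i<n. op_adj (z (Suc i)) - z (Suc i))"
      by (simp add: D_def sum_subtractf[symmetric])
    then have "\<phi> (D - op_adj D) = (\<Sum>i<n. \<phi> (op_adj (z (Suc i))) - \<phi> (z (Suc i)))"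
      using op_dual_sum[OF \<phi> op_subspace_B_ops, of "{..<n}" "\<lambda>i. op_adj (z (Suc i)) - z (Suc i)"]
      by (simp add: B_ops_diff op_adj_B_ops zB op_dual_diff[OF \<phi> op_subspace_B_ops])
    then have "of_nat n * (\<beta> - \<alpha>) - \<phi> (D - op_adj D) =
        (\<Sum>i<n. (\<phi> (z (Suc i)) - \<alpha>) - (\<phi> (op_adj (z (Suc i))) - \<beta>))"
      by (simp add: sum_subtractf sum.distrib algebra_simps)
    also have "cmod \<dots> \<le> (\<Sum>i<n. \<epsilon> + \<epsilon>)"
    proof (rule sum_norm_le)
      fix i
      show "cmod ((\<phi> (z (Suc i)) - \<alpha>) - (\<phi> (op_adj (z (Suc i))) - \<beta>)) \<le> \<epsilon> + \<epsilon>"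
        using z(1)[of "Suc i"] norm_triangle_ineq4[of "\<phi> (z (Suc i)) - \<alpha>" "\<phi> (op_adj (z (Suc i))) - \<beta>"]
        by (simp add: good_def)
    qed
    finally have 1: "cmod (of_nat n * (\<beta> - \<alpha>) - \<phi> (D - op_adj D)) \<le> 2"
      using n by (simp add: \<epsilon>_def)
    have "norm D \<le> sqrt (real n * (1 + 2 * real n * \<epsilon>))"
      unfolding D_def by (rule norm_sum_almost_absorbing) (use zB z good_def in auto)
    then have "norm D \<le> sqrt (real n) * sqrt 3" using n by (simp add: \<epsilon>_def real_sqrt_mult)
    then have "norm (D - op_adj D) \<le> 2 * (sqrt (real n) * sqrt 3)"
      using norm_triangle_ineq4[of D "op_adj D"] norm_op_adj[OF DB] by simp
    then have 2: "cmod (\<phi> (D - op_adj D)) \<le> K * (2 * (sqrt (real n) * sqrt 3))"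
      by (intro order_trans[OF K(2)] mult_left_mono K(1))
    have "cmod (of_nat n * (\<beta> - \<alpha>)) \<le> 2 + K * (2 * (sqrt (real n) * sqrt 3))"
      using norm_triangle_sub[of "of_nat n * (\<beta> - \<alpha>)" "\<phi> (D - op_adj D)"] 1 2 by linarith
    moreover have "cmod (of_nat n * (\<beta> - \<alpha>)) = sqrt (real n) * (cmod (\<alpha> - \<beta>) * sqrt (real n))"
      by (simp add: norm_mult norm_minus_commute)
    moreover have "2 + K * (2 * (sqrt (real n) * sqrt 3)) \<le> sqrt (real n) * (2 + 2 * K * sqrt 3)"
      using n by (simp add: algebra_simps)
    ultimately have "sqrt (real n) * (cmod (\<alpha> - \<beta>) * sqrt (real n)) \<le> sqrt (real n) * (2 + 2 * K * sqrt 3)"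
      by linarith
    then show ?thesis using n by simp
  qed
  show ?thesis
  proof (rule ccontr)
    assume "\<alpha> \<noteq> \<beta>"
    then have pos: "cmod (\<alpha> - \<beta>) > 0" by simp
    define C where "C = (2 + 2 * K * sqrt 3) / cmod (\<alpha> - \<beta>)"
    have C: "C \<ge> 0" using K(1) pos by (simp add: C_def)
    obtain n :: nat where n: "C\<^sup>2 < real n" using reals_Archimedean2 by blast
    then have "n > 0" using zero_le_power2[of C] by (intro gr0I) auto
    from bound[OF this] have "sqrt (real n) \<le> C" using pos by (simp add: C_def field_simps)
    then have "real n \<le> C\<^sup>2" using power_mono[of "sqrt (real n)" C 2] by simp
    with n show False by simp
  qed
qed

section \<open>From complemented left ideals to multiplier projections\<close>

locale approx_op_algebra = op_algebra A for A :: "('h::complex_hilbert_space \<Rightarrow>\<^sub>L 'h) set" +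
  fixes U :: "('h \<Rightarrow>\<^sub>L 'h) filter"
  assumes U_ultra: "ultra U"
    and U_ev: "\<forall>\<^sub>F e in U. e \<in> A \<and> norm e \<le> 1"
    and U_left: "a \<in> A \<Longrightarrow> ((\<lambda>e. e o\<^sub>L a) \<longlongrightarrow> a) U"
    and U_right: "a \<in> A \<Longrightarrow> ((\<lambda>e. a o\<^sub>L e) \<longlongrightarrow> a) U"
begin

lemma U_nonbot: "U \<noteq> bot"
  using U_ultra by (simp add: ultra_def)

lemma U_in: "\<forall>\<^sub>F e in U. e \<in> A"
  using U_ev by eventually_elim simp

text \<open>Equations in \<open>A\<close> are proved below by multiplying with an arbitrary element
  of \<open>A\<close> on the left; an approximate identity on that side makes this enough.\<close>

lemma left_annihilator_zero:
  assumes "x \<in> A" "\<And>b. b \<in> A \<Longrightarrow> b o\<^sub>L x = 0"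
  shows "x = 0"
proof -
  have "\<forall>\<^sub>F e in U. e o\<^sub>L x = 0" using U_in by eventually_elim (rule assms(2))
  then have "((\<lambda>e. e o\<^sub>L x) \<longlongrightarrow> 0) U" by (rule tendsto_eventually)
  with U_left[OF assms(1)] show ?thesis by (metis tendsto_unique U_nonbot)
qed

text \<open>For \<open>V = 2P - 1\<close> and \<open>s\<close>, \<open>t\<close> in the approximate identity, \<open>sV\<close> is a contraction with
  \<open>(sV)(tV)a \<approx> a\<close>. As \<open>tV\<close> is also contractive, the parallelogram law forces \<open>tVa \<approx> Va\<close>.\<close>

lemma right_projection_left_limit:
  assumes P: "P \<in> B_ops" "P o\<^sub>L P = P" "op_adj P = P" and AP: "\<And>b. b \<in> A \<Longrightarrow> b o\<^sub>L P \<in> A"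
    and a: "a \<in> A"
  shows "((\<lambda>e. (e o\<^sub>L P) o\<^sub>L a) \<longlongrightarrow> P o\<^sub>L a) U"
proof -
  define V where "V = P + P - id_blinfun"
  have VV: "blinfun_apply V (blinfun_apply V x) = x" for x
  proof -
    have "P (P x) = P x" by (metis P(2) blinfun_apply_blinfun_compose)
    then show ?thesis by (simp add: V_def blinfun.bilinear_simps)
  qed
  have V_B: "V \<in> B_ops" by (simp add: V_def B_ops_add B_ops_diff P(1))
  have V_adj: "cinner (V x) y = cinner x (V y)" for x y
    using cinner_op_adj_left[OF P(1), of x y]
    by (simp add: V_def P(3) blinfun.bilinear_simps cinner_diff_left cinner_diff_right cinner_add_left cinner_add_right)
  have V_norm: "norm (V x) = norm x" for x
  proof -
    have "cinner (V x) (V x) = cinner x x" using V_adj[of x "V x"] by (simp add: VV)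
    then have "(norm (V x))\<^sup>2 = (norm x)\<^sup>2" by (simp only: cinner_same of_real_eq_iff)
    then show ?thesis by (simp only: power2_eq_iff_nonneg norm_ge_zero)
  qed
  have AV: "b o\<^sub>L V \<in> A" if "b \<in> A" for b
  proof -
    have "b o\<^sub>L V = (b o\<^sub>L P) + (b o\<^sub>L P) - b"
      by (intro blinfun_eqI) (simp add: V_def blinfun.bilinear_simps)
    then show ?thesis using AP[OF that] that by (simp add: A_add A_diff)
  qed
  \<comment> \<open>The product of the bound \<open>k = \<delta> (norm a + 2) norm v\<close> found
    below and the bound \<open>4 norm a norm v\<close> for
    \<open>2 norm w + norm (\<zeta> + w)\<close>, with \<delta> and \<open>(norm v)\<^sup>2\<close>
    split off.\<close>
  define C where "C = 4 * norm a * (norm a + 2)"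
  have C0: "C \<ge> 0" by (simp add: C_def)
  have est: "norm (((t o\<^sub>L V) o\<^sub>L a) - (V o\<^sub>L a)) \<le> sqrt (C * \<delta>)"
    if s: "norm s \<le> 1" "norm ((s o\<^sub>L a) - a) \<le> \<delta>" and t: "norm t \<le> 1"
      and st: "norm (((s o\<^sub>L V) o\<^sub>L (t o\<^sub>L V)) - s) \<le> \<delta>" for s t \<delta>
  proof (rule norm_blinfun_bound)
    have d0: "0 \<le> \<delta>" using order_trans[OF norm_ge_zero st] .
    then show "0 \<le> sqrt (C * \<delta>)" using C0 by simp
    fix v
    define w where "w = a v"
    \<comment> \<open>\<open>V\<close> is an isometric involution, so the claim that
      \<open>tV\<close> is close to \<open>V\<close> at \<open>w\<close> becomes closeness of
      \<zeta> to \<open>w\<close>. The contraction \<open>s\<close> maps both near \<open>w\<close>,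
      which forces \<open>\<zeta> + w\<close> to have nearly the maximal norm
      \<open>2 norm w\<close>.\<close>
    define \<zeta> where "\<zeta> = V (t (V w))"
    have contr: "norm (r y) \<le> norm y" if "norm r \<le> 1" for r :: "'h \<Rightarrow>\<^sub>L 'h" and y
      using order_trans[OF norm_blinfun mult_right_mono[OF that norm_ge_zero]] by simp
    have wn: "norm w \<le> norm a * norm v" unfolding w_def by (rule norm_blinfun)
    have zn: "norm \<zeta> \<le> norm w"
      using contr[OF t, of "V w"] by (simp add: \<zeta>_def V_norm)
    have "norm (s \<zeta> - s w) = norm ((((s o\<^sub>L V) o\<^sub>L (t o\<^sub>L V)) - s) w)"
      by (simp add: \<zeta>_def blinfun.diff_left)
    also have "\<dots> \<le> \<delta> * (norm a * norm v)"
      by (rule order_trans[OF norm_blinfun mult_mono[OF st wn]]) (simp_all add: d0)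
    finally have 1: "norm (s \<zeta> - s w) \<le> \<delta> * (norm a * norm v)" .
    have "norm (s w - w) = norm (((s o\<^sub>L a) - a) v)" by (simp add: w_def blinfun.diff_left)
    also have "\<dots> \<le> \<delta> * norm v"
      by (rule order_trans[OF norm_blinfun mult_right_mono[OF s(2)]]) simp
    finally have 2: "norm (s w - w) \<le> \<delta> * norm v" .
    define k where "k = \<delta> * (norm a + 2) * norm v"
    have k0: "k \<ge> 0" using d0 by (simp add: k_def)
    have "s (\<zeta> + w) - ((s \<zeta> - s w) + 2 *\<^sub>R (s w - w)) = 2 *\<^sub>R w"
      by (simp add: blinfun.add_right scaleR_2)
    then have "2 * norm w = norm (s (\<zeta> + w) - ((s \<zeta> - s w) + 2 *\<^sub>R (s w - w)))"
      by simp
    also have "\<dots> \<le> norm (s (\<zeta> + w)) + (norm (s \<zeta> - s w) + 2 * norm (s w - w))"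
      by (intro order_trans[OF norm_triangle_ineq4] add_left_mono order_trans[OF norm_triangle_ineq]) simp
    also have "\<dots> \<le> norm (\<zeta> + w) + k"
      using 1 2 contr[OF s(1), of "\<zeta> + w"] by (simp add: k_def algebra_simps)
    finally have y: "2 * norm w - norm (\<zeta> + w) \<le> k" by simp
    have "4 * (norm w)\<^sup>2 - (norm (\<zeta> + w))\<^sup>2 = (2 * norm w - norm (\<zeta> + w)) * (2 * norm w + norm (\<zeta> + w))"
      by (simp add: power2_eq_square algebra_simps)
    also have "\<dots> \<le> k * (4 * norm w)"
    proof (cases "2 * norm w - norm (\<zeta> + w) \<le> 0")
      case True
      then have "(2 * norm w - norm (\<zeta> + w)) * (2 * norm w + norm (\<zeta> + w)) \<le> 0"
        by (intro mult_nonpos_nonneg) auto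
      also have "0 \<le> k * (4 * norm w)" using k0 by simp
      finally show ?thesis .
    qed (use y k0 in \<open>intro mult_mono; simp\<close>)
    also have "\<dots> \<le> k * (4 * (norm a * norm v))" using wn k0 by (intro mult_left_mono) auto
    also have "\<dots> = C * \<delta> * (norm v)\<^sup>2" by (simp add: k_def C_def power2_eq_square)
    finally have 3: "4 * (norm w)\<^sup>2 - (norm (\<zeta> + w))\<^sup>2 \<le> C * \<delta> * (norm v)\<^sup>2" .
    have "norm ((((t o\<^sub>L V) o\<^sub>L a) - (V o\<^sub>L a)) v) = norm (V ((((t o\<^sub>L V) o\<^sub>L a) - (V o\<^sub>L a)) v))"
      by (simp add: V_norm)
    also have "V ((((t o\<^sub>L V) o\<^sub>L a) - (V o\<^sub>L a)) v) = \<zeta> - w"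
      by (simp add: \<zeta>_def w_def blinfun.diff_left blinfun.diff_right VV)
    also have "norm (\<zeta> - w) \<le> sqrt (C * \<delta>) * norm v"
    proof (rule power2_le_imp_le)
      have "(norm (\<zeta> - w))\<^sup>2 \<le> C * \<delta> * (norm v)\<^sup>2"
        using parallelogram_law[of \<zeta> w] power_mono[OF zn norm_ge_zero, of 2] 3 by linarith
      then show "(norm (\<zeta> - w))\<^sup>2 \<le> (sqrt (C * \<delta>) * norm v)\<^sup>2"
        using C0 d0 by (simp add: power_mult_distrib)
    qed (use C0 d0 in simp)
    finally show "norm ((((t o\<^sub>L V) o\<^sub>L a) - (V o\<^sub>L a)) v) \<le> sqrt (C * \<delta>) * norm v" .
  qed
  have limV: "((\<lambda>t. (t o\<^sub>L V) o\<^sub>L a) \<longlongrightarrow> V o\<^sub>L a) U"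
  proof (rule tendstoI)
    fix r :: real assume r: "r > 0"
    define \<delta> where "\<delta> = r\<^sup>2 / (C + 1)"
    have d: "\<delta> > 0" using r C0 by (simp add: \<delta>_def)
    have "C * \<delta> < r\<^sup>2" using r C0 by (simp add: \<delta>_def field_simps)
    then have sq: "sqrt (C * \<delta>) < r"
      using real_sqrt_less_mono[of "C * \<delta>" "r\<^sup>2"] r by simp
    have "\<forall>\<^sub>F s in U. s \<in> A \<and> norm s \<le> 1 \<and> norm ((s o\<^sub>L a) - a) \<le> \<delta>"
      using U_ev tendstoD[OF U_left[OF a] d] by eventually_elim (simp add: dist_norm)
    then obtain s where s: "s \<in> A" "norm s \<le> 1" "norm ((s o\<^sub>L a) - a) \<le> \<delta>"
      using eventually_happens'[OF U_nonbot] by blast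
    \<comment> \<open>\<open>s\<close> stays fixed while \<open>t\<close> runs through the
      approximate identity. Since \<open>V\<close> squares to the identity, the limit is
      \<open>s\<close>.\<close>
    have "((\<lambda>t. ((s o\<^sub>L V) o\<^sub>L t) o\<^sub>L V) \<longlongrightarrow> (s o\<^sub>L V) o\<^sub>L V) U"
      by (intro tendsto_blinfun_compose U_right AV s tendsto_const)
    moreover have "(s o\<^sub>L V) o\<^sub>L V = s" by (rule blinfun_eqI) (simp add: VV)
    ultimately have "((\<lambda>t. (s o\<^sub>L V) o\<^sub>L (t o\<^sub>L V)) \<longlongrightarrow> s) U"
      by (simp add: blinfun_compose_assoc)
    from tendstoD[OF this d] U_ev
    show "\<forall>\<^sub>F t in U. dist ((t o\<^sub>L V) o\<^sub>L a) (V o\<^sub>L a) < r"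
    proof eventually_elim
      case (elim t)
      have "norm (((t o\<^sub>L V) o\<^sub>L a) - (V o\<^sub>L a)) \<le> sqrt (C * \<delta>)"
        by (rule est[OF s(2,3)]) (use elim in \<open>simp_all add: dist_norm\<close>)
      with sq show ?case by (simp add: dist_norm)
    qed
  qed
  have "((\<lambda>t. (1/2) *\<^sub>R (((t o\<^sub>L V) o\<^sub>L a) + (t o\<^sub>L a))) \<longlongrightarrow> (1/2) *\<^sub>R ((V o\<^sub>L a) + a)) U"
    by (intro tendsto_scaleR tendsto_add tendsto_const limV U_left a)
  moreover have "(1/2) *\<^sub>R (((t o\<^sub>L V) o\<^sub>L a) + (t o\<^sub>L a)) = (t o\<^sub>L P) o\<^sub>L a" for t :: "'h \<Rightarrow>\<^sub>L 'h"
    by (rule blinfun_eqI) (simp add: V_def blinfun.bilinear_simps scaleR_2[symmetric] flip: scaleR_add_right)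
  moreover have "(1/2) *\<^sub>R ((V o\<^sub>L a) + a) = P o\<^sub>L a"
    by (rule blinfun_eqI) (simp add: V_def blinfun.bilinear_simps scaleR_2[symmetric] flip: scaleR_add_right)
  ultimately show ?thesis by simp
qed

text \<open>Everything is computed through \<open>translate\<close>: evaluating \<open>p\<close> on
  the translate of \<open>f\<close> by \<open>a\<close> gives \<open>f (R a)\<close>. This
  identifies the Arens products \<open>a p\<close> and \<open>p p\<close>. The product
  \<open>p a\<close> on the other side requires norm convergence of \<open>R e o\<^sub>L a\<close>,
  supplied by \<open>right_projection_left_limit\<close> once \<open>p\<close> is known to be
  self-adjoint.\<close>

lemma multiplier_of_contractively_complemented:
  assumes J: "contractively_complemented A J"
  obtains p where "p \<in> multiplier_algebra A" "orth_projection A p"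
    "canon A ` J = (\<lambda>a. arens A (canon A a) p) ` A"
proof -
  obtain R where R_in: "\<And>a. a \<in> A \<Longrightarrow> R a \<in> A"
    and R_module: "\<And>a b. a \<in> A \<Longrightarrow> b \<in> A \<Longrightarrow> R (a o\<^sub>L b) = a o\<^sub>L R b"
    and R_add: "\<And>a b. a \<in> A \<Longrightarrow> b \<in> A \<Longrightarrow> R (a + b) = R a + R b"
    and R_scale: "\<And>c a. a \<in> A \<Longrightarrow> R (op_scale c a) = op_scale c (R a)"
    and R_norm: "\<And>a. a \<in> A \<Longrightarrow> norm (R a) \<le> norm a"
    and R_idem: "\<And>a. a \<in> A \<Longrightarrow> R (R a) = R a" and R_im: "R ` A = J"
    using J unfolding contractively_complemented_def by blast
  have R_diff: "R (a - b) = R a - R b" if "a \<in> A" "b \<in> A" for a b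
    using R_add[of "a - b" b] that A_diff[OF that] by simp
  have ev: "\<forall>\<^sub>F e in U. e \<in> A \<and> R e \<in> A \<and> norm (R e) \<le> 1"
    using U_ev by eventually_elim (use R_in R_norm in force)
  have ev_A: "\<forall>\<^sub>F e in U. R e \<in> A" using ev by eventually_elim simp
  \<comment> \<open>By the module property the difference is \<open>R\<close> applied to
    \<open>a e - a\<close>, and \<open>R\<close> is contractive.\<close>
  have aR: "((\<lambda>e. a o\<^sub>L R e) \<longlongrightarrow> R a) U" if a: "a \<in> A" for a
  proof -
    have "((\<lambda>e. (a o\<^sub>L R e) - R a) \<longlongrightarrow> 0) U"
    proof (rule Lim_null_comparison)
      show "\<forall>\<^sub>F e in U. norm ((a o\<^sub>L R e) - R a) \<le> norm ((a o\<^sub>L e) - a)"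
        using U_in
        by eventually_elim (metis R_diff R_module R_norm A_comp A_diff a)
      show "((\<lambda>e. norm ((a o\<^sub>L e) - a)) \<longlongrightarrow> 0) U"
        using tendsto_norm[OF LIM_zero[OF U_right[OF a]]] by simp
    qed
    then show ?thesis by (rule LIM_zero_cancel)
  qed
  define p where "p = restr (op_dual A) (\<lambda>f. Lim U (\<lambda>e. f (R e)))"
  have lim: "((\<lambda>e. f (R e)) \<longlongrightarrow> p f) U" if f: "f \<in> op_dual A" for f
  proof -
    obtain K where K: "K \<ge> 0" "\<And>a. cmod (f a) \<le> K * norm a" using op_dual_bound[OF f] by blast
    have "\<forall>\<^sub>F e in U. f (R e) \<in> cball 0 K"
      using ev by eventually_elim (use K in \<open>simp add: order_trans[OF K(2) mult_left_mono[OF _ K(1), of _ 1, simplified]]\<close>)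
    then obtain l where "((\<lambda>e. f (R e)) \<longlongrightarrow> l) U"
      using ultra_tendsto_compact[OF U_ultra compact_cball, of "\<lambda>e. f (R e)"] by blast
    moreover from this have "p f = l"
      using f U_nonbot by (simp add: p_def restr_in tendsto_Lim)
    ultimately show ?thesis by simp
  qed
  have pI: "p f = l" if "f \<in> op_dual A" "((\<lambda>e. f (R e)) \<longlongrightarrow> l) U" for f l
    using tendsto_unique[OF U_nonbot lim[OF that(1)] that(2)] .
  have p_bidual: "p \<in> op_bidual A"
    unfolding op_bidual_def
  proof (intro CollectI conjI ballI allI impI)
    fix f g assume fg: "f \<in> op_dual A" "g \<in> op_dual A"
    have "(\<lambda>a. f a + g a) \<in> op_dual A"
    proof -
      obtain K where K: "K \<ge> 0" "\<And>a. cmod (f a) \<le> K * norm a" using op_dual_bound[OF fg(1)] by blast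
      obtain L where L: "L \<ge> 0" "\<And>a. cmod (g a) \<le> L * norm a" using op_dual_bound[OF fg(2)] by blast
      show ?thesis
      proof (rule op_dualI[where K = "K + L"])
        show "cmod (f a + g a) \<le> (K + L) * norm a" for a
          using norm_triangle_le[of "f a" "g a"] K(2)[of a] L(2)[of a] by (simp add: distrib_right add_mono)
      qed (simp_all add: op_dualD[OF fg(1)] op_dualD[OF fg(2)] algebra_simps)
    qed
    then show "p (\<lambda>a. f a + g a) = p f + p g"
      by (rule pI) (intro tendsto_add lim fg)
  next
    fix c f assume f: "f \<in> op_dual A"
    obtain K where K: "K \<ge> 0" "\<And>a. cmod (f a) \<le> K * norm a" using op_dual_bound[OF f] by blast
    have "(\<lambda>a. c * f a) \<in> op_dual A"
    proof (rule op_dualI[where K = "cmod c * K"])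
      show "cmod (c * f a) \<le> cmod c * K * norm a" for a
        using mult_left_mono[OF K(2), of "cmod c" a] by (simp add: norm_mult mult.assoc)
    qed (simp_all add: op_dualD[OF f] algebra_simps)
    then show "p (\<lambda>a. c * f a) = c * p f"
      by (rule pI) (intro tendsto_mult tendsto_const lim f)
  next
    have "cmod (p f) \<le> 1 * dual_norm A f" if f: "f \<in> op_dual A" for f
    proof (rule tendsto_upperbound[OF tendsto_norm[OF lim[OF f]] _ U_nonbot])
      show "\<forall>\<^sub>F e in U. cmod (f (R e)) \<le> 1 * dual_norm A f"
        using ev by eventually_elim (simp add: dual_norm_upper[OF f])
    qed
    then show "\<exists>K. \<forall>f\<in>op_dual A. cmod (p f) \<le> K * dual_norm A f" by blast
  qed (simp add: p_def restr_def)
  have translate: "p (restr A (\<lambda>b. f (a o\<^sub>L b))) = f (R a)" if f: "f \<in> op_dual A" and a: "a \<in> A" for f a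
  proof (rule pI[OF translate_functional_dual[OF f a]])
    have "((\<lambda>e. f (a o\<^sub>L R e)) \<longlongrightarrow> f (R a)) U"
      by (rule op_dual_tendsto[OF f A_subspace A_closed U_nonbot aR[OF a]])
        (use ev_A a in \<open>auto elim!: eventually_mono simp: A_comp\<close>)
    moreover have "\<forall>\<^sub>F e in U. f (a o\<^sub>L R e) = restr A (\<lambda>b. f (a o\<^sub>L b)) (R e)"
      using ev_A by eventually_elim (simp add: restr_in)
    ultimately show "((\<lambda>e. restr A (\<lambda>b. f (a o\<^sub>L b)) (R e)) \<longlongrightarrow> f (R a)) U"
      by (rule Lim_transform_eventually)
  qed
  have canon_p: "arens A (canon A a) p = canon A (R a)" if a: "a \<in> A" for a
  proof
    fix f
    show "arens A (canon A a) p f = canon A (R a) f"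
    proof (cases "f \<in> op_dual A")
      case True
      then show ?thesis
        using bidual_translate_dual[OF p_bidual True] translate[OF True a] a
        by (simp add: arens_def restr_in canon_def)
    qed (simp add: arens_def canon_def restr_def)
  qed
  have pp: "arens A p p = p"
  proof
    fix f
    show "arens A p p f = p f"
    proof (cases "f \<in> op_dual A")
      case True
      have "p (restr A (\<lambda>a. p (restr A (\<lambda>b. f (a o\<^sub>L b))))) = p f"
      proof (rule pI[OF bidual_translate_dual[OF p_bidual True]])
        have "\<forall>\<^sub>F e in U. f (R e) = restr A (\<lambda>a. p (restr A (\<lambda>b. f (a o\<^sub>L b)))) (R e)"
          using ev by eventually_elim (simp add: restr_in translate[OF True] R_idem)
        then show "((\<lambda>e. restr A (\<lambda>a. p (restr A (\<lambda>b. f (a o\<^sub>L b)))) (R e)) \<longlongrightarrow> p f) U"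
          by (rule Lim_transform_eventually[OF lim[OF True]])
      qed
      then show ?thesis using True by (simp add: arens_def restr_in)
    qed (simp add: arens_def p_def restr_def)
  qed
  \<comment> \<open>The approximants \<open>R e\<close> absorb each other on the right because
    \<open>R (R e) = R e\<close>, so \<open>absorbing_limit_self_adjoint\<close> compares the limits
    of \<phi> along \<open>R e\<close> and along their adjoints.\<close>
  have sa: "cnj (p (restr A (functional_adj \<phi>))) = p (restr A \<phi>)" if \<phi>: "\<phi> \<in> op_dual B_ops" for \<phi>
  proof -
    obtain K where K: "K \<ge> 0" "\<And>a. cmod (\<phi> a) \<le> K * norm a" using op_dual_bound[OF \<phi>] by blast
    have d1: "restr A \<phi> \<in> op_dual A"
      by (rule op_dualI[where K = K]) (simp_all add: restr_def A_add A_scale A_B op_dualD[OF \<phi>] K)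
    have d2: "restr A (functional_adj \<phi>) \<in> op_dual A"
    proof (rule op_dualI[where K = K])
      show "cmod (restr A (functional_adj \<phi>) a) \<le> K * norm a" if "a \<in> A" for a
        using that K(2)[of "op_adj a"] by (simp add: restr_in functional_adj_def A_B norm_op_adj)
    qed (simp_all add: restr_def A_add A_scale A_B functional_adj_def B_ops_add B_ops_scale op_adj_add
        op_adj_scale op_adj_B_ops op_dualD[OF \<phi>])
    show ?thesis
    proof (rule absorbing_limit_self_adjoint[OF U_nonbot \<phi>, where g = R, symmetric])
      show "\<forall>\<^sub>F e in U. R e \<in> B_ops \<and> norm (R e) \<le> 1 \<and> ((\<lambda>e'. R e o\<^sub>L R e') \<longlongrightarrow> R e) U"
        using ev by eventually_elim (metis A_B aR R_idem)
      have "\<forall>\<^sub>F e in U. restr A \<phi> (R e) = \<phi> (R e)"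
        using ev_A by eventually_elim (simp add: restr_in)
      then show "((\<lambda>e. \<phi> (R e)) \<longlongrightarrow> p (restr A \<phi>)) U"
        by (rule Lim_transform_eventually[OF lim[OF d1]])
      have "\<forall>\<^sub>F e in U. cnj (restr A (functional_adj \<phi>) (R e)) = \<phi> (op_adj (R e))"
        using ev_A by eventually_elim (simp add: restr_in functional_adj_def A_B)
      then show "((\<lambda>e. \<phi> (op_adj (R e))) \<longlongrightarrow> cnj (p (restr A (functional_adj \<phi>)))) U"
        by (rule Lim_transform_eventually[OF tendsto_cnj[OF lim[OF d2]]])
    qed
  qed
  have orth: "orth_projection A p"
    unfolding orth_projection_def using p_bidual pp sa by blast
  obtain P where P: "P \<in> B_ops" "\<And>x y. p (vector_functional A x y) = cinner (blinfun_apply P x) y"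
    using bidual_operator[OF p_bidual] by blast
  note PP = orth_projection_operator[OF p_bidual orth P]
  note vd = vector_functional_dual[OF A_subspace]
  have RP: "R a = a o\<^sub>L P" if a: "a \<in> A" for a
  proof (intro blinfun_eqI cinner_eqI)
    fix x y
    show "cinner (R a x) y = cinner (blinfun_apply (a o\<^sub>L P) x) y"
      using arens_canon_left_vector[OF a P(2), of x y] canon_p[OF a] vd R_in[OF a]
      by (simp add: canon_def restr_in vector_functional_def)
  qed
  \<comment> \<open>Convergence against vector functionals alone would not place
    \<open>P o\<^sub>L a\<close> in the norm closed set \<open>A\<close>.\<close>
  have lim_left: "((\<lambda>e. R e o\<^sub>L a) \<longlongrightarrow> P o\<^sub>L a) U" if a: "a \<in> A" for a
  proof -
    have "\<forall>\<^sub>F e in U. (e o\<^sub>L P) o\<^sub>L a = R e o\<^sub>L a"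
      using U_in by eventually_elim (simp add: RP)
    moreover have "((\<lambda>e. (e o\<^sub>L P) o\<^sub>L a) \<longlongrightarrow> P o\<^sub>L a) U"
      by (rule right_projection_left_limit[OF P(1) PP _ a]) (use RP R_in in metis)
    ultimately show ?thesis by (rule Lim_transform_eventually[rotated])
  qed
  have ev_Ra: "\<forall>\<^sub>F e in U. R e o\<^sub>L a \<in> A" if "a \<in> A" for a
    using ev_A by eventually_elim (simp add: A_comp that)
  have PA: "P o\<^sub>L a \<in> A" if a: "a \<in> A" for a
    by (rule Lim_in_closed_set[OF A_closed ev_Ra[OF a] U_nonbot lim_left[OF a]])
  have p_canon: "arens A p (canon A a) = canon A (P o\<^sub>L a)" if a: "a \<in> A" for a
  proof
    fix f
    show "arens A p (canon A a) f = canon A (P o\<^sub>L a) f"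
    proof (cases "f \<in> op_dual A")
      case f: True
      obtain K where K: "K \<ge> 0" "\<And>a. cmod (f a) \<le> K * norm a" using op_dual_bound[OF f] by blast
      have d: "restr A (\<lambda>b. f (b o\<^sub>L a)) \<in> op_dual A"
      proof (rule op_dualI[where K = "K * norm a"])
        show "cmod (restr A (\<lambda>b. f (b o\<^sub>L a)) b) \<le> K * norm a * norm b" if "b \<in> A" for b
          using that order_trans[OF K(2) mult_left_mono[OF norm_blinfun_compose K(1)], of b a]
          by (simp add: restr_in mult_ac)
      qed (simp_all add: restr_def A_add A_scale blinfun_compose_simps op_scale_compose_left A_comp a op_dualD[OF f])
      have "p (restr A (\<lambda>b. f (b o\<^sub>L a))) = f (P o\<^sub>L a)"
      proof (rule pI[OF d])
        have "\<forall>\<^sub>F e in U. f (R e o\<^sub>L a) = restr A (\<lambda>b. f (b o\<^sub>L a)) (R e)"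
          using ev_A by eventually_elim (simp add: restr_in)
        then show "((\<lambda>e. restr A (\<lambda>b. f (b o\<^sub>L a)) (R e)) \<longlongrightarrow> f (P o\<^sub>L a)) U"
          by (rule Lim_transform_eventually[OF op_dual_tendsto[OF f A_subspace A_closed U_nonbot lim_left[OF a] ev_Ra[OF a]]])
      qed
      then show ?thesis
        unfolding arens_canon_right[OF a f] using f by (simp add: canon_def restr_in)
    qed (simp add: arens_def canon_def restr_def)
  qed
  have "p \<in> multiplier_algebra A"
    unfolding multiplier_algebra_def using p_bidual p_canon canon_p PA R_in by auto
  moreover have "canon A ` J = (\<lambda>a. arens A (canon A a) p) ` A"
    unfolding R_im[symmetric] by (auto simp: canon_p)
  ultimately show ?thesis using that orth by blast
qed

end

section \<open>Minimal projections\<close>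

lemma blinfun_compose_assoc_eq: "a o\<^sub>L b = c \<Longrightarrow> a o\<^sub>L (b o\<^sub>L x) = c o\<^sub>L x"
  by (metis blinfun_compose_assoc)

lemma bounded_linear_op_scale: "bounded_linear (op_scale c)"
proof (rule bounded_linear_intro[where K = "cmod c"])
  show "op_scale c (r *\<^sub>R T) = r *\<^sub>R op_scale c T" for r and T :: "'h::complex_hilbert_space \<Rightarrow>\<^sub>L 'h"
    by (rule blinfun_eqI) (simp add: op_scale_apply blinfun.scaleR_left scaleC_of_real[symmetric] scaleC_scaleC mult.commute)
qed (simp_all add: op_scale_simps norm_op_scale)

lemma op_subspace_closure:
  assumes "op_subspace V"
  shows "op_subspace (closure V)"
  unfolding op_subspace_def
proof (intro conjI ballI allI)
  show "0 \<in> closure V" using op_subspaceD(1)[OF assms] closure_subset by blast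
  show "a + b \<in> closure V" if ab: "a \<in> closure V" "b \<in> closure V" for a b
  proof -
    obtain f g where "\<And>n. f n \<in> V" "f \<longlonglongrightarrow> a" "\<And>n. g n \<in> V" "g \<longlonglongrightarrow> b"
      using ab unfolding closure_sequential by metis
    then show ?thesis unfolding closure_sequential
      by (intro exI[of _ "\<lambda>n. f n + g n"]) (simp add: op_subspaceD(2)[OF assms] tendsto_add)
  qed
  show "op_scale c a \<in> closure V" if a: "a \<in> closure V" for c a
  proof -
    obtain f where "\<And>n. f n \<in> V" "f \<longlonglongrightarrow> a" using a unfolding closure_sequential by blast
    then show ?thesis unfolding closure_sequential
      by (intro exI[of _ "\<lambda>n. op_scale c (f n)"])
        (simp add: op_subspaceD(3)[OF assms] bounded_linear.tendsto[OF bounded_linear_op_scale])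
  qed
qed

text \<open>Gelfand-Mazur for a corner \<open>Q B Q\<close>: if \<open>T\<close> had empty spectrum there, its resolvent \<open>S\<close> would be
  entire and vanish at infinity.\<close>

lemma no_resolvent:
  fixes Q T :: "'h::complex_hilbert_space \<Rightarrow>\<^sub>L 'h"
  assumes T: "T o\<^sub>L Q = T" "T \<in> B_ops"
    and S: "\<And>k. S k o\<^sub>L (T - op_scale k Q) = Q" "\<And>k. (T - op_scale k Q) o\<^sub>L S k = Q"
      "\<And>k. Q o\<^sub>L S k = S k" "\<And>k. S k o\<^sub>L Q = S k" "\<And>k. S k \<in> B_ops"
  shows "Q = 0"
proof -
  have resolvent: "S k - S \<mu> = op_scale (k - \<mu>) (S k o\<^sub>L S \<mu>)" for k \<mu>
  proof -
    have "S k o\<^sub>L ((T - op_scale \<mu> Q) o\<^sub>L S \<mu>) = S k" by (simp only: S)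
    moreover have "S k o\<^sub>L ((T - op_scale k Q) o\<^sub>L S \<mu>) = S \<mu>"
      by (metis S(1,3) blinfun_compose_assoc)
    ultimately have "S k - S \<mu> = S k o\<^sub>L (((T - op_scale \<mu> Q) - (T - op_scale k Q)) o\<^sub>L S \<mu>)"
      by (metis blinfun_compose_simps(3,4))
    also have "(T - op_scale \<mu> Q) - (T - op_scale k Q) = op_scale (k - \<mu>) Q"
      by (rule blinfun_eqI) (simp add: blinfun.diff_left op_scale_apply scaleC_diff_left)
    finally show ?thesis
      by (simp add: op_scale_compose_left S op_scale_compose_right)
  qed
  have cont: "((\<lambda>k. S k) \<longlongrightarrow> S \<mu>) (at \<mu>)" for \<mu>
  proof -
    \<comment> \<open>Near \<mu> the resolvent identity bounds \<open>norm (S k)\<close> by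
      \<open>norm (S \<mu>)\<close> plus half of itself. Absorbing that half gives local
      boundedness, hence continuity, without a Neumann series.\<close>
    have est: "norm (S k - S \<mu>) \<le> cmod (k - \<mu>) * (2 * norm (S \<mu>) * norm (S \<mu>))"
      if small: "cmod (k - \<mu>) * norm (S \<mu>) < 1/2" for k
    proof -
      have 1: "norm (S k - S \<mu>) \<le> cmod (k - \<mu>) * (norm (S k) * norm (S \<mu>))"
        unfolding resolvent norm_op_scale by (intro mult_left_mono norm_blinfun_compose) auto
      have "norm (S k) \<le> norm (S \<mu>) + norm (S k - S \<mu>)"
        by (metis add.commute norm_triangle_sub)
      also have "\<dots> \<le> norm (S \<mu>) + norm (S k) * (1/2)"
        using 1 mult_left_mono[OF less_imp_le[OF small] norm_ge_zero[of "S k"]] by (simp add: mult_ac)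
      finally have "norm (S k) \<le> 2 * norm (S \<mu>)" by simp
      then have "cmod (k - \<mu>) * (norm (S k) * norm (S \<mu>)) \<le> cmod (k - \<mu>) * (2 * norm (S \<mu>) * norm (S \<mu>))"
        by (intro mult_left_mono mult_right_mono) auto
      with 1 show ?thesis by linarith
    qed
    have lim0: "((\<lambda>k. cmod (k - \<mu>) * C) \<longlongrightarrow> 0) (at \<mu>)" for C
    proof -
      have "((\<lambda>k. cmod (k - \<mu>) * C) \<longlongrightarrow> cmod (\<mu> - \<mu>) * C) (at \<mu>)" by (intro tendsto_intros)
      then show ?thesis by simp
    qed
    have "((\<lambda>k. S k - S \<mu>) \<longlongrightarrow> 0) (at \<mu>)"
    proof (rule Lim_null_comparison[OF _ lim0])
      show "\<forall>\<^sub>F k in at \<mu>. norm (S k - S \<mu>) \<le> cmod (k - \<mu>) * (2 * norm (S \<mu>) * norm (S \<mu>))"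
        using order_tendstoD(2)[OF lim0[of "norm (S \<mu>)"], of "1/2"] by (auto elim!: eventually_mono intro: est)
    qed
    then show ?thesis by (rule LIM_zero_cancel)
  qed
  have zero: "cinner (S k x) y = 0" for k x y
  proof (rule Liouville_weak_0[where f = "\<lambda>k. cinner (S k x) y"])
    have "((\<lambda>k. cinner (S k x) y) has_field_derivative cinner ((S \<mu> o\<^sub>L S \<mu>) x) y) (at \<mu>)" for \<mu>
      unfolding has_field_derivative_iff
    proof (rule Lim_transform_eventually)
      show "((\<lambda>k. cinner ((S k o\<^sub>L S \<mu>) x) y) \<longlongrightarrow> cinner ((S \<mu> o\<^sub>L S \<mu>) x) y) (at \<mu>)"
        by (intro bounded_bilinear.tendsto[OF bounded_bilinear_cinner] tendsto_const
            blinfun.tendsto tendsto_blinfun_compose cont)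
      show "\<forall>\<^sub>F k in at \<mu>. cinner ((S k o\<^sub>L S \<mu>) x) y = (cinner (S k x) y - cinner (S \<mu> x) y) / (k - \<mu>)"
        using eventually_neq_at_within[of \<mu> \<mu> UNIV]
      proof eventually_elim
        case (elim k)
        have "cinner (S k x) y - cinner (S \<mu> x) y = cinner ((S k - S \<mu>) x) y"
          by (simp add: blinfun.diff_left cinner_diff_left)
        also have "\<dots> = (k - \<mu>) * cinner ((S k o\<^sub>L S \<mu>) x) y"
          by (simp add: resolvent op_scale_apply cinner_scaleC_left)
        finally show ?case using elim by simp
      qed
    qed
    then show "(\<lambda>k. cinner (S k x) y) holomorphic_on UNIV"
      by (auto simp: holomorphic_on_def field_differentiable_def)
    show "((\<lambda>k. cinner (S k x) y) \<longlongrightarrow> 0) at_infinity"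
      unfolding Lim_at_infinity
    proof (intro allI impI)
      fix e :: real assume e: "e > 0"
      \<comment> \<open>Chosen so that \<open>(B - norm T) * e\<close> exceeds
        \<open>norm Q * norm x * norm y\<close>; the added 1 makes this strict and keeps
        \<open>B - norm T\<close> positive.\<close>
      define B where "B = norm T + norm Q * norm x * norm y / e + 1"
      have "dist (cinner (S k x) y) 0 < e" if "B \<le> cmod k" for k
      proof -
        have Bp: "B - norm T > 0" using e by (simp add: B_def add_nonneg_pos)
        have "op_scale k (S k) = (T o\<^sub>L S k) - Q"
          using S(2,3)[of k] by (simp add: blinfun_compose_simps op_scale_compose_left algebra_simps)
        then have "cmod k * norm (S k) = norm ((T o\<^sub>L S k) - Q)" by (metis norm_op_scale)
        also have "\<dots> \<le> norm T * norm (S k) + norm Q"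
          by (intro order_trans[OF norm_triangle_ineq4] add_right_mono norm_blinfun_compose)
        finally have "(cmod k - norm T) * norm (S k) \<le> norm Q" by (simp add: algebra_simps)
        moreover have "(B - norm T) * norm (S k) \<le> (cmod k - norm T) * norm (S k)"
          using that by (intro mult_right_mono) auto
        ultimately have 1: "(B - norm T) * norm (S k) \<le> norm Q" by linarith
        have "(B - norm T) * cmod (cinner (S k x) y) \<le> (B - norm T) * (norm x * norm y * norm (S k))"
          using Bp by (intro mult_left_mono vector_functional_bound) auto
        also have "\<dots> \<le> norm Q * (norm x * norm y)"
          using mult_right_mono[OF 1, of "norm x * norm y"] by (simp add: mult_ac)
        also have "\<dots> < e * (B - norm T)" using e by (simp add: B_def field_simps)
        finally have "(B - norm T) * cmod (cinner (S k x) y) < (B - norm T) * e" by (simp add: mult.commute)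
        then show ?thesis using Bp by simp
      qed
      then show "\<exists>b. \<forall>z. b \<le> cmod z \<longrightarrow> dist (cinner (S z x) y) 0 < e" by blast
    qed
  qed
  have "S 0 = 0" by (intro blinfun_eqI cinner_eqI) (simp add: zero)
  then show "Q = 0" using S(1)[of 0] by simp
qed

section \<open>Projections attached to closed left ideals\<close>

locale complemented_algebra = approx_op_algebra A U
  for A :: "('h::complex_hilbert_space \<Rightarrow>\<^sub>L 'h) set" and U +
  assumes A_semisimple: "semisimple A"
    and A_complemented: "left_ideal A J \<Longrightarrow> closed J \<Longrightarrow> contractively_complemented A J"
begin

text \<open>The complementation hypothesis enters the structure theory only in this form.\<close>

lemma left_ideal_projection:
  assumes "left_ideal A J" "closed J"
  obtains P where "P \<in> B_ops" "P o\<^sub>L P = P" "op_adj P = P"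
    "\<And>a. a \<in> A \<Longrightarrow> a o\<^sub>L P \<in> A" "\<And>a. a \<in> A \<Longrightarrow> P o\<^sub>L a \<in> A" "J = (\<lambda>a. a o\<^sub>L P) ` A"
    "\<And>S. S \<in> B_ops \<Longrightarrow> (\<And>a. a \<in> A \<Longrightarrow> S o\<^sub>L a = a) \<Longrightarrow> S o\<^sub>L P = P"
    "\<And>D :: 'h \<Rightarrow>\<^sub>L 'h. (\<And>a. a \<in> A \<Longrightarrow> a o\<^sub>L D = 0) \<Longrightarrow> P o\<^sub>L D = 0"
proof -
  obtain p where p: "p \<in> multiplier_algebra A" "orth_projection A p"
    "canon A ` J = (\<lambda>a. arens A (canon A a) p) ` A"
    using multiplier_of_contractively_complemented[OF A_complemented[OF assms]] by blast
  obtain P where P: "P \<in> B_ops" "P o\<^sub>L P = P" "op_adj P = P"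
    "\<And>a. a \<in> A \<Longrightarrow> a o\<^sub>L P \<in> A" "\<And>a. a \<in> A \<Longrightarrow> P o\<^sub>L a \<in> A"
    "\<And>a. a \<in> A \<Longrightarrow> arens A (canon A a) p = canon A (a o\<^sub>L P)"
    "\<And>S. S \<in> B_ops \<Longrightarrow> (\<And>a. a \<in> A \<Longrightarrow> S o\<^sub>L a = a) \<Longrightarrow> S o\<^sub>L P = P"
    "\<And>D :: 'h \<Rightarrow>\<^sub>L 'h. (\<And>a. a \<in> A \<Longrightarrow> a o\<^sub>L D = 0) \<Longrightarrow> P o\<^sub>L D = 0"
    using multiplier_operator[OF p(1,2)] by blast
  have "canon A ` J = canon A ` (\<lambda>a. a o\<^sub>L P) ` A"
    using p(3) P(6) by (auto simp: image_image)
  moreover have "inj_on (canon A) A" using canon_eqD by (auto simp: inj_on_def)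
  moreover have "J \<subseteq> A" using assms(1) by (simp add: left_ideal_def)
  ultimately have "J = (\<lambda>a. a o\<^sub>L P) ` A"
    using P(4) by (intro inj_on_image_eq_iff[THEN iffD1, of "canon A" A]) auto
  then show ?thesis using that[OF P(1-5) _ P(7,8)] by blast
qed

lemma left_ideal_self: "left_ideal A A"
  by (simp add: left_ideal_def A_subspace A_comp)

text \<open>The case of the left ideal \<open>A\<close> itself. \<open>E\<close> replaces the
  identity operator when complements are formed, because \<open>A\<close> may act degenerately on
  \<open>H\<close>.\<close>

lemma unit_projection:
  obtains E where "E \<in> B_ops" "E o\<^sub>L E = E" "op_adj E = E"
    "\<And>a. a \<in> A \<Longrightarrow> a o\<^sub>L E = a" "\<And>a. a \<in> A \<Longrightarrow> E o\<^sub>L a = a"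
    "\<And>D :: 'h \<Rightarrow>\<^sub>L 'h. (\<And>a. a \<in> A \<Longrightarrow> a o\<^sub>L D = 0) \<Longrightarrow> E o\<^sub>L D = 0"
proof -
  obtain E where E: "E \<in> B_ops" "E o\<^sub>L E = E" "op_adj E = E"
    "\<And>a. a \<in> A \<Longrightarrow> E o\<^sub>L a \<in> A" "A = (\<lambda>a. a o\<^sub>L E) ` A"
    "\<And>D :: 'h \<Rightarrow>\<^sub>L 'h. (\<And>a. a \<in> A \<Longrightarrow> a o\<^sub>L D = 0) \<Longrightarrow> E o\<^sub>L D = 0"
    using left_ideal_projection[OF left_ideal_self A_closed] by metis
  have aE: "a o\<^sub>L E = a" if "a \<in> A" for a
    using that E(2,5) by (metis (no_types, lifting) blinfun_compose_assoc imageE)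
  have Ea: "E o\<^sub>L a = a" if a: "a \<in> A" for a
  proof -
    have "(E o\<^sub>L a) - a = 0"
    proof (rule left_annihilator_zero)
      show "b o\<^sub>L ((E o\<^sub>L a) - a) = 0" if "b \<in> A" for b
        by (simp add: blinfun_compose_simps blinfun_compose_assoc_eq[OF aE[OF that]])
    qed (simp add: A_diff E(4) a)
    then show ?thesis by simp
  qed
  show ?thesis using that[OF E(1-3)] aE Ea E(6) by blast
qed

text \<open>\<open>w\<close> is the sum of the powers \<open>v + v^2 + ...\<close>, so formally
  \<open>1 + w\<close> is a left inverse of \<open>1 - v\<close>. It is found as a Banach fixed
  point inside \<open>A\<close>, which need not contain a unit.\<close>

lemma quasi_inverse:
  assumes "v \<in> A" "norm v < 1"
  obtains w where "w \<in> A" "w = v + (w o\<^sub>L v)"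
proof -
  have "\<exists>!w. w \<in> A \<and> v + (w o\<^sub>L v) = w"
  proof (rule Banach_fix)
    show "complete A" by (simp add: complete_eq_closed A_closed)
    show "A \<noteq> {}" using A_zero by blast
    show "(\<lambda>w. v + (w o\<^sub>L v)) ` A \<subseteq> A" using assms(1) by (auto simp: A_add A_comp)
    show "dist (v + (x o\<^sub>L v)) (v + (y o\<^sub>L v)) \<le> norm v * dist x y" if "x \<in> A" "y \<in> A" for x y
    proof -
      have "(x o\<^sub>L v) - (y o\<^sub>L v) = (x - y) o\<^sub>L v" by (simp add: blinfun_compose_simps)
      then show ?thesis using norm_blinfun_compose[of "x - y" v] by (simp add: dist_norm mult.commute)
    qed
  qed (use assms(2) in auto)
  then show ?thesis using that by metis
qed

lemma left_ideal_closure: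
  assumes L: "left_ideal A L"
  shows "left_ideal A (closure L)"
  unfolding left_ideal_def
proof (intro conjI ballI)
  show "closure L \<subseteq> A" using L A_closed by (simp add: left_ideal_def closure_minimal)
  show "op_subspace (closure L)" using L by (simp add: left_ideal_def op_subspace_closure)
  show "a o\<^sub>L b \<in> closure L" if a: "a \<in> A" and b: "b \<in> closure L" for a b
  proof -
    obtain f where "\<And>n. f n \<in> L" "f \<longlonglongrightarrow> b" using b unfolding closure_sequential by blast
    then show ?thesis unfolding closure_sequential using L a
      by (intro exI[of _ "\<lambda>n. a o\<^sub>L f n"]) (auto simp: left_ideal_def intro!: tendsto_blinfun_compose)
  qed
qed

text \<open>A non-closed one would be dense by maximality, so it would contain some \<open>b\<close>
  at distance below 1 from its modular unit \<open>u\<close>; quasi-inverting \<open>u - b\<close>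
  then puts every element of \<open>A\<close> into the ideal.\<close>

lemma maximal_modular_closed:
  assumes L: "maximal_modular_left_ideal A L"
  shows "closed L"
proof (rule ccontr)
  assume "\<not> closed L"
  then have "closure L \<noteq> L" by (metis closed_closure)
  have LI: "left_ideal A L" and LA: "L \<noteq> A" using L by (auto simp: maximal_modular_left_ideal_def)
  obtain u where u: "u \<in> A" "\<And>a. a \<in> A \<Longrightarrow> a - (a o\<^sub>L u) \<in> L"
    using L unfolding maximal_modular_left_ideal_def by blast
  have "closure L = L \<or> closure L = A"
    using L left_ideal_closure[OF LI] closure_subset unfolding maximal_modular_left_ideal_def by blast
  then have "closure L = A" using \<open>closure L \<noteq> L\<close> by blast
  then have "u \<in> closure L" using u by simp
  then obtain b where b: "b \<in> L" "dist b u < 1" unfolding closure_approachable by (metis zero_less_one)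
  have LS: "op_subspace L" and bA: "b \<in> A" using LI b(1) by (auto simp: left_ideal_def)
  define v where "v = u - b"
  have v: "v \<in> A" "norm v < 1"
    using u(1) bA b(2) by (simp_all add: v_def A_diff dist_norm norm_minus_commute)
  obtain w where w: "w \<in> A" "w = v + (w o\<^sub>L v)" using quasi_inverse[OF v] .
  have "a \<in> L" if a: "a \<in> A" for a
  proof -
    \<comment> \<open>Formally \<open>a (1 + w)\<close>, so that multiplying by \<open>1 - v\<close>
      on the right returns \<open>a\<close>.\<close>
    define a' where "a' = a + (a o\<^sub>L w)"
    have a': "a' \<in> A" using a w(1) by (simp add: a'_def A_add A_comp)
    have "a' o\<^sub>L v = a o\<^sub>L (v + (w o\<^sub>L v))"
      by (simp add: a'_def blinfun_compose_simps blinfun_compose_assoc)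
    also have "\<dots> = a o\<^sub>L w" using w(2) by simp
    finally have "a = a' - (a' o\<^sub>L v)" by (simp add: a'_def)
    also have "\<dots> = (a' - (a' o\<^sub>L u)) + (a' o\<^sub>L b)"
      by (simp add: v_def blinfun_compose_simps)
    also have "\<dots> \<in> L"
      using u(2)[OF a'] LI b(1) a' by (intro op_subspaceD(2)[OF LS]) (auto simp: left_ideal_def)
    finally show ?thesis .
  qed
  then show False using LA LI by (auto simp: left_ideal_def)
qed

text \<open>Minimality is expressed through the left annihilator, which connects it directly with
  the Jacobson radical. The customary description by one-dimensional corners follows in
  \<open>MP_corner\<close>.\<close>

definition minimal_projections :: "('h \<Rightarrow>\<^sub>L 'h) set" where
  "minimal_projections = {Q \<in> A. Q o\<^sub>L Q = Q \<and> op_adj Q = Q \<and>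
     maximal_modular_left_ideal A {a \<in> A. a o\<^sub>L Q = 0}}"

lemma MP_D:
  assumes "Q \<in> minimal_projections"
  shows "Q \<in> A" "Q o\<^sub>L Q = Q" "op_adj Q = Q" "Q \<noteq> 0" "Q \<in> B_ops"
  using assms A_B by (auto simp: minimal_projections_def maximal_modular_left_ideal_def)

text \<open>Modularity brings the complementary projection into \<open>A\<close>: \<open>E\<close>
  and \<open>P\<close> need only be multipliers, but \<open>E - P\<close> equals
  \<open>u - u P\<close> for the modular unit \<open>u\<close>.\<close>

lemma maximal_modular_projection:
  assumes L: "maximal_modular_left_ideal A L"
  obtains Q where "Q \<in> minimal_projections" "L = {a \<in> A. a o\<^sub>L Q = 0}"
proof -
  have LI: "left_ideal A L" using L by (simp add: maximal_modular_left_ideal_def)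
  obtain u where u: "u \<in> A" "\<And>a. a \<in> A \<Longrightarrow> a - (a o\<^sub>L u) \<in> L"
    using L unfolding maximal_modular_left_ideal_def by blast
  obtain P where P: "P \<in> B_ops" "P o\<^sub>L P = P" "op_adj P = P"
    "\<And>a. a \<in> A \<Longrightarrow> a o\<^sub>L P \<in> A" "L = (\<lambda>a. a o\<^sub>L P) ` A"
    "\<And>S. S \<in> B_ops \<Longrightarrow> (\<And>a. a \<in> A \<Longrightarrow> S o\<^sub>L a = a) \<Longrightarrow> S o\<^sub>L P = P"
    using left_ideal_projection[OF LI maximal_modular_closed[OF L]] by metis
  obtain E where E: "E \<in> B_ops" "E o\<^sub>L E = E" "op_adj E = E"
    "\<And>a. a \<in> A \<Longrightarrow> a o\<^sub>L E = a" "\<And>a. a \<in> A \<Longrightarrow> E o\<^sub>L a = a"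
    "\<And>D :: 'h \<Rightarrow>\<^sub>L 'h. (\<And>a. a \<in> A \<Longrightarrow> a o\<^sub>L D = 0) \<Longrightarrow> E o\<^sub>L D = 0"
    using unit_projection by blast
  have EP: "E o\<^sub>L P = P" using P(6) E(1,5) by blast
  define Q where "Q = u - (u o\<^sub>L P)"
  have QA: "Q \<in> A" using u(1) P(4) by (simp add: Q_def A_diff)
  have aQ: "a o\<^sub>L Q = a - (a o\<^sub>L P)" if a: "a \<in> A" for a
  proof -
    obtain b where b: "b \<in> A" "a - (a o\<^sub>L u) = b o\<^sub>L P" using u(2)[OF a] P(5) by auto
    then have "(a - (a o\<^sub>L u)) o\<^sub>L P = a - (a o\<^sub>L u)" using P(2) by (simp add: blinfun_compose_assoc)
    then show ?thesis
      by (simp add: Q_def blinfun_compose_simps blinfun_compose_assoc algebra_simps)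
  qed
  \<comment> \<open>\<open>A\<close> kills \<open>D\<close> from the left, so
    \<open>E o\<^sub>L D\<close> is 0; but it is also \<open>D\<close>.\<close>
  define D where "D = (E - P) - Q"
  have "E o\<^sub>L D = 0"
    using aQ E(4) by (intro E(6)) (simp add: D_def blinfun_compose_simps)
  moreover have "E o\<^sub>L D = D"
    using E(2) EP E(5)[OF QA] by (simp add: D_def blinfun_compose_simps)
  ultimately have "Q = E - P" by (simp add: D_def)
  then have "op_adj Q = Q" using E(1,3) P(1,3) by (simp add: op_adj_diff)
  moreover have "Q o\<^sub>L Q = Q"
    using aQ[OF QA] by (simp add: Q_def blinfun_compose_simps blinfun_compose_assoc P(2))
  moreover have "L = {a \<in> A. a o\<^sub>L Q = 0}"
  proof
    show "L \<subseteq> {a \<in> A. a o\<^sub>L Q = 0}"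
    proof
      fix b assume "b \<in> L"
      then obtain a where a: "a \<in> A" "b = a o\<^sub>L P" using P(5) by blast
      then show "b \<in> {a \<in> A. a o\<^sub>L Q = 0}"
        using P(4) aQ[OF P(4)[OF a(1)]] by (simp add: blinfun_compose_assoc[of _ P P] P(2))
    qed
    show "{a \<in> A. a o\<^sub>L Q = 0} \<subseteq> L"
      using P(5) by (auto simp: aQ)
  qed
  ultimately show ?thesis using that[of Q] QA L by (simp add: minimal_projections_def)
qed

text \<open>The left annihilators of the minimal projections include all maximal modular left
  ideals, so an element of all of them lies in the radical.\<close>

lemma MP_separating:
  assumes "a \<in> A" "\<And>Q. Q \<in> minimal_projections \<Longrightarrow> a o\<^sub>L Q = 0"
  shows "a = 0"
proof -
  have "a \<in> jacobson_radical A"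
    unfolding jacobson_radical_def using assms maximal_modular_projection by blast
  then show ?thesis using A_semisimple by (simp add: semisimple_def)
qed

lemma left_annihilator_ideal:
  fixes x :: "'h \<Rightarrow>\<^sub>L 'h"
  shows  "left_ideal A {a \<in> A. a o\<^sub>L x = 0}"
  unfolding left_ideal_def op_subspace_def
  by (auto simp: A_zero A_add A_scale A_comp blinfun_compose_simps op_scale_compose_left op_scale_simps blinfun_compose_assoc)

text \<open>\<open>A Q\<close> is a minimal left ideal: the elements \<open>a\<close> with
  \<open>a Q\<close> in \<open>A x Q\<close> form a left ideal containing the annihilator of
  \<open>Q\<close>. It cannot equal the annihilator, since then \<open>A x Q = 0\<close>, so it is
  all of \<open>A\<close>.\<close>

lemma MP_minimal:
  assumes Q: "Q \<in> minimal_projections" and x: "x \<in> A" "x o\<^sub>L Q \<noteq> 0"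
  obtains b where "b \<in> A" "b o\<^sub>L (x o\<^sub>L Q) = Q"
proof -
  note D = MP_D[OF Q]
  define L where "L = {a \<in> A. \<exists>b\<in>A. a o\<^sub>L Q = b o\<^sub>L (x o\<^sub>L Q)}"
  have L0: "{a \<in> A. a o\<^sub>L Q = 0} \<subseteq> L" unfolding L_def using A_zero by force
  have "left_ideal A L"
    unfolding left_ideal_def op_subspace_def
  proof (intro conjI ballI allI)
    show "0 \<in> L" using L0 A_zero by force
    show "a + b \<in> L" if "a \<in> L" "b \<in> L" for a b
      using that unfolding L_def by (auto simp: A_add blinfun_compose_simps) (metis A_add blinfun_compose_simps(1))
    show "op_scale c a \<in> L" if "a \<in> L" for c a
      using that unfolding L_def by (auto simp: A_scale op_scale_compose_left) (metis A_scale op_scale_compose_left)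
    show "a o\<^sub>L b \<in> L" if "a \<in> A" "b \<in> L" for a b
      using that unfolding L_def by (auto simp: A_comp blinfun_compose_assoc) (metis A_comp blinfun_compose_assoc)
  qed (auto simp: L_def)
  then have "L = {a \<in> A. a o\<^sub>L Q = 0} \<or> L = A"
    using Q L0 unfolding minimal_projections_def maximal_modular_left_ideal_def by blast
  moreover have "L \<noteq> {a \<in> A. a o\<^sub>L Q = 0}"
  proof
    assume eq: "L = {a \<in> A. a o\<^sub>L Q = 0}"
    have "x o\<^sub>L Q = 0"
    proof (rule left_annihilator_zero)
      show "b o\<^sub>L (x o\<^sub>L Q) = 0" if "b \<in> A" for b
      proof -
        have "b o\<^sub>L x \<in> L" using that x(1) by (auto simp: L_def A_comp blinfun_compose_assoc)
        then show ?thesis by (simp add: eq blinfun_compose_assoc)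
      qed
    qed (simp add: A_comp x D(1))
    with x(2) show False ..
  qed
  ultimately have "Q \<in> L" using D(1) by blast
  then show ?thesis using that by (auto simp: L_def D(2))
qed

text \<open>By \<open>MP_minimal\<close> the corner \<open>Q A Q\<close> is a division algebra with
  unit \<open>Q\<close>, and a non-scalar element would have a resolvent everywhere, contradicting
  \<open>no_resolvent\<close>.\<close>

lemma MP_corner:
  assumes Q: "Q \<in> minimal_projections" and a: "a \<in> A"
  obtains c where "Q o\<^sub>L (a o\<^sub>L Q) = op_scale c Q"
proof (rule ccontr)
  assume "\<not> thesis"
  then have ne: "Q o\<^sub>L (a o\<^sub>L Q) \<noteq> op_scale c Q" for c using that by blast
  note D = MP_D[OF Q]
  note QQ = blinfun_compose_assoc_eq[OF D(2)]
  define T where "T = Q o\<^sub>L (a o\<^sub>L Q)"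
  have TA: "T \<in> A" by (simp add: T_def A_comp D a)
  have TQ: "T o\<^sub>L Q = T" "Q o\<^sub>L T = T" by (simp_all add: T_def blinfun_compose_assoc D(2) QQ)
  have "\<exists>s. s o\<^sub>L (T - op_scale k Q) = Q \<and> (T - op_scale k Q) o\<^sub>L s = Q \<and>
      Q o\<^sub>L s = s \<and> s o\<^sub>L Q = s \<and> s \<in> B_ops" for k
  proof -
    define t where "t = T - op_scale k Q"
    have t: "t \<in> A" "t o\<^sub>L Q = t" "Q o\<^sub>L t = t"
      by (simp_all add: t_def TA A_diff A_scale D TQ blinfun_compose_simps op_scale_compose_left op_scale_compose_right)
    have "t \<noteq> 0" using ne[of k] by (simp add: t_def T_def)
    have inv: "\<exists>s\<in>A. s o\<^sub>L r = Q \<and> Q o\<^sub>L s = s \<and> s o\<^sub>L Q = s"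
      if r: "r \<in> A" "r o\<^sub>L Q = r" "Q o\<^sub>L r = r" "r \<noteq> 0" for r
    proof -
      obtain b where b: "b \<in> A" "b o\<^sub>L (r o\<^sub>L Q) = Q" using MP_minimal[OF Q r(1)] r(2,4) by metis
      have "(Q o\<^sub>L (b o\<^sub>L Q)) o\<^sub>L r = Q"
        using b(2) r(2,3) by (simp add: blinfun_compose_assoc D(2))
      then show ?thesis using b(1)
        by (intro bexI[of _ "Q o\<^sub>L (b o\<^sub>L Q)"]) (simp_all add: A_comp D QQ blinfun_compose_assoc)
    qed
    obtain s where s: "s \<in> A" "s o\<^sub>L t = Q" "Q o\<^sub>L s = s" "s o\<^sub>L Q = s" using inv[OF t \<open>t \<noteq> 0\<close>] by blast
    have "s \<noteq> 0" using s(2) D(4) by auto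
    then obtain r where r: "r \<in> A" "r o\<^sub>L s = Q" "r o\<^sub>L Q = r" using inv[OF s(1,4,3)] by blast
    \<comment> \<open>The left inverse \<open>s\<close> has itself a left inverse \<open>r\<close>,
      and \<open>r = r s t = t\<close> makes \<open>s\<close> a two-sided inverse.\<close>
    have "r = (r o\<^sub>L s) o\<^sub>L t" using r(3) s(2) by (simp add: blinfun_compose_assoc)
    then have "r = t" using r(2) t(3) by simp
    then show ?thesis using s r(2) A_B unfolding t_def by blast
  qed
  then obtain S where S: "\<And>k. S k o\<^sub>L (T - op_scale k Q) = Q" "\<And>k. (T - op_scale k Q) o\<^sub>L S k = Q"
      "\<And>k. Q o\<^sub>L S k = S k" "\<And>k. S k o\<^sub>L Q = S k" "\<And>k. S k \<in> B_ops"
    by metis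
  have "Q = 0" by (rule no_resolvent[OF TQ(1) A_B[OF TA] S])
  with D(4) show False ..
qed

text \<open>The left annihilator of \<open>x\<close> is again a maximal modular left ideal, which yields \<open>Q'\<close>.\<close>

lemma MP_range:
  assumes Q: "Q \<in> minimal_projections" and x: "x \<in> A" "x o\<^sub>L Q = x" "x \<noteq> 0"
  obtains Q' w where "Q' \<in> minimal_projections" "Q' o\<^sub>L x = x" "w \<in> A" "Q' = x o\<^sub>L w" "Q o\<^sub>L w = w"
proof -
  note D = MP_D[OF Q]
  define J where "J = {a \<in> A. a o\<^sub>L x = 0}"
  obtain v where v: "v \<in> A" "v o\<^sub>L x = Q" using MP_minimal[OF Q x(1)] x(2,3) by metis
  have "maximal_modular_left_ideal A J"
    unfolding maximal_modular_left_ideal_def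
  proof (intro conjI allI impI)
    show "left_ideal A J" unfolding J_def by (rule left_annihilator_ideal)
    show "J \<noteq> A"
    proof
      assume "J = A"
      then have "v o\<^sub>L x = 0" using v(1) by (auto simp: J_def)
      with v(2) D(4) show False by simp
    qed
    \<comment> \<open>The modular unit is \<open>x v\<close>: as \<open>v x = Q\<close> and
      \<open>x Q = x\<close>, right multiplication by it does not change the product with
      \<open>x\<close>.\<close>
    show "\<exists>u\<in>A. \<forall>a\<in>A. a - (a o\<^sub>L u) \<in> J"
      using x v by (intro bexI[of _ "x o\<^sub>L v"])
        (auto simp: J_def A_diff A_comp blinfun_compose_simps blinfun_compose_assoc)
    fix M assume M: "left_ideal A M \<and> J \<subseteq> M"
    show "M = J \<or> M = A"
    proof (rule disjCI)
      assume "M \<noteq> A"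
      have MS: "op_subspace M" and MA: "M \<subseteq> A" and Mm: "\<And>a b. a \<in> A \<Longrightarrow> b \<in> M \<Longrightarrow> a o\<^sub>L b \<in> M"
        using M by (auto simp: left_ideal_def)
      show "M = J"
      proof (rule ccontr)
        assume "M \<noteq> J"
        then obtain b where b: "b \<in> M" "b \<in> A" "b o\<^sub>L x \<noteq> 0" using M MA by (auto simp: J_def)
        then obtain c where c: "c \<in> A" "c o\<^sub>L (b o\<^sub>L x) = Q"
          using MP_minimal[OF Q A_comp[OF b(2) x(1)]] x(2) by (metis blinfun_compose_assoc)
        have "a \<in> M" if a: "a \<in> A" for a
        proof -
          \<comment> \<open>An element of \<open>M\<close> with \<open>d x = a x\<close>, so that
            \<open>a\<close> differs from it by an element of \<open>J\<close>.\<close>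
          define d where "d = (a o\<^sub>L x) o\<^sub>L (c o\<^sub>L b)"
          have dM: "d \<in> M" using Mm[of "(a o\<^sub>L x) o\<^sub>L c" b] a x(1) c(1) b(1)
            by (simp add: d_def A_comp blinfun_compose_assoc)
          have "d o\<^sub>L x = a o\<^sub>L x" using c(2) x(2) by (simp add: d_def blinfun_compose_assoc)
          then have "a - d \<in> J" using a dM MA by (auto simp: J_def A_diff blinfun_compose_simps)
          then have "(a - d) + d \<in> M" using M dM by (intro op_subspaceD(2)[OF MS]) auto
          then show ?thesis by simp
        qed
        with \<open>M \<noteq> A\<close> MA show False by blast
      qed
    qed
  qed
  then obtain Q' where Q': "Q' \<in> minimal_projections" "J = {a \<in> A. a o\<^sub>L Q' = 0}"
    using maximal_modular_projection by blast
  note D' = MP_D[OF Q'(1)]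
  have same: "a o\<^sub>L x = 0 \<longleftrightarrow> a o\<^sub>L Q' = 0" if "a \<in> A" for a
    using Q'(2) that by (auto simp: J_def)
  have "x - (Q' o\<^sub>L x) = 0"
  proof (rule left_annihilator_zero)
    fix a assume a: "a \<in> A"
    have "(a - (a o\<^sub>L Q')) o\<^sub>L Q' = 0" by (simp add: blinfun_compose_simps blinfun_compose_assoc D'(2))
    then have "(a - (a o\<^sub>L Q')) o\<^sub>L x = 0" using same[of "a - (a o\<^sub>L Q')"] a D'(1) by (simp add: A_diff A_comp)
    then show "a o\<^sub>L (x - (Q' o\<^sub>L x)) = 0" by (simp add: blinfun_compose_simps blinfun_compose_assoc)
  qed (simp add: A_diff A_comp x D'(1))
  \<comment> \<open>\<open>x\<close> and \<open>Q'\<close> have the same left annihilator, so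
    \<open>a - a x v\<close>, which kills \<open>x\<close>, also kills \<open>Q'\<close>. This
    exhibits \<open>Q'\<close> as a right multiple of \<open>x\<close>.\<close>
  moreover have "Q' - (x o\<^sub>L (v o\<^sub>L Q')) = 0"
  proof (rule left_annihilator_zero)
    fix a assume a: "a \<in> A"
    have "(a - (a o\<^sub>L (x o\<^sub>L v))) o\<^sub>L x = 0"
      by (simp add: blinfun_compose_simps blinfun_compose_assoc v(2) x(2))
    then have "(a - (a o\<^sub>L (x o\<^sub>L v))) o\<^sub>L Q' = 0"
      using same[of "a - (a o\<^sub>L (x o\<^sub>L v))"] a x(1) v(1) by (simp add: A_diff A_comp)
    then show "a o\<^sub>L (Q' - (x o\<^sub>L (v o\<^sub>L Q'))) = 0" by (simp add: blinfun_compose_simps blinfun_compose_assoc)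
  qed (simp add: A_diff A_comp x v(1) D'(1))
  ultimately show ?thesis
    using that[OF Q'(1), of "Q o\<^sub>L (v o\<^sub>L Q')"] v(1) D D'(1)
    by (simp add: A_comp blinfun_compose_assoc_eq[OF x(2)] blinfun_compose_assoc_eq[OF D(2)])
qed

text \<open>For \<open>x \<in> AQ\<close> with \<open>Qx = Q\<close>, the range projection \<open>Q'\<close> of \<open>x\<close> satisfies \<open>Q'Q = c x\<close> with a
  scalar \<open>c \<noteq> 0\<close>, so \<open>x\<^sup>*\<close> is a multiple of \<open>QQ'\<close> and lies in \<open>A\<close>.\<close>

lemma MP_adjoint:
  assumes Q: "Q \<in> minimal_projections" and z: "z \<in> A"
  shows "op_adj (z o\<^sub>L Q) \<in> A"
proof -
  note D = MP_D[OF Q]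
  obtain \<alpha> where \<alpha>: "Q o\<^sub>L (z o\<^sub>L Q) = op_scale \<alpha> Q" using MP_corner[OF Q z] by blast
  \<comment> \<open>A multiple of \<open>Q\<close>, whose adjoint is harmless, is added to normalize
    \<open>Q x\<close> to \<open>Q\<close>.\<close>
  define x where "x = (z o\<^sub>L Q) + op_scale (1 - \<alpha>) Q"
  have xA: "x \<in> A" by (simp add: x_def A_add A_scale A_comp z D)
  have xQ: "x o\<^sub>L Q = x"
    by (simp add: x_def blinfun_compose_simps blinfun_compose_assoc D(2) op_scale_compose_left)
  have Qx: "Q o\<^sub>L x = Q"
    by (simp add: x_def blinfun_compose_simps \<alpha> D(2,5) op_scale_compose_right op_scale_simps(3)[symmetric] op_scale_simps(5))
  have "x \<noteq> 0" using Qx D(4) by auto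
  then obtain Q' w where Q': "Q' \<in> minimal_projections" "Q' o\<^sub>L x = x" and w: "w \<in> A" "Q' = x o\<^sub>L w" "Q o\<^sub>L w = w"
    using MP_range[OF Q xA xQ] by blast
  note D' = MP_D[OF Q'(1)]
  obtain c where c: "Q o\<^sub>L (Q' o\<^sub>L Q) = op_scale c Q" using MP_corner[OF Q D'(1)] by blast
  \<comment> \<open>\<open>Q Q' = Q x w = Q w = w\<close>, by the normalization of
    \<open>x\<close>.\<close>
  have wQ: "w = Q o\<^sub>L Q'"
    using w(3) by (simp add: w(2) blinfun_compose_assoc_eq[OF Qx])
  have "Q' o\<^sub>L Q = x o\<^sub>L (w o\<^sub>L Q)" by (metis w(2) blinfun_compose_assoc)
  also have "w o\<^sub>L Q = op_scale c Q" by (simp add: wQ blinfun_compose_assoc c)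
  also have "x o\<^sub>L op_scale c Q = op_scale c x" using xQ by (simp add: op_scale_compose_right A_B xA)
  finally have QQ: "Q' o\<^sub>L Q = op_scale c x" .
  have adj: "op_adj (Q' o\<^sub>L Q) = Q o\<^sub>L Q'" using D D' by (simp add: op_adj_compose)
  have "c \<noteq> 0"
  proof
    assume "c = 0"
    then have "Q' o\<^sub>L Q = 0" using QQ by (simp add: op_scale_simps)
    then have "w = 0" using adj wQ by simp
    then have "Q' = 0" using w(2) by simp
    with D'(4) show False ..
  qed
  then have "x = op_scale (inverse c) (Q' o\<^sub>L Q)" by (simp add: QQ op_scale_simps)
  then have "op_adj x = op_scale (cnj (inverse c)) (Q o\<^sub>L Q')"
    using adj by (simp add: op_adj_scale B_ops_compose D D')
  then have "op_adj x \<in> A" by (simp add: A_scale A_comp D D')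
  moreover have "op_adj (z o\<^sub>L Q) = op_adj x - op_scale (cnj (1 - \<alpha>)) Q"
    unfolding x_def using D z by (simp add: op_adj_add B_ops_scale B_ops_compose A_B op_adj_scale)
  ultimately show ?thesis by (simp add: A_diff A_scale D)
qed

text \<open>The closed left ideal generated by the minimal projections is \<open>AP\<close> with \<open>PQ = Q\<close> for all of them,
  so semisimplicity gives \<open>a = aP\<close> for all \<open>a\<close>.\<close>

lemma A_induct:
  assumes C: "closed C" "op_subspace C" and MP: "\<And>a Q. a \<in> A \<Longrightarrow> Q \<in> minimal_projections \<Longrightarrow> a o\<^sub>L Q \<in> C"
  shows "A \<subseteq> C"
proof -
  define span_closed where
    "span_closed C \<longleftrightarrow> closed C \<and> op_subspace C \<and> (\<forall>a\<in>A. \<forall>Q\<in>minimal_projections. a o\<^sub>L Q \<in> C)" for C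
  \<comment> \<open>The intersection over all admissible subspaces is used because the given
    \<open>C\<close> need not be a left ideal.\<close>
  define J where "J = A \<inter> \<Inter>{C. span_closed C}"
  have J_I: "a \<in> J" if "a \<in> A" "\<And>C. span_closed C \<Longrightarrow> a \<in> C" for a
    using that by (auto simp: J_def)
  have J_D: "a \<in> A" "span_closed C \<Longrightarrow> a \<in> C" if "a \<in> J" for a C
    using that by (auto simp: J_def)
  have "closed J" unfolding J_def by (intro closed_Int A_closed closed_Inter) (auto simp: span_closed_def)
  moreover have "left_ideal A J"
    unfolding left_ideal_def op_subspace_def
  proof (intro conjI ballI allI)
    show "J \<subseteq> A" by (auto simp: J_def)
    show "0 \<in> J" by (auto intro!: J_I simp: A_zero span_closed_def op_subspaceD(1))
    show "a + b \<in> J" if "a \<in> J" "b \<in> J" for a b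
      using J_D[OF that(1)] J_D[OF that(2)] by (auto intro!: J_I simp: A_add) (simp add: span_closed_def op_subspaceD(2))
    show "op_scale c a \<in> J" if "a \<in> J" for c a
      using J_D[OF that] by (auto intro!: J_I simp: A_scale) (simp add: span_closed_def op_subspaceD(3))
    show "b o\<^sub>L a \<in> J" if b: "b \<in> A" and a: "a \<in> J" for a b
    proof (rule J_I)
      show "b o\<^sub>L a \<in> A" using J_D(1)[OF a] b by (simp add: A_comp)
      fix C assume C: "span_closed C"
      \<comment> \<open>The preimage of an admissible subspace under left multiplication by
        \<open>b\<close> is admissible again; this is what makes the intersection a left
        ideal.\<close>
      define C' where "C' = {c. b o\<^sub>L c \<in> C}"
      have "closed ((\<lambda>c. b o\<^sub>L c) -` C)"
        using C by (intro continuous_closed_vimage) (auto simp: span_closed_def intro!: continuous_intros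
          bounded_bilinear.continuous[OF bounded_bilinear_blinfun_compose])
      moreover have "(\<lambda>c. b o\<^sub>L c) -` C = C'" by (auto simp: C'_def)
      ultimately have "span_closed C'"
        using C b unfolding span_closed_def
        by (auto simp: C'_def op_subspace_def blinfun_compose_simps op_scale_compose_right A_B
            blinfun_compose_assoc[symmetric] A_comp)
      with a have "a \<in> C'" using J_D(2) by blast
      then show "b o\<^sub>L a \<in> C" by (simp add: C'_def)
    qed
  qed
  ultimately obtain P where P: "P \<in> B_ops" "P o\<^sub>L P = P" "op_adj P = P"
    "\<And>a. a \<in> A \<Longrightarrow> a o\<^sub>L P \<in> A" "J = (\<lambda>a. a o\<^sub>L P) ` A"
    using left_ideal_projection[of J] by metis
  \<comment> \<open>\<open>Q\<close> lies in \<open>J = A P\<close>, so \<open>Q P = Q\<close>; both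
    are self-adjoint, and adjoints give the other order.\<close>
  have PQ: "P o\<^sub>L Q = Q" if Q: "Q \<in> minimal_projections" for Q
  proof -
    have "Q \<in> J" using Q MP_D[OF Q] by (intro J_I) (auto simp: span_closed_def dest!: bspec[of _ _ Q])
    then have "Q o\<^sub>L P = Q" using P(2,5) by (auto simp: blinfun_compose_assoc)
    then show ?thesis using P(1,3) MP_D[OF Q] by (metis op_adj_compose)
  qed
  have "a \<in> C" if a: "a \<in> A" for a
  proof -
    have "a - (a o\<^sub>L P) = 0"
    proof (rule MP_separating)
      show "a - (a o\<^sub>L P) \<in> A" using a P(4) by (intro A_diff)
      show "(a - (a o\<^sub>L P)) o\<^sub>L Q = 0" if "Q \<in> minimal_projections" for Q
        by (simp only: blinfun_compose_simps blinfun_compose_assoc PQ[OF that] diff_self)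
    qed
    then have "a o\<^sub>L P = a" by simp
    then have "a \<in> J" unfolding P(5) using a by (metis image_eqI)
    then show ?thesis using J_D(2) C MP by (simp add: span_closed_def)
  qed
  then show ?thesis by blast
qed

lemma A_adjoint: "a \<in> A \<Longrightarrow> op_adj a \<in> A"
proof -
  define C where "C = {a \<in> A. op_adj a \<in> A}"
  have "closed C"
    unfolding closed_sequential_limits
  proof (intro allI impI, elim conjE)
    fix f l assume f: "\<forall>n. f n \<in> C" "f \<longlonglongrightarrow> l"
    have l: "l \<in> A" using f A_closed by (metis (mono_tags, lifting) C_def closed_sequentially mem_Collect_eq)
    have "(\<lambda>n. op_adj (f n) - op_adj l) \<longlonglongrightarrow> 0"
    proof (rule Lim_null_comparison)
      show "\<forall>\<^sub>F n in sequentially. norm (op_adj (f n) - op_adj l) \<le> norm (f n - l)"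
        using f(1) l by (intro always_eventually allI)
          (simp add: C_def op_adj_diff[symmetric] norm_op_adj A_B B_ops_diff)
      show "(\<lambda>n. norm (f n - l)) \<longlonglongrightarrow> 0" using tendsto_norm[OF LIM_zero[OF f(2)]] by simp
    qed
    then have "(\<lambda>n. op_adj (f n)) \<longlonglongrightarrow> op_adj l" by (rule LIM_zero_cancel)
    then have "op_adj l \<in> A" using f(1) A_closed by (auto simp: C_def intro: closed_sequentially)
    with l show "l \<in> C" by (simp add: C_def)
  qed
  moreover have "op_subspace C"
    by (auto simp: C_def op_subspace_def A_zero A_add A_scale op_adj_add op_adj_scale A_B)
  ultimately have "A \<subseteq> C"
    by (rule A_induct) (simp add: C_def A_comp MP_D(1) MP_adjoint)
  then show "a \<in> A \<Longrightarrow> op_adj a \<in> A" by (auto simp: C_def)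
qed

end

section \<open>Matrix norms\<close>

lemma op_mat_norm_bdd:
  fixes T :: "nat \<Rightarrow> nat \<Rightarrow> 'h::complex_hilbert_space \<Rightarrow>\<^sub>L 'h"
  assumes "(\<Sum>j<n. (norm (v j))\<^sup>2) \<le> 1"
  shows "sqrt (\<Sum>i<n. (norm (\<Sum>j<n. T i j (v j)))\<^sup>2) \<le> (\<Sum>i<n. \<Sum>j<n. norm (T i j))"
proof -
  have v1: "norm (v j) \<le> 1" if "j < n" for j
  proof -
    have "(norm (v j))\<^sup>2 \<le> (\<Sum>j<n. (norm (v j))\<^sup>2)"
      using that by (intro member_le_sum) auto
    with assms have "(norm (v j))\<^sup>2 \<le> 1\<^sup>2" by simp
    then show ?thesis by (rule power2_le_imp_le) simp
  qed
  have "sqrt (\<Sum>i<n. (norm (\<Sum>j<n. T i j (v j)))\<^sup>2) \<le> (\<Sum>i<n. norm (\<Sum>j<n. T i j (v j)))"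
    using L2_set_le_sum[of "{..<n}" "\<lambda>i. norm (\<Sum>j<n. T i j (v j))"] by (simp add: L2_set_def)
  also have "\<dots> \<le> (\<Sum>i<n. \<Sum>j<n. norm (T i j))"
  proof (intro sum_mono order_trans[OF norm_sum])
    fix i j assume "i \<in> {..<n}" "j \<in> {..<n}"
    then show "norm (T i j (v j)) \<le> norm (T i j)"
      using order_trans[OF norm_blinfun mult_left_mono[OF v1 norm_ge_zero]] by simp
  qed
  finally show ?thesis .
qed

lemma op_mat_norm_upper:
  fixes T :: "nat \<Rightarrow> nat \<Rightarrow> 'h::complex_hilbert_space \<Rightarrow>\<^sub>L 'h"
  assumes "(\<Sum>j<n. (norm (v j))\<^sup>2) \<le> 1"
  shows "sqrt (\<Sum>i<n. (norm (\<Sum>j<n. T i j (v j)))\<^sup>2) \<le> op_mat_norm n T"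
  unfolding op_mat_norm_def
proof (rule cSup_upper)
  show "bdd_above {sqrt (\<Sum>i<n. (norm (\<Sum>j<n. T i j (v j)))\<^sup>2) |v. (\<Sum>j<n. (norm (v j))\<^sup>2) \<le> 1}"
    using op_mat_norm_bdd unfolding bdd_above_def by blast
qed (use assms in blast)

lemma op_mat_norm_nonneg: "0 \<le> op_mat_norm n (T :: nat \<Rightarrow> nat \<Rightarrow> 'h::complex_hilbert_space \<Rightarrow>\<^sub>L 'h)"
  using op_mat_norm_upper[where v = "\<lambda>_. 0" and n = n and T = T] by simp

text \<open>Homogeneous form of the supremum. Together with \<open>op_mat_norm_least\<close> it
  replaces unit-ball arguments by inequalities between sums of squares, which add over orthogonal
  summands.\<close>

lemma op_mat_norm_sum_le:
  fixes T :: "nat \<Rightarrow> nat \<Rightarrow> 'h::complex_hilbert_space \<Rightarrow>\<^sub>L 'h"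
  shows "(\<Sum>i<n. (norm (\<Sum>j<n. T i j (v j)))\<^sup>2) \<le> (op_mat_norm n T)\<^sup>2 * (\<Sum>j<n. (norm (v j))\<^sup>2)"
proof (cases "(\<Sum>j<n. (norm (v j))\<^sup>2) = 0")
  case True
  then have "\<forall>j<n. v j = 0" by (subst (asm) sum_nonneg_eq_0_iff) auto
  then show ?thesis by simp
next
  case False
  define t where "t = sqrt (\<Sum>j<n. (norm (v j))\<^sup>2)"
  have s0: "(\<Sum>j<n. (norm (v j))\<^sup>2) \<ge> 0" by (intro sum_nonneg) simp
  then have t: "t > 0" "t\<^sup>2 = (\<Sum>j<n. (norm (v j))\<^sup>2)" using False by (auto simp: t_def)
  have "(\<Sum>j<n. (norm ((1/t) *\<^sub>R v j))\<^sup>2) = (1/t)\<^sup>2 * (\<Sum>j<n. (norm (v j))\<^sup>2)"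
    by (simp add: power_mult_distrib sum_distrib_left power_divide)
  also have "\<dots> = 1" using t by (simp add: t(2)[symmetric] power_divide)
  finally have "sqrt (\<Sum>i<n. (norm (\<Sum>j<n. T i j ((1/t) *\<^sub>R v j)))\<^sup>2) \<le> op_mat_norm n T"
    by (intro op_mat_norm_upper) simp
  also have "(\<Sum>i<n. (norm (\<Sum>j<n. T i j ((1/t) *\<^sub>R v j)))\<^sup>2) = (1/t)\<^sup>2 * (\<Sum>i<n. (norm (\<Sum>j<n. T i j (v j)))\<^sup>2)"
    by (simp add: blinfun.scaleR_right scaleR_sum_right[symmetric] power_mult_distrib sum_distrib_left power_divide)
  finally have "(1/t) * sqrt (\<Sum>i<n. (norm (\<Sum>j<n. T i j (v j)))\<^sup>2) \<le> op_mat_norm n T"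
    using t(1) by (simp add: real_sqrt_mult real_sqrt_divide)
  then have "sqrt (\<Sum>i<n. (norm (\<Sum>j<n. T i j (v j)))\<^sup>2) \<le> op_mat_norm n T * t"
    using t(1) by (simp add: field_simps)
  then have "(sqrt (\<Sum>i<n. (norm (\<Sum>j<n. T i j (v j)))\<^sup>2))\<^sup>2 \<le> (op_mat_norm n T * t)\<^sup>2"
    by (rule power_mono) (simp add: sum_nonneg)
  then show ?thesis by (simp add: sum_nonneg power_mult_distrib t(2))
qed

lemma op_mat_norm_least:
  fixes T :: "nat \<Rightarrow> nat \<Rightarrow> 'h::complex_hilbert_space \<Rightarrow>\<^sub>L 'h"
  assumes "C \<ge> 0" "\<And>v. (\<Sum>i<n. (norm (\<Sum>j<n. T i j (v j)))\<^sup>2) \<le> C\<^sup>2 * (\<Sum>j<n. (norm (v j))\<^sup>2)"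
  shows "op_mat_norm n T \<le> C"
  unfolding op_mat_norm_def
proof (rule cSup_least)
  show "{sqrt (\<Sum>i<n. (norm (\<Sum>j<n. T i j (v j)))\<^sup>2) |v. (\<Sum>j<n. (norm (v j))\<^sup>2) \<le> 1} \<noteq> {}"
    by (simp, rule exI[of _ "\<lambda>_. 0"], simp)
  fix x assume "x \<in> {sqrt (\<Sum>i<n. (norm (\<Sum>j<n. T i j (v j)))\<^sup>2) |v. (\<Sum>j<n. (norm (v j))\<^sup>2) \<le> 1}"
  then obtain v where v: "x = sqrt (\<Sum>i<n. (norm (\<Sum>j<n. T i j (v j)))\<^sup>2)" "(\<Sum>j<n. (norm (v j))\<^sup>2) \<le> 1"
    by blast
  have "(\<Sum>i<n. (norm (\<Sum>j<n. T i j (v j)))\<^sup>2) \<le> C\<^sup>2"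
    using assms(2)[of v] mult_left_mono[OF v(2), of "C\<^sup>2"] by simp
  then have "x \<le> sqrt (C\<^sup>2)" unfolding v(1) by (rule real_sqrt_le_mono)
  then show "x \<le> C" using assms(1) by simp
qed

section \<open>Cyclic subspaces of minimal projections\<close>

lemma csubspace_closure:
  assumes "csubspace V"
  shows "csubspace (closure V)"
  unfolding csubspace_def
proof (intro conjI ballI allI)
  show "0 \<in> closure V" using assms closure_subset by (auto simp: csubspace_def)
  show "x + y \<in> closure V" if xy: "x \<in> closure V" "y \<in> closure V" for x y
  proof -
    obtain f g where "\<And>n. f n \<in> V" "f \<longlonglongrightarrow> x" "\<And>n. g n \<in> V" "g \<longlonglongrightarrow> y"
      using xy unfolding closure_sequential by metis
    then show ?thesis unfolding closure_sequential using assms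
      by (intro exI[of _ "\<lambda>n. f n + g n"]) (simp add: csubspace_def tendsto_add)
  qed
  show "scaleC c x \<in> closure V" if x: "x \<in> closure V" for c x
  proof -
    obtain f where "\<And>n. f n \<in> V" "f \<longlonglongrightarrow> x" using x unfolding closure_sequential by blast
    then show ?thesis unfolding closure_sequential using assms
      by (intro exI[of _ "\<lambda>n. scaleC c (f n)"])
        (simp add: csubspace_def bounded_linear.tendsto[OF bounded_linear_scaleC])
  qed
qed

context complemented_algebra
begin

text \<open>\<open>A\<close> is self-adjoint by now, so \<open>Q w\<^sup>* z Q\<close> is an element
  of the corner of \<open>Q\<close>, hence a scalar multiple of \<open>Q\<close>. The scalar does
  not depend on the vectors.\<close>

lemma MP_inner:
  assumes Q: "Q \<in> minimal_projections" and zw: "z \<in> A" "w \<in> A"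
  obtains c where "op_adj (w o\<^sub>L Q) o\<^sub>L (z o\<^sub>L Q) = op_scale c Q"
    "\<And>x y. Q x = x \<Longrightarrow> Q y = y \<Longrightarrow> cinner (z x) (w y) = c * cinner x y"
proof -
  note D = MP_D[OF Q]
  have adj: "op_adj (w o\<^sub>L Q) = Q o\<^sub>L op_adj w" by (simp add: op_adj_compose A_B zw D)
  obtain c where c: "Q o\<^sub>L ((op_adj w o\<^sub>L z) o\<^sub>L Q) = op_scale c Q"
    using MP_corner[OF Q A_comp[OF A_adjoint[OF zw(2)] zw(1)]] .
  then have eq: "op_adj (w o\<^sub>L Q) o\<^sub>L (z o\<^sub>L Q) = op_scale c Q" by (simp add: adj blinfun_compose_assoc)
  show ?thesis
  proof (rule that[OF eq])
    fix x y assume xy: "Q x = x" "Q y = y"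
    have "cinner (z x) (w y) = cinner ((z o\<^sub>L Q) x) ((w o\<^sub>L Q) y)" by (simp add: xy)
    also have "\<dots> = cinner ((op_adj (w o\<^sub>L Q) o\<^sub>L (z o\<^sub>L Q)) x) y"
      by (simp only: blinfun_apply_blinfun_compose[of "op_adj (w o\<^sub>L Q)"] cinner_op_adj_left[OF B_ops_compose[OF A_B[OF zw(2)] D(5)]])
    also have "\<dots> = c * cinner x y" by (simp add: eq op_scale_apply cinner_scaleC_left xy)
    finally show "cinner (z x) (w y) = c * cinner x y" .
  qed
qed

text \<open>Taking \<open>w = z\<close> in \<open>MP_inner\<close>, every element of
  \<open>A\<close> acts on the range of \<open>Q\<close> as a multiple of an isometry.\<close>

lemma MP_norm:
  assumes Q: "Q \<in> minimal_projections" and z: "z \<in> A" and x: "Q x = x"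
  shows "norm (z x) = norm (z o\<^sub>L Q) * norm x"
proof -
  note D = MP_D[OF Q]
  obtain c where c: "\<And>x y. Q x = x \<Longrightarrow> Q y = y \<Longrightarrow> cinner (z x) (z y) = c * cinner x y"
    using MP_inner[OF Q z z] by metis
  have n: "(norm (z x))\<^sup>2 = Re c * (norm x)\<^sup>2" if "Q x = x" for x
    using arg_cong[OF c[OF that that], of Re] by (simp add: cinner_same)
  have QQ: "Q (Q x) = Q x" for x by (metis D(2) blinfun_apply_blinfun_compose)
  obtain y where "Q y \<noteq> 0" using D(4) by (metis blinfun_eqI zero_blinfun.rep_eq)
  then have c0: "Re c \<ge> 0"
  proof -
    have "0 \<le> Re c * (norm (Q y))\<^sup>2" unfolding n[OF QQ, symmetric] by simp
    then show ?thesis using \<open>Q y \<noteq> 0\<close> by (simp add: zero_le_mult_iff)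
  qed
  have "norm (z o\<^sub>L Q) \<le> sqrt (Re c)"
  proof (rule norm_blinfun_bound)
    fix y
    have "(norm ((z o\<^sub>L Q) y))\<^sup>2 = Re c * (norm (Q y))\<^sup>2" using n[OF QQ] by simp
    also have "\<dots> \<le> Re c * (norm y)\<^sup>2"
      using c0 orthogonal_projection_norm_le_1(1)[OF D(5,2,3), of y] by (intro mult_left_mono power_mono) auto
    also have "\<dots> = (sqrt (Re c) * norm y)\<^sup>2" using c0 by (simp add: power_mult_distrib)
    finally show "norm ((z o\<^sub>L Q) y) \<le> sqrt (Re c) * norm y"
      by (rule power2_le_imp_le) (simp add: c0)
  qed (simp add: c0)
  moreover have "norm (z x) = sqrt (Re c) * norm x"
    using n[OF x] by (metis norm_ge_zero real_sqrt_mult real_sqrt_unique)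
  moreover have "norm (z x) \<le> norm (z o\<^sub>L Q) * norm x"
    using norm_blinfun[of "z o\<^sub>L Q" x] x by simp
  ultimately show ?thesis
    by (metis mult_right_mono norm_ge_zero order_antisym)
qed

section \<open>Cyclic subspaces and equivalence of the representations on them\<close>

definition unit_vectors :: "'h set" where
  "unit_vectors = {\<eta>. norm \<eta> = 1 \<and> (\<exists>Q\<in>minimal_projections. blinfun_apply Q \<eta> = \<eta>)}"

definition support :: "'h \<Rightarrow> 'h \<Rightarrow>\<^sub>L 'h" where
  "support \<eta> = (SOME Q. Q \<in> minimal_projections \<and> blinfun_apply Q \<eta> = \<eta>)"

definition cyclic :: "'h \<Rightarrow> 'h set" where
  "cyclic \<eta> = (\<lambda>a. blinfun_apply a \<eta>) ` A"

lemma support: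
  assumes "\<eta> \<in> unit_vectors"
  shows "support \<eta> \<in> minimal_projections" "support \<eta> \<eta> = \<eta>" "norm \<eta> = 1"
proof -
  have "\<exists>Q. Q \<in> minimal_projections \<and> blinfun_apply Q \<eta> = \<eta>" "norm \<eta> = 1"
    using assms by (auto simp: unit_vectors_def)
  from someI_ex[OF this(1)] this(2)
  show "support \<eta> \<in> minimal_projections" "support \<eta> \<eta> = \<eta>" "norm \<eta> = 1" by (simp_all add: support_def)
qed

lemma cyclic_invariant: "a \<in> A \<Longrightarrow> v \<in> cyclic \<eta> \<Longrightarrow> a v \<in> cyclic \<eta>"
  by (auto simp: cyclic_def blinfun_apply_blinfun_compose[symmetric] A_comp simp del: blinfun_apply_blinfun_compose)

lemma cyclic_self: "\<eta> \<in> unit_vectors \<Longrightarrow> \<eta> \<in> cyclic \<eta>"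
  using support[of \<eta>] MP_D(1) by (force simp: cyclic_def)

lemma csubspace_cyclic: "csubspace (cyclic \<eta>)"
  unfolding csubspace_def cyclic_def
proof (intro conjI ballI allI)
  show "0 \<in> (\<lambda>a. blinfun_apply a \<eta>) ` A" using A_zero by force
  show "x + y \<in> (\<lambda>a. blinfun_apply a \<eta>) ` A"
    if "x \<in> (\<lambda>a. blinfun_apply a \<eta>) ` A" "y \<in> (\<lambda>a. blinfun_apply a \<eta>) ` A" for x y
    using that by (auto simp: blinfun.add_left[symmetric] A_add)
  show "scaleC c x \<in> (\<lambda>a. blinfun_apply a \<eta>) ` A" if "x \<in> (\<lambda>a. blinfun_apply a \<eta>) ` A" for c x
    using that by (auto simp: op_scale_apply[symmetric] A_scale)
qed

text \<open>By \<open>MP_norm\<close> evaluation at \<eta> is isometric on \<open>A Q\<close> for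
  the support \<open>Q\<close> of \<eta>, so a convergent sequence in the cyclic subspace lifts to a
  Cauchy sequence in \<open>A\<close>.\<close>

lemma closed_cyclic:
  assumes \<eta>: "\<eta> \<in> unit_vectors"
  shows "closed (cyclic \<eta>)"
  unfolding closed_sequential_limits
proof (intro allI impI, elim conjE)
  note s = support[OF \<eta>]
  note D = MP_D[OF s(1)]
  fix x l assume x: "\<forall>n. x n \<in> cyclic \<eta>" "x \<longlonglongrightarrow> l"
  then have "\<forall>n. \<exists>a. a \<in> A \<and> x n = a \<eta>" by (auto simp: cyclic_def)
  then obtain z where z: "\<And>n. z n \<in> A" "\<And>n. x n = z n \<eta>" by metis
  define y where "y n = z n o\<^sub>L support \<eta>" for n
  have y: "y n \<in> A" "x n = y n \<eta>" for n using z s(2) D(1) by (simp_all add: y_def A_comp)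
  have "norm (y n - y m) = norm (x n - x m)" for n m
  proof -
    have "norm ((z n - z m) \<eta>) = norm ((z n - z m) o\<^sub>L support \<eta>) * norm \<eta>"
      by (rule MP_norm[OF s(1) A_diff[OF z(1) z(1)] s(2)])
    then show ?thesis using s(3) z(2) by (simp add: y_def blinfun.diff_left blinfun_compose_simps)
  qed
  then have "Cauchy y"
    using LIMSEQ_imp_Cauchy[OF x(2)] by (simp add: Cauchy_def dist_norm)
  then obtain a where a: "y \<longlonglongrightarrow> a" by (metis Cauchy_convergent convergent_def)
  then have "a \<in> A" using closed_sequentially[OF A_closed] y(1) by blast
  moreover have "(\<lambda>n. y n \<eta>) \<longlonglongrightarrow> a \<eta>" by (intro blinfun.tendsto a tendsto_const)
  then have "l = a \<eta>" using x(2) by (simp add: y(2)[symmetric] LIMSEQ_unique)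
  ultimately show "l \<in> cyclic \<eta>" by (auto simp: cyclic_def)
qed

text \<open>A nonzero \<open>P a Q\<close> gives, by right multiplication, a nonzero module map
  between the minimal left ideals \<open>A P\<close> and \<open>A Q\<close>; so linked projections
  belong to equivalent irreducible representations.\<close>

definition linked :: "('h \<Rightarrow>\<^sub>L 'h) \<Rightarrow> ('h \<Rightarrow>\<^sub>L 'h) \<Rightarrow> bool" where
  "linked P Q \<longleftrightarrow> (\<exists>a\<in>A. P o\<^sub>L (a o\<^sub>L Q) \<noteq> 0)"

lemma linked_refl: "Q \<in> minimal_projections \<Longrightarrow> linked Q Q"
  using MP_D by (auto simp: linked_def intro!: bexI[of _ Q])

lemma linked_sym:
  assumes PQ: "P \<in> minimal_projections" "Q \<in> minimal_projections" and l: "linked P Q"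
  shows "linked Q P"
proof -
  note D = MP_D[OF PQ(1)] MP_D[OF PQ(2)]
  obtain a where a: "a \<in> A" "P o\<^sub>L (a o\<^sub>L Q) \<noteq> 0" using l by (auto simp: linked_def)
  have eq: "op_adj (P o\<^sub>L (a o\<^sub>L Q)) = Q o\<^sub>L (op_adj a o\<^sub>L P)"
    using D a(1) by (simp add: op_adj_compose B_ops_compose A_B blinfun_compose_assoc)
  have "Q o\<^sub>L (op_adj a o\<^sub>L P) \<noteq> 0"
    using a D eq by (metis A_B B_ops_compose op_adj_adj op_adj_zero)
  then show ?thesis using A_adjoint[OF a(1)] by (auto simp: linked_def)
qed

text \<open>\<open>MP_minimal\<close> provides a left factor that turns \<open>P a Q\<close> into
  \<open>Q\<close>; it would turn \<open>P a Q b R = 0\<close> into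
  \<open>Q b R = 0\<close>.\<close>

lemma linked_trans:
  assumes MP: "P \<in> minimal_projections" "Q \<in> minimal_projections" "R \<in> minimal_projections"
    and l: "linked P Q" "linked Q R"
  shows "linked P R"
proof (rule ccontr)
  assume nl: "\<not> linked P R"
  note D = MP_D[OF MP(1)] and D' = MP_D[OF MP(2)]
  obtain a where a: "a \<in> A" "P o\<^sub>L (a o\<^sub>L Q) \<noteq> 0" using l by (auto simp: linked_def)
  obtain b where b: "b \<in> A" "Q o\<^sub>L (b o\<^sub>L R) \<noteq> 0" using l by (auto simp: linked_def)
  obtain v where v: "v \<in> A" "v o\<^sub>L ((P o\<^sub>L a) o\<^sub>L Q) = Q"
    using MP_minimal[OF MP(2), of "P o\<^sub>L a"] a D by (auto simp: A_comp blinfun_compose_assoc)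
  have "P o\<^sub>L (((a o\<^sub>L Q) o\<^sub>L b) o\<^sub>L R) = 0"
    using nl a(1) b(1) D' A_comp unfolding linked_def by blast
  then have "v o\<^sub>L (P o\<^sub>L (((a o\<^sub>L Q) o\<^sub>L b) o\<^sub>L R)) = 0" by simp
  moreover have "v o\<^sub>L (P o\<^sub>L (((a o\<^sub>L Q) o\<^sub>L b) o\<^sub>L R)) = (v o\<^sub>L ((P o\<^sub>L a) o\<^sub>L Q)) o\<^sub>L (b o\<^sub>L R)"
    by (simp add: blinfun_compose_assoc)
  ultimately show False using v(2) b(2) by simp
qed

text \<open>With \<open>Q\<close> the support of \<eta>, these elements \<open>z Q w\<^sup>*\<close>
  give the rank one operators of one summand and act as 0 on the inequivalent ones. The scalar comes
  from \<open>MP_inner\<close>.\<close>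

lemma rank_one:
  assumes \<eta>: "\<eta> \<in> unit_vectors" and zw: "z \<in> A" "w \<in> A"
  defines "r \<equiv> (z o\<^sub>L support \<eta>) o\<^sub>L op_adj (w o\<^sub>L support \<eta>)"
  shows "r \<in> A" "\<And>v. v \<in> cyclic \<eta> \<Longrightarrow> r v = scaleC (cinner v (w \<eta>)) (z \<eta>)"
    "\<And>\<omega> v. \<omega> \<in> unit_vectors \<Longrightarrow> \<not> linked (support \<eta>) (support \<omega>) \<Longrightarrow> v \<in> cyclic \<omega> \<Longrightarrow> r v = 0"
proof -
  note s = support[OF \<eta>]
  note D = MP_D[OF s(1)]
  show "r \<in> A" by (simp add: r_def A_comp zw D MP_adjoint[OF s(1)])
  show "r v = scaleC (cinner v (w \<eta>)) (z \<eta>)" if v: "v \<in> cyclic \<eta>" for v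
  proof -
    obtain u where u: "u \<in> A" "v = u \<eta>" using v by (auto simp: cyclic_def)
    obtain c where c: "op_adj (w o\<^sub>L support \<eta>) o\<^sub>L (u o\<^sub>L support \<eta>) = op_scale c (support \<eta>)"
      "\<And>x y. support \<eta> x = x \<Longrightarrow> support \<eta> y = y \<Longrightarrow> cinner (u x) (w y) = c * cinner x y"
      using MP_inner[OF s(1) u(1) zw(2)] by metis
    have "op_adj (w o\<^sub>L support \<eta>) v = (op_adj (w o\<^sub>L support \<eta>) o\<^sub>L (u o\<^sub>L support \<eta>)) \<eta>"
      by (simp add: u(2) s(2))
    also have "\<dots> = scaleC c \<eta>" by (simp add: c(1) op_scale_apply s(2))
    finally have "op_adj (w o\<^sub>L support \<eta>) v = scaleC c \<eta>" .
    moreover have "cinner v (w \<eta>) = c" using c(2)[OF s(2) s(2)] s(3) by (simp add: u(2) cinner_same)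
    ultimately show ?thesis using s(2) by (simp add: r_def B_opsD[OF A_B] zw(1) B_opsD[OF D(5)])
  qed
  show "r v = 0" if \<omega>: "\<omega> \<in> unit_vectors" and nl: "\<not> linked (support \<eta>) (support \<omega>)" and v: "v \<in> cyclic \<omega>" for \<omega> v
  proof -
    obtain u where u: "u \<in> A" "v = u \<omega>" using v by (auto simp: cyclic_def)
    have "support \<eta> o\<^sub>L ((op_adj w o\<^sub>L u) o\<^sub>L support \<omega>) = 0"
      using nl A_comp[OF A_adjoint[OF zw(2)] u(1)] by (auto simp: linked_def)
    from arg_cong[OF this, of "\<lambda>T. blinfun_apply T \<omega>"]
    have "support \<eta> (op_adj w v) = 0" by (simp add: support(2)[OF \<omega>] u(2))
    moreover have "op_adj (w o\<^sub>L support \<eta>) = support \<eta> o\<^sub>L op_adj w" by (simp add: op_adj_compose A_B zw D)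
    ultimately show ?thesis by (simp add: r_def)
  qed
qed

text \<open>\<open>Q\<close> acts on an equivalent cyclic subspace as a rank one projection: a
  suitable element of \<open>rank_one\<close> form lies in the corner of \<open>Q\<close>, so it is
  a multiple of \<open>Q\<close>, and evaluation at its own vector \<xi> shows that the multiple is
  1.\<close>

lemma linked_vector:
  assumes Q: "Q \<in> minimal_projections" and \<eta>: "\<eta> \<in> unit_vectors" and l: "linked Q (support \<eta>)"
  obtains \<xi> where "\<xi> \<in> cyclic \<eta>" "norm \<xi> = 1" "Q \<xi> = \<xi>" "\<And>v. v \<in> cyclic \<eta> \<Longrightarrow> Q v = scaleC (cinner v \<xi>) \<xi>"
proof -
  note s = support[OF \<eta>]
  note D = MP_D[OF s(1)] and D' = MP_D[OF Q]
  obtain a where a: "a \<in> A" "Q o\<^sub>L (a o\<^sub>L support \<eta>) \<noteq> 0" using l by (auto simp: linked_def)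
  define t where "t = norm (Q o\<^sub>L (a o\<^sub>L support \<eta>))"
  have t: "t > 0" using a(2) by (simp add: t_def)
  define y where "y = op_scale (complex_of_real (1 / t)) (Q o\<^sub>L a)"
  have yA: "y \<in> A" by (simp add: y_def A_scale A_comp a D')
  define \<xi> where "\<xi> = y \<eta>"
  have \<xi>: "\<xi> \<in> cyclic \<eta>" using yA by (auto simp: \<xi>_def cyclic_def)
  have "norm \<xi> = norm (y o\<^sub>L support \<eta>)" using MP_norm[OF s(1) yA s(2)] s(3) by (simp add: \<xi>_def)
  also have "\<dots> = 1" using t by (simp add: y_def op_scale_compose_left blinfun_compose_assoc norm_op_scale t_def[symmetric] norm_divide)
  finally have n1: "norm \<xi> = 1" .
  have "Q o\<^sub>L y = y"
    by (simp add: y_def op_scale_compose_right D' blinfun_compose_assoc_eq[OF D'(2)])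
  then have Q\<xi>: "Q \<xi> = \<xi>" unfolding \<xi>_def by (metis blinfun_apply_blinfun_compose)
  define r where "r = (y o\<^sub>L support \<eta>) o\<^sub>L op_adj (y o\<^sub>L support \<eta>)"
  have r: "r \<in> A" "\<And>v. v \<in> cyclic \<eta> \<Longrightarrow> r v = scaleC (cinner v \<xi>) \<xi>"
    unfolding r_def \<xi>_def using rank_one(1,2)[OF \<eta> yA yA] by auto
  have adjy: "op_adj (y o\<^sub>L support \<eta>) = support \<eta> o\<^sub>L op_adj y" by (simp add: op_adj_compose A_B yA D)
  have "op_adj y o\<^sub>L Q = op_adj y"
    using \<open>Q o\<^sub>L y = y\<close> D' by (metis A_B op_adj_compose yA)
  \<comment> \<open>\<open>y\<close> starts with \<open>Q\<close> on the left and its adjoint ends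
    with \<open>Q\<close>, so \<open>r\<close> is unchanged by compression to the corner.\<close>
  then have "Q o\<^sub>L (r o\<^sub>L Q) = r"
    using \<open>Q o\<^sub>L y = y\<close> by (simp add: r_def adjy blinfun_compose_assoc blinfun_compose_assoc_eq[OF \<open>Q o\<^sub>L y = y\<close>])
  moreover obtain d where "Q o\<^sub>L (r o\<^sub>L Q) = op_scale d Q" using MP_corner[OF Q r(1)] .
  ultimately have rd: "r = op_scale d Q" by simp
  have "scaleC d \<xi> = \<xi>"
    using r(2)[OF \<xi>] n1 by (simp add: rd op_scale_apply Q\<xi> cinner_same)
  then have "cinner (scaleC d \<xi>) \<xi> = cinner \<xi> \<xi>" by simp
  then have "d = 1" using n1 by (simp add: cinner_scaleC_left cinner_same)
  then have "Q v = scaleC (cinner v \<xi>) \<xi>" if "v \<in> cyclic \<eta>" for v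
    using r(2)[OF that] by (simp add: rd op_scale_simps)
  then show ?thesis using that[OF \<xi> n1 Q\<xi>] by blast
qed

lemma not_linked_zero:
  assumes "\<eta> \<in> unit_vectors" "\<not> linked Q (support \<eta>)" "v \<in> cyclic \<eta>"
  shows "Q v = 0"
proof -
  obtain u where u: "u \<in> A" "v = u \<eta>" using assms(3) by (auto simp: cyclic_def)
  have "Q o\<^sub>L (u o\<^sub>L support \<eta>) = 0" using assms(2) u(1) by (auto simp: linked_def)
  from arg_cong[OF this, of "\<lambda>T. blinfun_apply T \<eta>"] show ?thesis
    using support(2)[OF assms(1)] by (simp add: u(2))
qed

end

section \<open>Decomposition into cyclic subspaces\<close>

text \<open>\<open>\<Omega>\<close> indexes an orthogonal decomposition of the nondegenerate part of \<open>H\<close> into irreducible subspaces;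
  \<open>I\<close> picks one of them from each unitary equivalence class, and so indexes the summands \<open>K(H\<^sub>i)\<close>.\<close>

locale cyclic_decomposition = complemented_algebra A U
  for A :: "('h::complex_hilbert_space \<Rightarrow>\<^sub>L 'h) set" and U +
  fixes \<Omega> I :: "'h set"
  assumes \<Omega>_unit: "\<Omega> \<subseteq> unit_vectors"
    and \<Omega>_orth: "\<lbrakk>\<eta> \<in> \<Omega>; \<omega> \<in> \<Omega>; \<eta> \<noteq> \<omega>; v \<in> cyclic \<eta>; w \<in> cyclic \<omega>\<rbrakk> \<Longrightarrow> cinner v w = 0"
    and \<Omega>_total: "\<lbrakk>\<And>\<omega> v. \<omega> \<in> \<Omega> \<Longrightarrow> v \<in> cyclic \<omega> \<Longrightarrow> cinner v x = 0; a \<in> A\<rbrakk> \<Longrightarrow> blinfun_apply a x = 0"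
    and I_\<Omega>: "I \<subseteq> \<Omega>"
    and I_linked: "\<eta> \<in> \<Omega> \<Longrightarrow> \<exists>\<omega>\<in>I. linked (support \<eta>) (support \<omega>)"
    and I_unlinked: "\<lbrakk>\<eta> \<in> I; \<omega> \<in> I; linked (support \<eta>) (support \<omega>)\<rbrakk> \<Longrightarrow> \<eta> = \<omega>"

context complemented_algebra
begin

definition orthogonal_family :: "'h set \<Rightarrow> bool" where
  "orthogonal_family \<Omega> \<longleftrightarrow> \<Omega> \<subseteq> unit_vectors \<and>
     (\<forall>\<eta>\<in>\<Omega>. \<forall>\<omega>\<in>\<Omega>. \<eta> \<noteq> \<omega> \<longrightarrow> (\<forall>v\<in>cyclic \<eta>. \<forall>w\<in>cyclic \<omega>. cinner v w = 0))"

lemma maximal_orthogonal_family: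
  obtains \<Omega> where "orthogonal_family \<Omega>"
    "\<And>\<eta>. \<eta> \<in> unit_vectors \<Longrightarrow> \<exists>\<omega>\<in>\<Omega>. \<exists>v\<in>cyclic \<omega>. \<exists>w\<in>cyclic \<eta>. cinner v w \<noteq> 0"
proof -
  have "\<exists>M\<in>Collect orthogonal_family. \<forall>X\<in>Collect orthogonal_family. M \<subseteq> X \<longrightarrow> X = M"
  proof (rule subset_Zorn')
    fix C assume C: "subset.chain (Collect orthogonal_family) C"
    have mem: "\<And>X. X \<in> C \<Longrightarrow> orthogonal_family X" and lin: "\<And>X Y. X \<in> C \<Longrightarrow> Y \<in> C \<Longrightarrow> X \<subseteq> Y \<or> Y \<subseteq> X"
      using C by (auto simp: subset_chain_def)
    have "cinner v w = 0" if XY: "X \<in> C" "Y \<in> C" "\<eta> \<in> X" "\<omega> \<in> Y" and vw: "\<eta> \<noteq> \<omega>" "v \<in> cyclic \<eta>" "w \<in> cyclic \<omega>"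
      for X Y \<eta> \<omega> v w
    proof -
      obtain Z where "Z \<in> C" "\<eta> \<in> Z" "\<omega> \<in> Z" using lin[OF XY(1,2)] XY by blast
      then show ?thesis using mem[of Z] vw unfolding orthogonal_family_def by blast
    qed
    moreover have "\<Union>C \<subseteq> unit_vectors" using mem unfolding orthogonal_family_def by blast
    ultimately show "\<Union>C \<in> Collect orthogonal_family"
      unfolding orthogonal_family_def by blast
  qed
  then obtain M where M: "orthogonal_family M" "\<And>X. orthogonal_family X \<Longrightarrow> M \<subseteq> X \<Longrightarrow> X = M" by auto
  have "\<exists>\<omega>\<in>M. \<exists>v\<in>cyclic \<omega>. \<exists>w\<in>cyclic \<eta>. cinner v w \<noteq> 0" if \<eta>: "\<eta> \<in> unit_vectors" for \<eta>
  proof (rule ccontr)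
    assume "\<not> ?thesis"
    then have orth: "\<And>\<omega> v w. \<omega> \<in> M \<Longrightarrow> v \<in> cyclic \<omega> \<Longrightarrow> w \<in> cyclic \<eta> \<Longrightarrow> cinner v w = 0" by blast
    then have orth': "\<And>\<omega> v w. \<omega> \<in> M \<Longrightarrow> v \<in> cyclic \<omega> \<Longrightarrow> w \<in> cyclic \<eta> \<Longrightarrow> cinner w v = 0"
      by (metis cinner_commute complex_cnj_zero)
    have "orthogonal_family (insert \<eta> M)"
      using M(1) \<eta> orth orth' by (auto simp: orthogonal_family_def)
    then have "\<eta> \<in> M" using M(2) by blast
    then have "cinner \<eta> \<eta> = 0" using orth cyclic_self[OF \<eta>] by blast
    then show False using support(3)[OF \<eta>] by (simp add: cinner_same)
  qed
  then show ?thesis using that M(1) by blast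
qed

text \<open>Totality comes from maximality: if \<open>x\<close> is orthogonal to the family and
  \<open>Q x\<close> is nonzero, the normalized \<open>Q x\<close> generates a cyclic subspace
  orthogonal to the whole family. So all minimal projections kill \<open>x\<close>, and
  \<open>A_induct\<close> extends this to \<open>A\<close>.\<close>

lemma cyclic_decomposition_exists:
  obtains \<Omega> I where "cyclic_decomposition A U \<Omega> I"
proof -
  obtain \<Omega> where \<Omega>: "orthogonal_family \<Omega>"
    "\<And>\<eta>. \<eta> \<in> unit_vectors \<Longrightarrow> \<exists>\<omega>\<in>\<Omega>. \<exists>v\<in>cyclic \<omega>. \<exists>w\<in>cyclic \<eta>. cinner v w \<noteq> 0"
    using maximal_orthogonal_family by blast
  have \<Omega>u: "\<Omega> \<subseteq> unit_vectors" using \<Omega>(1) by (simp add: orthogonal_family_def)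
  have MP: "support \<eta> \<in> minimal_projections" if "\<eta> \<in> \<Omega>" for \<eta>
    using support(1) \<Omega>u that by blast
  define rep where "rep \<eta> = (SOME \<omega>. \<omega> \<in> \<Omega> \<and> linked (support \<eta>) (support \<omega>))" for \<eta>
  have rep: "rep \<eta> \<in> \<Omega>" "linked (support \<eta>) (support (rep \<eta>))" if "\<eta> \<in> \<Omega>" for \<eta>
    using someI_ex[of "\<lambda>\<omega>. \<omega> \<in> \<Omega> \<and> linked (support \<eta>) (support \<omega>)"] linked_refl[OF MP[OF that]] that
    unfolding rep_def by blast+
  have rep_eq: "rep \<eta> = rep \<omega>" if "\<eta> \<in> \<Omega>" "\<omega> \<in> \<Omega>" "linked (support \<eta>) (support \<omega>)" for \<eta> \<omega>
  proof -
    have "linked (support \<eta>) (support \<alpha>) \<longleftrightarrow> linked (support \<omega>) (support \<alpha>)" if "\<alpha> \<in> \<Omega>" for \<alpha>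
      using linked_trans linked_sym MP that \<open>\<eta> \<in> \<Omega>\<close> \<open>\<omega> \<in> \<Omega>\<close> \<open>linked (support \<eta>) (support \<omega>)\<close> by metis
    \<comment> \<open>Linked vectors give equivalent predicates, so the choice operator returns the
      same representative.\<close>
    then show ?thesis unfolding rep_def by metis
  qed
  have "cyclic_decomposition A U \<Omega> (rep ` \<Omega>)"
  proof unfold_locales
    show "\<Omega> \<subseteq> unit_vectors" by (rule \<Omega>u)
    show "cinner v w = 0" if "\<eta> \<in> \<Omega>" "\<omega> \<in> \<Omega>" "\<eta> \<noteq> \<omega>" "v \<in> cyclic \<eta>" "w \<in> cyclic \<omega>" for \<eta> \<omega> v w
      using \<Omega>(1) that by (simp add: orthogonal_family_def)
    show "rep ` \<Omega> \<subseteq> \<Omega>" using rep(1) by blast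
    show "\<exists>\<omega>\<in>rep ` \<Omega>. linked (support \<eta>) (support \<omega>)" if "\<eta> \<in> \<Omega>" for \<eta> using rep(2) that by blast
    show "\<eta> = \<omega>" if "\<eta> \<in> rep ` \<Omega>" "\<omega> \<in> rep ` \<Omega>" "linked (support \<eta>) (support \<omega>)" for \<eta> \<omega>
    proof -
      obtain \<alpha> \<beta> where ab: "\<alpha> \<in> \<Omega>" "\<eta> = rep \<alpha>" "\<beta> \<in> \<Omega>" "\<omega> = rep \<beta>" using \<open>\<eta> \<in> rep ` \<Omega>\<close> \<open>\<omega> \<in> rep ` \<Omega>\<close> by blast
      have "linked (support \<alpha>) (support \<omega>)"
        using linked_trans[OF MP MP MP] rep ab \<open>linked (support \<eta>) (support \<omega>)\<close> by metis
      then have "linked (support \<alpha>) (support \<beta>)"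
        using linked_trans[OF MP MP MP] linked_sym[OF MP MP] rep ab by metis
      then show ?thesis using rep_eq ab by metis
    qed
    fix x a assume x: "\<And>\<omega> v. \<omega> \<in> \<Omega> \<Longrightarrow> v \<in> cyclic \<omega> \<Longrightarrow> cinner v x = 0" and a: "a \<in> A"
    have Qx: "Q x = 0" if Q: "Q \<in> minimal_projections" for Q
    proof (rule ccontr)
      assume ne: "Q x \<noteq> 0"
      note D = MP_D[OF Q]
      define \<eta> where "\<eta> = (1 / norm (Q x)) *\<^sub>R Q x"
      have "Q (Q x) = Q x" by (metis D(2) blinfun_apply_blinfun_compose)
      then have "\<eta> \<in> unit_vectors"
        using ne Q by (auto simp: \<eta>_def unit_vectors_def blinfun.scaleR_right intro!: bexI[of _ Q])
      then obtain \<omega> v w where vw: "\<omega> \<in> \<Omega>" "v \<in> cyclic \<omega>" "w \<in> cyclic \<eta>" "cinner v w \<noteq> 0" using \<Omega>(2) by blast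
      obtain b where b: "b \<in> A" "w = b \<eta>" using vw(3) by (auto simp: cyclic_def)
      have "cinner v w = (1 / norm (Q x)) *\<^sub>R cinner v ((b o\<^sub>L Q) x)"
        by (simp add: b(2) \<eta>_def blinfun.scaleR_right bounded_bilinear.scaleR_right[OF bounded_bilinear_cinner])
      \<comment> \<open>The adjoint of \<open>b Q\<close> lies in \<open>A\<close> and hence keeps
        \<open>v\<close> inside its cyclic subspace, to which \<open>x\<close> is
        orthogonal.\<close>
      also have "cinner v ((b o\<^sub>L Q) x) = cinner (op_adj (b o\<^sub>L Q) v) x"
        by (rule cinner_op_adj_left[symmetric]) (intro B_ops_compose A_B b D)
      also have "\<dots> = 0"
        by (rule x[OF vw(1)]) (intro cyclic_invariant A_adjoint A_comp b D vw)
      finally show False using vw(4) by simp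
    qed
    have "A \<subseteq> {a. blinfun_apply a x = 0}"
    proof (rule A_induct)
      show "closed {a. blinfun_apply a x = 0}" by (intro closed_Collect_eq continuous_intros)
      show "op_subspace {a. blinfun_apply a x = 0}"
        by (simp add: op_subspace_def blinfun.add_left op_scale_apply)
    qed (simp add: Qx)
    then show "a x = 0" using a by blast
  qed
  then show ?thesis by (rule that)
qed

end

section \<open>Matrix norm bounds carried from the representatives to all of
  \<open>H\<close>\<close>

context cyclic_decomposition
begin

lemma \<Omega>_D: "\<eta> \<in> \<Omega> \<Longrightarrow> \<eta> \<in> unit_vectors"
  and I_D: "\<eta> \<in> I \<Longrightarrow> \<eta> \<in> unit_vectors"
  using \<Omega>_unit I_\<Omega> by auto

text \<open>The representative's cyclic subspace contains a unit vector \<xi> fixed by the support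
  of \<eta>. By \<open>MP_norm\<close>, sending \<open>z \<eta>\<close> to \<open>z \<xi>\<close>
  preserves norms, and it commutes with the action of \<open>A\<close>.\<close>

lemma matrix_bound_transfer:
  fixes n :: nat
  assumes M: "\<And>i j. i < n \<Longrightarrow> j < n \<Longrightarrow> M i j \<in> A"
    and C: "\<And>\<eta> w. \<eta> \<in> I \<Longrightarrow> (\<And>j. j < n \<Longrightarrow> w j \<in> cyclic \<eta>) \<Longrightarrow>
      (\<Sum>i<n. (norm (\<Sum>j<n. blinfun_apply (M i j) (w j)))\<^sup>2) \<le> C\<^sup>2 * (\<Sum>j<n. (norm (w j))\<^sup>2)"
    and \<eta>: "\<eta> \<in> \<Omega>" and w: "\<And>j. j < n \<Longrightarrow> w j \<in> cyclic \<eta>"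
  shows "(\<Sum>i<n. (norm (\<Sum>j<n. blinfun_apply (M i j) (w j)))\<^sup>2) \<le> C\<^sup>2 * (\<Sum>j<n. (norm (w j))\<^sup>2)"
proof -
  note s = support[OF \<Omega>_D[OF \<eta>]]
  obtain \<omega> where \<omega>: "\<omega> \<in> I" "linked (support \<eta>) (support \<omega>)" using I_linked[OF \<eta>] by blast
  obtain \<xi> where \<xi>: "\<xi> \<in> cyclic \<omega>" "norm \<xi> = 1" "support \<eta> \<xi> = \<xi>"
    using linked_vector[OF s(1) I_D[OF \<omega>(1)] \<omega>(2)] by metis
  have same: "norm (z \<xi>) = norm (z \<eta>)" if "z \<in> A" for z
    using MP_norm[OF s(1) that s(2)] MP_norm[OF s(1) that \<xi>(3)] s(3) \<xi>(2) by simp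
  have "\<forall>j. \<exists>z. j < n \<longrightarrow> z \<in> A \<and> w j = blinfun_apply z \<eta>" using w by (auto simp: cyclic_def)
  then obtain z where z: "\<And>j. j < n \<Longrightarrow> z j \<in> A" "\<And>j. j < n \<Longrightarrow> w j = z j \<eta>" by metis
  have row: "norm (\<Sum>j<n. M i j (z j \<xi>)) = norm (\<Sum>j<n. M i j (w j))" if i: "i < n" for i
  proof -
    have "norm ((\<Sum>j<n. M i j o\<^sub>L z j) \<xi>) = norm ((\<Sum>j<n. M i j o\<^sub>L z j) \<eta>)"
      by (rule same) (auto intro!: A_sum A_comp M i z)
    then show ?thesis using z(2) by (simp add: blinfun_sum_apply)
  qed
  have "(\<Sum>i<n. (norm (\<Sum>j<n. M i j (z j \<xi>)))\<^sup>2) \<le> C\<^sup>2 * (\<Sum>j<n. (norm (z j \<xi>))\<^sup>2)"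
    by (rule C[OF \<omega>(1)]) (simp add: cyclic_invariant z \<xi>(1))
  also have "(\<Sum>j<n. (norm (z j \<xi>))\<^sup>2) = (\<Sum>j<n. (norm (w j))\<^sup>2)"
    by (intro sum.cong refl) (simp add: same z)
  also have "(\<Sum>i<n. (norm (\<Sum>j<n. M i j (z j \<xi>)))\<^sup>2) = (\<Sum>i<n. (norm (\<Sum>j<n. M i j (w j)))\<^sup>2)"
    by (intro sum.cong refl) (simp add: row)
  finally show ?thesis .
qed

definition finite_sums :: "'h set" where
  "finite_sums = {v. \<exists>F g. finite F \<and> F \<subseteq> \<Omega> \<and> (\<forall>\<eta>. g \<eta> \<in> cyclic \<eta>) \<and> v = (\<Sum>\<eta>\<in>F. g \<eta>)}"

lemma zero_cyclic: "0 \<in> cyclic \<eta>"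
  using csubspace_cyclic[of \<eta>] by (simp add: csubspace_def)

lemma finite_sums_iff:
  "v \<in> finite_sums \<longleftrightarrow> (\<exists>F g. finite F \<and> F \<subseteq> \<Omega> \<and> (\<forall>\<eta>. g \<eta> \<in> cyclic \<eta>) \<and> v = (\<Sum>\<eta>\<in>F. g \<eta>))"
  by (simp only: finite_sums_def mem_Collect_eq)

lemma finite_sumsI:
  "finite F \<Longrightarrow> F \<subseteq> \<Omega> \<Longrightarrow> (\<And>\<eta>. g \<eta> \<in> cyclic \<eta>) \<Longrightarrow> (\<Sum>\<eta>\<in>F. g \<eta>) \<in> finite_sums"
  unfolding finite_sums_iff by (rule exI[of _ F], rule exI[of _ g]) simp

text \<open>Vectors with different index sets are padded by zeros over the union, so that the
  entries of a column can be split simultaneously.\<close>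

lemma finite_sums_common:
  assumes "finite J" "\<And>j. j \<in> J \<Longrightarrow> v j \<in> finite_sums"
  shows "\<exists>F g. finite F \<and> F \<subseteq> \<Omega> \<and> (\<forall>j\<in>J. \<forall>\<eta>. g j \<eta> \<in> cyclic \<eta>) \<and> (\<forall>j\<in>J. v j = (\<Sum>\<eta>\<in>F. g j \<eta>))"
proof -
  have "\<forall>j. \<exists>F g. j \<in> J \<longrightarrow> finite F \<and> F \<subseteq> \<Omega> \<and> (\<forall>\<eta>. g \<eta> \<in> cyclic \<eta>) \<and> v j = (\<Sum>\<eta>\<in>F. g \<eta>)"
    using assms(2) unfolding finite_sums_iff by simp
  then obtain F g where Fg: "\<And>j. j \<in> J \<Longrightarrow> finite (F j) \<and> F j \<subseteq> \<Omega> \<and> (\<forall>\<eta>. g j \<eta> \<in> cyclic \<eta>) \<and> v j = (\<Sum>\<eta>\<in>F j. g j \<eta>)"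
    by metis
  define G where "G j \<eta> = (if \<eta> \<in> F j then g j \<eta> else 0)" for j \<eta>
  have "v j = (\<Sum>\<eta>\<in>(\<Union>j\<in>J. F j). G j \<eta>)" if "j \<in> J" for j
  proof -
    have "(\<Sum>\<eta>\<in>F j. g j \<eta>) = (\<Sum>\<eta>\<in>(\<Union>j\<in>J. F j). G j \<eta>)"
      using that assms(1) Fg by (intro sum.mono_neutral_cong_left) (auto simp: G_def)
    then show ?thesis using Fg[OF that] by simp
  qed
  then show ?thesis
    using assms(1) Fg zero_cyclic
    by (intro exI[of _ "\<Union>j\<in>J. F j"] exI[of _ G]) (auto simp: G_def)
qed

lemma csubspace_finite_sums: "csubspace finite_sums"
  unfolding csubspace_def
proof (intro conjI ballI allI)
  show "0 \<in> finite_sums" unfolding finite_sums_def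
    using zero_cyclic by (auto intro!: exI[of _ "{}"] exI[of _ "\<lambda>_. 0"])
  show "x + y \<in> finite_sums" if xy: "x \<in> finite_sums" "y \<in> finite_sums" for x y
  proof -
    \<comment> \<open>The pair is indexed by booleans.\<close>
    have "\<exists>F g. finite F \<and> F \<subseteq> \<Omega> \<and> (\<forall>j\<in>UNIV. \<forall>\<eta>. g j \<eta> \<in> cyclic \<eta>) \<and>
        (\<forall>j\<in>UNIV. (if j then x else y) = (\<Sum>\<eta>\<in>F. g j \<eta>))"
      using xy by (intro finite_sums_common) auto
    then obtain F g where F: "finite F" "F \<subseteq> \<Omega>" and g: "\<And>j \<eta>. g j \<eta> \<in> cyclic \<eta>"
      "\<And>j. (if j then x else y) = (\<Sum>\<eta>\<in>F. g j \<eta>)"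
      by blast
    have "x + y = (\<Sum>\<eta>\<in>F. g True \<eta> + g False \<eta>)" using g(2)[of True] g(2)[of False] by (simp add: sum.distrib)
    moreover have "g True \<eta> + g False \<eta> \<in> cyclic \<eta>" for \<eta>
      using g(1) csubspace_cyclic[of \<eta>] by (simp add: csubspace_def)
    ultimately show ?thesis using F by (simp add: finite_sumsI)
  qed
  show "scaleC c x \<in> finite_sums" if x: "x \<in> finite_sums" for c x
  proof -
    obtain F g where F: "finite F" "F \<subseteq> \<Omega>" and g: "\<And>\<eta>. g \<eta> \<in> cyclic \<eta>" "x = (\<Sum>\<eta>\<in>F. g \<eta>)"
      using x unfolding finite_sums_iff by metis
    have "scaleC c x = (\<Sum>\<eta>\<in>F. scaleC c (g \<eta>))" by (simp add: g(2) scaleC_sum_right)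
    moreover have "scaleC c (g \<eta>) \<in> cyclic \<eta>" for \<eta>
      using g(1) csubspace_cyclic[of \<eta>] by (simp add: csubspace_def)
    ultimately show ?thesis using F by (simp add: finite_sumsI)
  qed
qed

text \<open>Elements of \<open>A\<close> leave every cyclic subspace invariant, so both sides split
  by Pythagoras into contributions of the single subspaces.\<close>

lemma matrix_bound_finite_sums:
  fixes n :: nat
  assumes M: "\<And>i j. i < n \<Longrightarrow> j < n \<Longrightarrow> M i j \<in> A"
    and C: "\<And>\<eta> w. \<eta> \<in> I \<Longrightarrow> (\<And>j. j < n \<Longrightarrow> w j \<in> cyclic \<eta>) \<Longrightarrow>
      (\<Sum>i<n. (norm (\<Sum>j<n. blinfun_apply (M i j) (w j)))\<^sup>2) \<le> C\<^sup>2 * (\<Sum>j<n. (norm (w j))\<^sup>2)"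
    and v: "\<And>j. j < n \<Longrightarrow> v j \<in> finite_sums"
  shows "(\<Sum>i<n. (norm (\<Sum>j<n. blinfun_apply (M i j) (v j)))\<^sup>2) \<le> C\<^sup>2 * (\<Sum>j<n. (norm (v j))\<^sup>2)"
proof -
  have "\<exists>F g. finite F \<and> F \<subseteq> \<Omega> \<and> (\<forall>j\<in>{..<n}. \<forall>\<eta>. g j \<eta> \<in> cyclic \<eta>) \<and> (\<forall>j\<in>{..<n}. v j = (\<Sum>\<eta>\<in>F. g j \<eta>))"
    using v by (intro finite_sums_common) auto
  then obtain F g where F: "finite F" "F \<subseteq> \<Omega>" and g: "\<And>j \<eta>. j < n \<Longrightarrow> g j \<eta> \<in> cyclic \<eta>"
    "\<And>j. j < n \<Longrightarrow> v j = (\<Sum>\<eta>\<in>F. g j \<eta>)"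
    by (metis lessThan_iff)
  have pyth: "(norm (\<Sum>\<eta>\<in>F. h \<eta>))\<^sup>2 = (\<Sum>\<eta>\<in>F. (norm (h \<eta>))\<^sup>2)" if "\<And>\<eta>. h \<eta> \<in> cyclic \<eta>" for h
  proof (rule norm_sum_orthogonal[OF F(1)])
    fix \<eta> \<omega> assume "\<eta> \<in> F" "\<omega> \<in> F" "\<eta> \<noteq> \<omega>"
    then have "cinner (h \<eta>) (h \<omega>) = 0" using \<Omega>_orth F(2) that by blast
    then show "inner (h \<eta>) (h \<omega>) = 0" by (simp add: inner_eq_Re_cinner)
  qed
  have row: "(norm (\<Sum>j<n. M i j (v j)))\<^sup>2 = (\<Sum>\<eta>\<in>F. (norm (\<Sum>j<n. M i j (g j \<eta>)))\<^sup>2)" if i: "i < n" for i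
  proof -
    have "(\<Sum>j<n. M i j (v j)) = (\<Sum>j<n. \<Sum>\<eta>\<in>F. M i j (g j \<eta>))"
      by (intro sum.cong refl) (simp add: g(2) blinfun.sum_right)
    also have "\<dots> = (\<Sum>\<eta>\<in>F. \<Sum>j<n. M i j (g j \<eta>))" by (rule sum.swap)
    finally have "(\<Sum>j<n. M i j (v j)) = (\<Sum>\<eta>\<in>F. \<Sum>j<n. M i j (g j \<eta>))" .
    moreover have "(\<Sum>j<n. M i j (g j \<eta>)) \<in> cyclic \<eta>" for \<eta>
      by (rule csubspace_sum[OF csubspace_cyclic]) (simp add: cyclic_invariant M i g)
    ultimately show ?thesis by (simp add: pyth)
  qed
  have "(\<Sum>i<n. (norm (\<Sum>j<n. M i j (v j)))\<^sup>2) = (\<Sum>i<n. \<Sum>\<eta>\<in>F. (norm (\<Sum>j<n. M i j (g j \<eta>)))\<^sup>2)"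
    by (intro sum.cong refl) (simp add: row)
  also have "\<dots> = (\<Sum>\<eta>\<in>F. \<Sum>i<n. (norm (\<Sum>j<n. M i j (g j \<eta>)))\<^sup>2)" by (rule sum.swap)
  also have "\<dots> \<le> (\<Sum>\<eta>\<in>F. C\<^sup>2 * (\<Sum>j<n. (norm (g j \<eta>))\<^sup>2))"
  proof (intro sum_mono)
    fix \<eta> assume "\<eta> \<in> F"
    then have "\<eta> \<in> \<Omega>" using F(2) by blast
    then show "(\<Sum>i<n. (norm (\<Sum>j<n. M i j (g j \<eta>)))\<^sup>2) \<le> C\<^sup>2 * (\<Sum>j<n. (norm (g j \<eta>))\<^sup>2)"
      by (rule matrix_bound_transfer[rotated 2]) (rule g(1), simp, rule M, simp, simp, rule C, assumption, simp)
  qed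
  also have "\<dots> = C\<^sup>2 * (\<Sum>j<n. \<Sum>\<eta>\<in>F. (norm (g j \<eta>))\<^sup>2)"
    by (subst sum.swap) (simp add: sum_distrib_left)
  also have "(\<Sum>j<n. \<Sum>\<eta>\<in>F. (norm (g j \<eta>))\<^sup>2) = (\<Sum>j<n. (norm (v j))\<^sup>2)"
  proof (intro sum.cong refl)
    fix j assume "j \<in> {..<n}"
    then show "(\<Sum>\<eta>\<in>F. (norm (g j \<eta>))\<^sup>2) = (norm (v j))\<^sup>2" using pyth[of "g j"] g by simp
  qed
  finally show ?thesis .
qed

text \<open>The part of each \<open>v j\<close> orthogonal to the closed span of the cyclic
  subspaces is killed by \<open>A\<close> and only enlarges the right-hand side; on the closed span
  the bound follows by density.\<close>

lemma matrix_bound: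
  fixes n :: nat
  assumes M: "\<And>i j. i < n \<Longrightarrow> j < n \<Longrightarrow> M i j \<in> A"
    and C: "\<And>\<eta> w. \<eta> \<in> I \<Longrightarrow> (\<And>j. j < n \<Longrightarrow> w j \<in> cyclic \<eta>) \<Longrightarrow>
      (\<Sum>i<n. (norm (\<Sum>j<n. blinfun_apply (M i j) (w j)))\<^sup>2) \<le> C\<^sup>2 * (\<Sum>j<n. (norm (w j))\<^sup>2)"
  shows "(\<Sum>i<n. (norm (\<Sum>j<n. blinfun_apply (M i j) (v j)))\<^sup>2) \<le> C\<^sup>2 * (\<Sum>j<n. (norm (v j))\<^sup>2)"
proof -
  let ?W = "closure finite_sums"
  have cyc: "cyclic \<omega> \<subseteq> ?W" if "\<omega> \<in> \<Omega>" for \<omega>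
  proof -
    have "v \<in> finite_sums" if "v \<in> cyclic \<omega>" for v
      unfolding finite_sums_def using that \<open>\<omega> \<in> \<Omega>\<close> zero_cyclic
      by (auto intro!: exI[of _ "{\<omega>}"] exI[of _ "\<lambda>\<eta>. if \<eta> = \<omega> then v else 0"])
    then show ?thesis using closure_subset by blast
  qed
  have "\<forall>j. \<exists>y. y \<in> ?W \<and> (\<forall>z\<in>?W. cinner (v j - y) z = 0)"
    using orthogonal_decomposition[OF csubspace_closure[OF csubspace_finite_sums] closed_closure] by metis
  then obtain y where y: "\<And>j. y j \<in> ?W" "\<And>j z. z \<in> ?W \<Longrightarrow> cinner (v j - y j) z = 0" by metis
  have kill: "a (v j) = a (y j)" if a: "a \<in> A" for a j
  proof -
    have "a (v j - y j) = 0"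
      by (rule \<Omega>_total[OF _ a]) (metis y(2) cyc subsetD cinner_commute complex_cnj_zero)
    then show ?thesis by (simp add: blinfun.diff_right)
  qed
  have yv: "norm (y j) \<le> norm (v j)" for j
  proof -
    have "orthogonal (v j - y j) (y j)"
      using y(2)[OF y(1)] by (simp add: orthogonal_def inner_eq_Re_cinner)
    from norm_add_Pythagorean[OF this] have "(norm (v j))\<^sup>2 = (norm (v j - y j))\<^sup>2 + (norm (y j))\<^sup>2" by simp
    then have "(norm (y j))\<^sup>2 \<le> (norm (v j))\<^sup>2" by simp
    then show ?thesis by (rule power2_le_imp_le) simp
  qed
  have "\<forall>j. \<exists>f. (\<forall>k. f k \<in> finite_sums) \<and> f \<longlonglongrightarrow> y j" using y(1) unfolding closure_sequential by blast
  then obtain f where f: "\<And>j k. f j k \<in> finite_sums" "\<And>j. f j \<longlonglongrightarrow> y j" by metis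
  have "(\<Sum>i<n. (norm (\<Sum>j<n. M i j (y j)))\<^sup>2) \<le> C\<^sup>2 * (\<Sum>j<n. (norm (y j))\<^sup>2)"
  proof (rule LIMSEQ_le)
    show "(\<lambda>k. \<Sum>i<n. (norm (\<Sum>j<n. M i j (f j k)))\<^sup>2) \<longlonglongrightarrow> (\<Sum>i<n. (norm (\<Sum>j<n. M i j (y j)))\<^sup>2)"
      by (intro tendsto_intros blinfun.tendsto f)
    show "(\<lambda>k. C\<^sup>2 * (\<Sum>j<n. (norm (f j k))\<^sup>2)) \<longlonglongrightarrow> C\<^sup>2 * (\<Sum>j<n. (norm (y j))\<^sup>2)"
      by (intro tendsto_intros f)
    show "\<exists>N. \<forall>k\<ge>N. (\<Sum>i<n. (norm (\<Sum>j<n. M i j (f j k)))\<^sup>2) \<le> C\<^sup>2 * (\<Sum>j<n. (norm (f j k))\<^sup>2)"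
    proof (intro exI allI impI)
      fix k :: nat
      show "(\<Sum>i<n. (norm (\<Sum>j<n. M i j (f j k)))\<^sup>2) \<le> C\<^sup>2 * (\<Sum>j<n. (norm (f j k))\<^sup>2)"
        by (rule matrix_bound_finite_sums) (rule M, simp, simp, rule C, assumption, simp, rule f(1))
    qed
  qed
  also have "\<dots> \<le> C\<^sup>2 * (\<Sum>j<n. (norm (v j))\<^sup>2)"
    by (intro mult_left_mono sum_mono power_mono yv) auto
  also have "(\<Sum>i<n. (norm (\<Sum>j<n. M i j (y j)))\<^sup>2) = (\<Sum>i<n. (norm (\<Sum>j<n. M i j (v j)))\<^sup>2)"
    by (intro sum.cong refl) (simp add: kill M)
  finally show ?thesis .
qed

end

section \<open>Orthogonal projections and compact operators\<close>

definition orth_proj :: "'h::complex_hilbert_space set \<Rightarrow> 'h \<Rightarrow>\<^sub>L 'h" where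
  "orth_proj S = (SOME E. E \<in> B_ops \<and> (\<forall>x. blinfun_apply E x \<in> S \<and> (\<forall>z\<in>S. cinner (x - blinfun_apply E x) z = 0)))"

lemma orth_proj:
  assumes S: "csubspace S" "closed S"
  shows "orth_proj S \<in> B_ops" "orth_proj S x \<in> S" "z \<in> S \<Longrightarrow> cinner (x - orth_proj S x) z = 0"
proof -
  have "\<forall>x. \<exists>y. y \<in> S \<and> (\<forall>z\<in>S. cinner (x - y) z = 0)" using orthogonal_decomposition[OF S] by metis
  then obtain f where f: "\<And>x. f x \<in> S" "\<And>x z. z \<in> S \<Longrightarrow> cinner (x - f x) z = 0" by metis
  have unique: "f x = y" if y: "y \<in> S" "\<And>z. z \<in> S \<Longrightarrow> cinner (x - y) z = 0" for x y
  proof -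
    have "f x - y \<in> S" using csubspace_diff[OF S(1) f(1) y(1)] .
    then have "cinner ((x - y) - (x - f x)) (f x - y) = 0"
      using y(2) f(2) by (simp only: cinner_diff_left[of "x - y"]) simp
    then show ?thesis by (simp add: cinner_same)
  qed
  have add: "f (x + y) = f x + f y" for x y
  proof (rule unique)
    show "f x + f y \<in> S" using S(1) f(1) by (simp add: csubspace_def)
    show "cinner (x + y - (f x + f y)) z = 0" if "z \<in> S" for z
      using f(2)[OF that, of x] f(2)[OF that, of y] by (simp add: cinner_diff_left cinner_add_left)
  qed
  have scale: "f (scaleC c x) = scaleC c (f x)" for c x
  proof (rule unique)
    show "scaleC c (f x) \<in> S" using S(1) f(1) by (simp add: csubspace_def)
    show "cinner (scaleC c x - scaleC c (f x)) z = 0" if "z \<in> S" for z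
      using f(2)[OF that, of x] by (simp add: scaleC_diff_right[symmetric] cinner_scaleC_left)
  qed
  have "norm (f x) \<le> norm x" for x
  proof -
    have "orthogonal (x - f x) (f x)" using f(2)[OF f(1)] by (simp add: orthogonal_def inner_eq_Re_cinner)
    from norm_add_Pythagorean[OF this] have "(norm (f x))\<^sup>2 \<le> (norm x)\<^sup>2" by simp
    then show ?thesis by (rule power2_le_imp_le) simp
  qed
  then have bl: "bounded_linear f"
    using scale[of "complex_of_real r" for r] add
    by (intro bounded_linear_intro[where K = 1]) (simp_all add: scaleC_of_real)
  have "\<exists>E. E \<in> B_ops \<and> (\<forall>x. blinfun_apply E x \<in> S \<and> (\<forall>z\<in>S. cinner (x - blinfun_apply E x) z = 0))"
    by (rule exI[of _ "Blinfun f"]) (simp add: bounded_linear_Blinfun_apply[OF bl] B_ops_def scale f)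
  from someI_ex[OF this] show "orth_proj S \<in> B_ops" "orth_proj S x \<in> S" "z \<in> S \<Longrightarrow> cinner (x - orth_proj S x) z = 0"
    by (auto simp: orth_proj_def)
qed

lemma orth_proj_props:
  assumes S: "csubspace S" "closed S"
  shows "z \<in> S \<Longrightarrow> cinner (orth_proj S x) z = cinner x z"
    and "x \<in> S \<Longrightarrow> orth_proj S x = x"
    and "(\<And>z. z \<in> S \<Longrightarrow> cinner x z = 0) \<Longrightarrow> orth_proj S x = 0"
    and "norm (orth_proj S x) \<le> norm x" and "norm (orth_proj S) \<le> 1"
    and "cinner (orth_proj S x) y = cinner x (orth_proj S y)"
proof -
  note E = orth_proj[OF S]
  show 1: "cinner (orth_proj S x) z = cinner x z" if "z \<in> S" for x z
    using E(3)[OF that, of x] by (simp add: cinner_diff_left)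
  show "orth_proj S x = x" if "x \<in> S"
  proof -
    have "x - orth_proj S x \<in> S" using csubspace_diff[OF S(1) that E(2)] .
    from E(3)[OF this, of x] have "cinner (x - orth_proj S x) (x - orth_proj S x) = 0" .
    then show ?thesis by (simp add: cinner_same)
  qed
  show "orth_proj S x = 0" if "\<And>z. z \<in> S \<Longrightarrow> cinner x z = 0"
    using 1[OF E(2), of x x] that[OF E(2)] by (simp add: cinner_same)
  show n: "norm (orth_proj S x) \<le> norm x" for x
  proof -
    have "(norm (orth_proj S x))\<^sup>2 = cmod (cinner x (orth_proj S x))"
      using 1[OF E(2), of x x] by (metis cinner_same norm_of_real abs_of_nonneg zero_le_power2)
    also have "\<dots> \<le> norm x * norm (orth_proj S x)" by (rule norm_cinner_le)
    finally show ?thesis by (cases "orth_proj S x = 0") (simp_all add: power2_eq_square)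
  qed
  show "norm (orth_proj S) \<le> 1" by (rule norm_blinfun_bound) (simp_all add: n)
  show "cinner (orth_proj S x) y = cinner x (orth_proj S y)"
    using 1[OF E(2), of y x] 1[OF E(2), of x y] by (metis cinner_commute)
qed

definition compact_op :: "('h::complex_hilbert_space \<Rightarrow>\<^sub>L 'h) \<Rightarrow> bool" where
  "compact_op T \<longleftrightarrow> compact (closure (blinfun_apply T ` cball 0 1))"

lemma apply_in_closure_ball: "norm x \<le> 1 \<Longrightarrow> blinfun_apply T x \<in> closure (blinfun_apply T ` cball 0 1)"
  by (rule closure_subset[THEN subsetD]) simp

lemma compact_opI:
  assumes "blinfun_apply T ` cball 0 1 \<subseteq> K" "compact K"
  shows "compact_op T"
proof -
  have "closure (blinfun_apply T ` cball 0 1) \<subseteq> K"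
    using assms by (simp add: closure_minimal compact_imp_closed)
  then have "closure (blinfun_apply T ` cball 0 1) = K \<inter> closure (blinfun_apply T ` cball 0 1)" by blast
  then show ?thesis unfolding compact_op_def using compact_Int_closed[OF assms(2) closed_closure] by metis
qed

lemma compact_op_subspace: "op_subspace {T. compact_op T}"
  unfolding op_subspace_def
proof (intro conjI ballI allI)
  show "0 \<in> {T. compact_op T}" by (auto intro!: compact_opI[of _ "{0}"])
  show "S + T \<in> {T. compact_op T}" if "S \<in> {T. compact_op T}" "T \<in> {T. compact_op T}"
    for S T :: "'h::complex_hilbert_space \<Rightarrow>\<^sub>L 'h"
  proof -
    let ?K = "\<lambda>T :: 'h \<Rightarrow>\<^sub>L 'h. closure (blinfun_apply T ` cball 0 1)"
    have "compact {x + y |x y. x \<in> ?K S \<and> y \<in> ?K T}"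
      using that by (intro compact_sums) (simp_all add: compact_op_def)
    moreover have "blinfun_apply (S + T) ` cball 0 1 \<subseteq> {x + y |x y. x \<in> ?K S \<and> y \<in> ?K T}"
      using apply_in_closure_ball by (auto simp: blinfun.add_left) blast
    ultimately have "compact_op (S + T)" by (rule compact_opI[rotated])
    then show ?thesis by simp
  qed
  show "op_scale c T \<in> {T. compact_op T}" if "T \<in> {T. compact_op T}" for c and T :: "'h::complex_hilbert_space \<Rightarrow>\<^sub>L 'h"
  proof -
    have "compact (scaleC c ` closure (blinfun_apply T ` cball 0 1))"
      using that by (intro compact_continuous_image linear_continuous_on bounded_linear_scaleC)
        (simp add: compact_op_def)
    moreover have "blinfun_apply (op_scale c T) ` cball 0 1 \<subseteq> scaleC c ` closure (blinfun_apply T ` cball 0 1)"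
      by (auto simp: op_scale_apply intro!: imageI apply_in_closure_ball)
    ultimately have "compact_op (op_scale c T)" by (rule compact_opI[rotated])
    then show ?thesis by simp
  qed
qed

lemma compact_op_limit:
  assumes "\<And>\<epsilon>. \<epsilon> > 0 \<Longrightarrow> \<exists>S. compact_op S \<and> norm (T - S) < \<epsilon>"
  shows "compact_op T"
  unfolding compact_op_def compact_eq_totally_bounded
proof (intro conjI allI impI)
  show "complete (closure (blinfun_apply T ` cball 0 1))" by (simp add: complete_eq_closed)
  fix \<epsilon> :: real assume e: "\<epsilon> > 0"
  obtain S where S: "compact_op S" "norm (T - S) < \<epsilon> / 3" using assms[of "\<epsilon> / 3"] e by auto
  obtain k where k: "finite k" "closure (blinfun_apply S ` cball 0 1) \<subseteq> (\<Union>x\<in>k. ball x (\<epsilon> / 3))"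
    using S(1) e unfolding compact_op_def compact_eq_totally_bounded by (meson divide_pos_pos zero_less_numeral)
  \<comment> \<open>Closed balls are used because a finite union of them also covers the closure;
    the slack up to \<epsilon> restores open balls.\<close>
  have "blinfun_apply T ` cball 0 1 \<subseteq> (\<Union>x\<in>k. cball x (2 * \<epsilon> / 3))"
  proof
    fix y assume "y \<in> blinfun_apply T ` cball 0 1"
    then obtain x where x: "y = T x" "norm x \<le> 1" by auto
    have "S x \<in> closure (blinfun_apply S ` cball 0 1)" using x(2) by (rule apply_in_closure_ball)
    then obtain c where c: "c \<in> k" "dist c (S x) < \<epsilon> / 3" using k(2) by auto
    have "norm ((T - S) x) \<le> norm (T - S) * 1"
      using order_trans[OF norm_blinfun mult_left_mono[OF x(2) norm_ge_zero]] .
    then have "dist (S x) y \<le> \<epsilon> / 3" using S(2) by (simp add: x(1) dist_norm norm_minus_commute blinfun.diff_left)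
    then have "dist c y \<le> 2 * \<epsilon> / 3" using c(2) dist_triangle[of c y "S x"] by simp
    then show "y \<in> (\<Union>x\<in>k. cball x (2 * \<epsilon> / 3))" using c(1) by auto
  qed
  moreover have "closed (\<Union>x\<in>k. cball x (2 * \<epsilon> / 3))" using k(1) by (intro closed_UN) auto
  ultimately have "closure (blinfun_apply T ` cball 0 1) \<subseteq> (\<Union>x\<in>k. cball x (2 * \<epsilon> / 3))"
    by (rule closure_minimal)
  also have "\<dots> \<subseteq> (\<Union>x\<in>k. ball x \<epsilon>)" using e by (intro UN_mono) auto
  finally show "\<exists>k. finite k \<and> closure (blinfun_apply T ` cball 0 1) \<subseteq> (\<Union>x\<in>k. ball x \<epsilon>)" using k(1) by blast
qed

section \<open>The isomorphism with a sum of algebras of compact operators\<close>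

context cyclic_decomposition
begin

abbreviation Pr :: "'h \<Rightarrow> 'h \<Rightarrow>\<^sub>L 'h" where
  "Pr \<eta> \<equiv> orth_proj (cyclic \<eta>)"

lemmas Pr = orth_proj[OF csubspace_cyclic closed_cyclic[OF I_D]]
  and Pr_props = orth_proj_props[OF csubspace_cyclic closed_cyclic[OF I_D]]

lemma norm_compose_Pr: "\<eta> \<in> I \<Longrightarrow> norm (a o\<^sub>L Pr \<eta>) \<le> norm a"
  using order_trans[OF norm_blinfun_compose mult_left_mono[OF Pr_props(5) norm_ge_zero], of \<eta> a] by simp

lemma norm_le_if_components:
  assumes a: "a \<in> A" and C: "C \<ge> 0" "\<And>\<eta>. \<eta> \<in> I \<Longrightarrow> norm (a o\<^sub>L Pr \<eta>) \<le> C"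
  shows "norm a \<le> C"
proof (rule norm_blinfun_bound[OF C(1)])
  fix v
  \<comment> \<open>The one by one case of \<open>matrix_bound\<close>.\<close>
  have "(\<Sum>i<1::nat. (norm (\<Sum>j<1::nat. blinfun_apply a v))\<^sup>2) \<le> C\<^sup>2 * (\<Sum>j<1::nat. (norm v)\<^sup>2)"
  proof (rule matrix_bound)
    fix \<eta> and w :: "nat \<Rightarrow> 'h" assume \<eta>: "\<eta> \<in> I" and w: "\<And>j. j < 1 \<Longrightarrow> w j \<in> cyclic \<eta>"
    have "norm (a (w 0)) = norm ((a o\<^sub>L Pr \<eta>) (w 0))" using Pr_props(2)[OF \<eta> w] by simp
    also have "\<dots> \<le> C * norm (w 0)"
      by (rule order_trans[OF norm_blinfun mult_right_mono[OF C(2)[OF \<eta>] norm_ge_zero]])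
    finally have "(norm (a (w 0)))\<^sup>2 \<le> (C * norm (w 0))\<^sup>2" by (rule power_mono) simp
    then show "(\<Sum>i<1::nat. (norm (\<Sum>j<1. blinfun_apply a (w j)))\<^sup>2) \<le> C\<^sup>2 * (\<Sum>j<1. (norm (w j))\<^sup>2)"
      by (simp add: power_mult_distrib)
  qed (rule a)
  then have "(norm (a v))\<^sup>2 \<le> (C * norm v)\<^sup>2" by (simp add: power_mult_distrib)
  then show "norm (a v) \<le> C * norm v" by (rule power2_le_imp_le) (simp add: C(1))
qed

text \<open>\<open>matrix_bound\<close> gives the nontrivial inequality. The inserted 0 covers an
  empty \<open>I\<close> and is otherwise harmless, matrix norms being nonnegative.\<close>

lemma op_mat_norm_components:
  assumes M: "\<And>i j. i < n \<Longrightarrow> j < n \<Longrightarrow> M i j \<in> A"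
  shows "Sup (insert 0 ((\<lambda>\<eta>. op_mat_norm n (\<lambda>i j. M i j o\<^sub>L Pr \<eta>)) ` I)) = op_mat_norm n M"
proof -
  let ?X = "insert 0 ((\<lambda>\<eta>. op_mat_norm n (\<lambda>i j. M i j o\<^sub>L Pr \<eta>)) ` I)"
  have le: "op_mat_norm n (\<lambda>i j. M i j o\<^sub>L Pr \<eta>) \<le> op_mat_norm n M" if \<eta>: "\<eta> \<in> I" for \<eta>
  proof (rule op_mat_norm_least[OF op_mat_norm_nonneg])
    fix v :: "nat \<Rightarrow> 'h"
    have "(\<Sum>i<n. (norm (\<Sum>j<n. M i j (Pr \<eta> (v j))))\<^sup>2) \<le> (op_mat_norm n M)\<^sup>2 * (\<Sum>j<n. (norm (Pr \<eta> (v j)))\<^sup>2)"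
      by (rule op_mat_norm_sum_le)
    also have "\<dots> \<le> (op_mat_norm n M)\<^sup>2 * (\<Sum>j<n. (norm (v j))\<^sup>2)"
      by (intro mult_left_mono sum_mono power_mono Pr_props(4)[OF \<eta>]) auto
    finally show "(\<Sum>i<n. (norm (\<Sum>j<n. blinfun_apply (M i j o\<^sub>L Pr \<eta>) (v j)))\<^sup>2) \<le> (op_mat_norm n M)\<^sup>2 * (\<Sum>j<n. (norm (v j))\<^sup>2)"
      by simp
  qed
  have bdd: "bdd_above ?X" using le by (auto simp: bdd_above_def intro!: exI[of _ "op_mat_norm n M"] op_mat_norm_nonneg)
  have S0: "0 \<le> Sup ?X" using bdd by (intro cSup_upper) auto
  show ?thesis
  proof (rule antisym)
    show "Sup ?X \<le> op_mat_norm n M" by (rule cSup_least) (auto intro: le op_mat_norm_nonneg)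
    show "op_mat_norm n M \<le> Sup ?X"
    proof (rule op_mat_norm_least[OF S0], rule matrix_bound[OF M])
      fix \<eta> and w :: "nat \<Rightarrow> 'h" assume \<eta>: "\<eta> \<in> I" and w: "\<And>j. j < n \<Longrightarrow> w j \<in> cyclic \<eta>"
      have "(\<Sum>i<n. (norm (\<Sum>j<n. M i j (w j)))\<^sup>2) = (\<Sum>i<n. (norm (\<Sum>j<n. (M i j o\<^sub>L Pr \<eta>) (w j)))\<^sup>2)"
        using Pr_props(2)[OF \<eta> w] by simp
      also have "\<dots> \<le> (op_mat_norm n (\<lambda>i j. M i j o\<^sub>L Pr \<eta>))\<^sup>2 * (\<Sum>j<n. (norm (w j))\<^sup>2)"
        by (rule op_mat_norm_sum_le)
      also have "\<dots> \<le> (Sup ?X)\<^sup>2 * (\<Sum>j<n. (norm (w j))\<^sup>2)"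
        using \<eta> by (intro mult_right_mono power_mono cSup_upper bdd op_mat_norm_nonneg sum_nonneg) auto
      finally show "(\<Sum>i<n. (norm (\<Sum>j<n. M i j (w j)))\<^sup>2) \<le> (Sup ?X)\<^sup>2 * (\<Sum>j<n. (norm (w j))\<^sup>2)" .
    qed
  qed
qed

text \<open>\<open>A_induct\<close> reduces to \<open>b Q\<close>, which by
  \<open>linked_vector\<close> and \<open>not_linked_zero\<close> has rank at most one on a cyclic
  subspace.\<close>

lemma component_compact:
  assumes \<eta>: "\<eta> \<in> I" and a: "a \<in> A"
  shows "compact_op (a o\<^sub>L Pr \<eta>)"
proof -
  have "A \<subseteq> {a. compact_op (a o\<^sub>L Pr \<eta>)}"
  proof (rule A_induct)
    have sub: "op_subspace {T :: 'h \<Rightarrow>\<^sub>L 'h. compact_op T}" by (rule compact_op_subspace)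
    show "op_subspace {a. compact_op (a o\<^sub>L Pr \<eta>)}"
      using op_subspaceD(1-3)[OF sub]
      by (auto simp: op_subspace_def blinfun_compose_simps op_scale_compose_left)
    show "closed {a. compact_op (a o\<^sub>L Pr \<eta>)}"
      unfolding closed_sequential_limits
    proof (intro allI impI, elim conjE)
      fix f l assume f: "\<forall>n. f n \<in> {a. compact_op (a o\<^sub>L Pr \<eta>)}" "f \<longlonglongrightarrow> l"
      have "compact_op (l o\<^sub>L Pr \<eta>)"
      proof (rule compact_op_limit)
        fix \<epsilon> :: real assume "\<epsilon> > 0"
        then obtain n where "dist (f n) l < \<epsilon>" using metric_LIMSEQ_D[OF f(2)] by blast
        moreover have "norm ((l o\<^sub>L Pr \<eta>) - (f n o\<^sub>L Pr \<eta>)) \<le> norm (l - f n)"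
          using norm_compose_Pr[OF \<eta>, of "l - f n"] by (simp add: blinfun_compose_simps)
        ultimately show "\<exists>S. compact_op S \<and> norm ((l o\<^sub>L Pr \<eta>) - S) < \<epsilon>"
          using f(1) by (intro exI[of _ "f n o\<^sub>L Pr \<eta>"]) (auto simp: dist_norm norm_minus_commute)
      qed
      then show "l \<in> {a. compact_op (a o\<^sub>L Pr \<eta>)}" by simp
    qed
    fix b Q assume b: "b \<in> A" and Q: "Q \<in> minimal_projections"
    have "compact_op ((b o\<^sub>L Q) o\<^sub>L Pr \<eta>)"
    proof (cases "linked Q (support \<eta>)")
      case True
      obtain \<xi> where \<xi>: "norm \<xi> = 1" "\<And>v. v \<in> cyclic \<eta> \<Longrightarrow> Q v = scaleC (cinner v \<xi>) \<xi>"
        using linked_vector[OF Q I_D[OF \<eta>] True] by metis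
      have "bounded_linear (\<lambda>c. scaleC c (b \<xi>))"
        by (rule bounded_linear_intro[where K = "norm (b \<xi>)"])
          (simp_all add: scaleC_add_left norm_scaleC scaleR_conv_of_real scaleC_scaleC[symmetric] scaleC_of_real)
      then have "compact ((\<lambda>c. scaleC c (b \<xi>)) ` cball 0 1)"
        by (intro compact_continuous_image linear_continuous_on) auto
      moreover have "blinfun_apply ((b o\<^sub>L Q) o\<^sub>L Pr \<eta>) ` cball 0 1 \<subseteq> (\<lambda>c. scaleC c (b \<xi>)) ` cball 0 1"
      proof
        fix y assume "y \<in> blinfun_apply ((b o\<^sub>L Q) o\<^sub>L Pr \<eta>) ` cball 0 1"
        then obtain x where x: "norm x \<le> 1" "y = b (Q (Pr \<eta> x))" by auto
        have "y = scaleC (cinner (Pr \<eta> x) \<xi>) (b \<xi>)"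
          using \<xi>(2)[OF Pr(2)[OF \<eta>]] by (simp add: x(2) B_opsD[OF A_B[OF b]])
        moreover have "cmod (cinner (Pr \<eta> x) \<xi>) \<le> 1"
          using norm_cinner_le[of "Pr \<eta> x" \<xi>] Pr_props(4)[OF \<eta>, of x] x(1) \<xi>(1) by simp
        ultimately show "y \<in> (\<lambda>c. scaleC c (b \<xi>)) ` cball 0 1" by auto
      qed
      ultimately show ?thesis by (intro compact_opI)
    next
      case False
      have "(b o\<^sub>L Q) o\<^sub>L Pr \<eta> = 0"
        by (rule blinfun_eqI) (simp add: not_linked_zero[OF I_D[OF \<eta>] False Pr(2)[OF \<eta>]])
      then show ?thesis using op_subspaceD(1)[OF sub] by simp
    qed
    then show "b o\<^sub>L Q \<in> {a. compact_op (a o\<^sub>L Pr \<eta>)}" by simp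
  qed
  then show ?thesis using a by blast
qed

lemma component_K_ops:
  assumes \<eta>: "\<eta> \<in> I" and a: "a \<in> A"
  shows "a o\<^sub>L Pr \<eta> \<in> K_ops (cyclic \<eta>)"
  unfolding K_ops_def
proof (intro CollectI conjI allI impI)
  show "a o\<^sub>L Pr \<eta> \<in> B_ops" by (intro B_ops_compose A_B a Pr(1) \<eta>)
  show "range (blinfun_apply (a o\<^sub>L Pr \<eta>)) \<subseteq> cyclic \<eta>"
    using cyclic_invariant[OF a Pr(2)[OF \<eta>]] by auto
  show "blinfun_apply (a o\<^sub>L Pr \<eta>) x = 0" if "\<forall>y\<in>cyclic \<eta>. cinner x y = 0" for x
    using Pr_props(3)[OF \<eta>, of x] that by simp
  show "compact (closure (blinfun_apply (a o\<^sub>L Pr \<eta>) ` cball 0 1))"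
    using component_compact[OF \<eta> a] by (simp add: compact_op_def)
qed

text \<open>A minimal projection is linked to at most one member of \<open>I\<close>, so
  \<open>b Q\<close> has at most one nonzero component; the condition passes to sums and norm
  limits.\<close>

lemma components_vanish:
  assumes a: "a \<in> A" and e: "\<epsilon> > 0"
  shows "finite {\<eta> \<in> I. norm (a o\<^sub>L Pr \<eta>) \<ge> \<epsilon>}"
proof -
  define C where "C = {a :: 'h \<Rightarrow>\<^sub>L 'h. \<forall>\<epsilon>>0. finite {\<eta> \<in> I. norm (a o\<^sub>L Pr \<eta>) \<ge> \<epsilon>}}"
  have C_D: "finite {\<eta> \<in> I. norm (a o\<^sub>L Pr \<eta>) \<ge> \<delta>}" if "a \<in> C" "\<delta> > 0" for a \<delta>
    using that unfolding C_def by blast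
  have "A \<subseteq> C"
  proof (rule A_induct)
    show "op_subspace C"
      unfolding op_subspace_def
    proof (intro conjI ballI allI)
      show "0 \<in> C" by (simp add: C_def)
      show "a + b \<in> C" if ab: "a \<in> C" "b \<in> C" for a b
        unfolding C_def
      proof (intro CollectI allI impI)
        fix \<epsilon> :: real assume e: "\<epsilon> > 0"
        have "norm (a o\<^sub>L Pr \<eta>) \<ge> \<epsilon> / 2 \<or> norm (b o\<^sub>L Pr \<eta>) \<ge> \<epsilon> / 2" if "norm ((a + b) o\<^sub>L Pr \<eta>) \<ge> \<epsilon>" for \<eta>
          using norm_triangle_ineq[of "a o\<^sub>L Pr \<eta>" "b o\<^sub>L Pr \<eta>"] that unfolding blinfun_compose_simps by linarith
        then have "{\<eta> \<in> I. norm ((a + b) o\<^sub>L Pr \<eta>) \<ge> \<epsilon>} \<subseteq> {\<eta> \<in> I. norm (a o\<^sub>L Pr \<eta>) \<ge> \<epsilon> / 2} \<union> {\<eta> \<in> I. norm (b o\<^sub>L Pr \<eta>) \<ge> \<epsilon> / 2}"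
          by blast
        moreover have "finite {\<eta> \<in> I. norm (a o\<^sub>L Pr \<eta>) \<ge> \<epsilon> / 2}" "finite {\<eta> \<in> I. norm (b o\<^sub>L Pr \<eta>) \<ge> \<epsilon> / 2}"
          by (rule C_D[OF ab(1)], use e in simp, rule C_D[OF ab(2)], use e in simp)
        ultimately show "finite {\<eta> \<in> I. norm ((a + b) o\<^sub>L Pr \<eta>) \<ge> \<epsilon>}" by (blast intro: finite_subset)
      qed
      show "op_scale c a \<in> C" if a: "a \<in> C" for c a
        unfolding C_def
      proof (intro CollectI allI impI)
        fix \<epsilon> :: real assume e: "\<epsilon> > 0"
        have "{\<eta> \<in> I. norm (op_scale c a o\<^sub>L Pr \<eta>) \<ge> \<epsilon>} \<subseteq> {\<eta> \<in> I. norm (a o\<^sub>L Pr \<eta>) \<ge> \<epsilon> / (cmod c + 1)}"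
        proof safe
          fix \<eta> assume "\<epsilon> \<le> norm (op_scale c a o\<^sub>L Pr \<eta>)"
          then have "\<epsilon> \<le> cmod c * norm (a o\<^sub>L Pr \<eta>)" by (simp add: op_scale_compose_left norm_op_scale)
          also have "\<dots> \<le> (cmod c + 1) * norm (a o\<^sub>L Pr \<eta>)" by (intro mult_right_mono) auto
          finally show "\<epsilon> / (cmod c + 1) \<le> norm (a o\<^sub>L Pr \<eta>)"
            by (simp add: pos_divide_le_eq add_nonneg_pos mult.commute)
        qed
        moreover have "finite {\<eta> \<in> I. norm (a o\<^sub>L Pr \<eta>) \<ge> \<epsilon> / (cmod c + 1)}"
          by (rule C_D[OF a]) (use e in \<open>simp add: add_nonneg_pos\<close>)
        ultimately show "finite {\<eta> \<in> I. norm (op_scale c a o\<^sub>L Pr \<eta>) \<ge> \<epsilon>}" by (rule finite_subset)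
      qed
    qed
    show "closed C"
      unfolding closed_sequential_limits
    proof (intro allI impI, elim conjE)
      fix f l assume f: "\<forall>n. f n \<in> C" "f \<longlonglongrightarrow> l"
      show "l \<in> C"
        unfolding C_def
      proof (intro CollectI allI impI)
        fix \<epsilon> :: real assume e: "\<epsilon> > 0"
        then obtain n where n: "dist (f n) l < \<epsilon> / 2" using metric_LIMSEQ_D[OF f(2), of "\<epsilon> / 2"] by auto
        have "{\<eta> \<in> I. norm (l o\<^sub>L Pr \<eta>) \<ge> \<epsilon>} \<subseteq> {\<eta> \<in> I. norm (f n o\<^sub>L Pr \<eta>) \<ge> \<epsilon> / 2}"
        proof safe
          fix \<eta> assume \<eta>: "\<eta> \<in> I" and "\<epsilon> \<le> norm (l o\<^sub>L Pr \<eta>)"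
          moreover have "norm ((l o\<^sub>L Pr \<eta>) - (f n o\<^sub>L Pr \<eta>)) \<le> norm (l - f n)"
            using norm_compose_Pr[OF \<eta>, of "l - f n"] by (simp add: blinfun_compose_simps)
          ultimately show "\<epsilon> / 2 \<le> norm (f n o\<^sub>L Pr \<eta>)"
            using n norm_triangle_sub[of "l o\<^sub>L Pr \<eta>" "f n o\<^sub>L Pr \<eta>"] by (simp add: dist_norm norm_minus_commute)
        qed
        moreover have "finite {\<eta> \<in> I. norm (f n o\<^sub>L Pr \<eta>) \<ge> \<epsilon> / 2}" by (rule C_D) (use f(1) e in auto)
        ultimately show "finite {\<eta> \<in> I. norm (l o\<^sub>L Pr \<eta>) \<ge> \<epsilon>}" by (rule finite_subset)
      qed
    qed
    fix b Q assume b: "b \<in> A" and Q: "Q \<in> minimal_projections"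
    have zero: "(b o\<^sub>L Q) o\<^sub>L Pr \<eta> = 0" if \<eta>: "\<eta> \<in> I" and nl: "\<not> linked Q (support \<eta>)" for \<eta>
      by (rule blinfun_eqI) (simp add: not_linked_zero[OF I_D[OF \<eta>] nl Pr(2)[OF \<eta>]])
    have one: "\<eta> = \<omega>" if "\<eta> \<in> I" "\<omega> \<in> I" "linked Q (support \<eta>)" "linked Q (support \<omega>)" for \<eta> \<omega>
    proof -
      note MP = support(1)[OF I_D[OF that(1)]] support(1)[OF I_D[OF that(2)]]
      show ?thesis
        using I_unlinked[OF that(1,2)] linked_trans[OF MP(1) Q MP(2)] linked_sym[OF Q MP(1)] that(3,4) by blast
    qed
    have "finite {\<eta> \<in> I. linked Q (support \<eta>)}"
    proof (cases "{\<eta> \<in> I. linked Q (support \<eta>)} = {}")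
      case False
      then obtain \<omega> where "\<omega> \<in> I" "linked Q (support \<omega>)" by blast
      then have "{\<eta> \<in> I. linked Q (support \<eta>)} \<subseteq> {\<omega>}" using one by blast
      then show ?thesis by (rule finite_subset) simp
    next
      case True
      then show ?thesis by (simp only: finite.emptyI)
    qed
    then show "b o\<^sub>L Q \<in> C"
      unfolding C_def
    proof (intro CollectI allI impI)
      fix \<epsilon> :: real assume e: "\<epsilon> > 0" and fin: "finite {\<eta> \<in> I. linked Q (support \<eta>)}"
      have "{\<eta> \<in> I. norm ((b o\<^sub>L Q) o\<^sub>L Pr \<eta>) \<ge> \<epsilon>} \<subseteq> {\<eta> \<in> I. linked Q (support \<eta>)}"
        using zero e by fastforce
      then show "finite {\<eta> \<in> I. norm ((b o\<^sub>L Q) o\<^sub>L Pr \<eta>) \<ge> \<epsilon>}" using fin by (rule finite_subset)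
    qed
  qed
  then show ?thesis using a e C_D by blast
qed

text \<open>Approximation instead of equality makes the set closed under norm limits by
  construction, so that \<open>A_induct\<close> applies. Vanishing of the other components allows
  different indices to be added without interference.\<close>

definition approximable :: "'h \<Rightarrow> ('h \<Rightarrow>\<^sub>L 'h) set" where
  "approximable \<eta> = {T. \<forall>\<epsilon>>0. \<exists>a\<in>A. norm ((a o\<^sub>L Pr \<eta>) - T) \<le> \<epsilon> \<and> (\<forall>\<omega>\<in>I. \<omega> \<noteq> \<eta> \<longrightarrow> a o\<^sub>L Pr \<omega> = 0)}"

lemma approximableI:
  assumes "\<And>\<epsilon>. \<epsilon> > 0 \<Longrightarrow> \<exists>S\<in>approximable \<eta>. norm (S - T) \<le> \<epsilon>"
  shows "T \<in> approximable \<eta>"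
  unfolding approximable_def
proof (intro CollectI allI impI)
  fix \<epsilon> :: real assume e: "\<epsilon> > 0"
  obtain S where S: "S \<in> approximable \<eta>" "norm (S - T) \<le> \<epsilon> / 2" using assms[of "\<epsilon> / 2"] e by auto
  have "\<epsilon> / 2 > 0" using e by simp
  then obtain a where a: "a \<in> A" "norm ((a o\<^sub>L Pr \<eta>) - S) \<le> \<epsilon> / 2" "\<forall>\<omega>\<in>I. \<omega> \<noteq> \<eta> \<longrightarrow> a o\<^sub>L Pr \<omega> = 0"
    using S(1) unfolding approximable_def by blast
  have "norm ((a o\<^sub>L Pr \<eta>) - T) \<le> \<epsilon>"
    using norm_triangle_le[of "(a o\<^sub>L Pr \<eta>) - S" "S - T" \<epsilon>] a(2) S(2) by simp
  then show "\<exists>a\<in>A. norm ((a o\<^sub>L Pr \<eta>) - T) \<le> \<epsilon> \<and> (\<forall>\<omega>\<in>I. \<omega> \<noteq> \<eta> \<longrightarrow> a o\<^sub>L Pr \<omega> = 0)" using a by blast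
qed

lemma approximable_component:
  assumes "a \<in> A" "\<And>\<omega>. \<omega> \<in> I \<Longrightarrow> \<omega> \<noteq> \<eta> \<Longrightarrow> a o\<^sub>L Pr \<omega> = 0"
  shows "a o\<^sub>L Pr \<eta> \<in> approximable \<eta>"
  using assms unfolding approximable_def by (auto intro!: bexI[of _ a])

lemma approximable_subspace: "op_subspace (approximable \<eta>)"
  unfolding op_subspace_def
proof (intro conjI ballI allI)
  show "0 \<in> approximable \<eta>" using approximable_component[OF A_zero, of \<eta>] by simp
  show "S + T \<in> approximable \<eta>" if ST: "S \<in> approximable \<eta>" "T \<in> approximable \<eta>" for S T
    unfolding approximable_def
  proof (intro CollectI allI impI)
    fix \<epsilon> :: real assume "\<epsilon> > 0"
    then have e: "\<epsilon> / 2 > 0" by simp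
    obtain a where a: "a \<in> A" "norm ((a o\<^sub>L Pr \<eta>) - S) \<le> \<epsilon> / 2" "\<forall>\<omega>\<in>I. \<omega> \<noteq> \<eta> \<longrightarrow> a o\<^sub>L Pr \<omega> = 0"
      using ST(1) e unfolding approximable_def by blast
    obtain b where b: "b \<in> A" "norm ((b o\<^sub>L Pr \<eta>) - T) \<le> \<epsilon> / 2" "\<forall>\<omega>\<in>I. \<omega> \<noteq> \<eta> \<longrightarrow> b o\<^sub>L Pr \<omega> = 0"
      using ST(2) e unfolding approximable_def by blast
    have eq: "((a + b) o\<^sub>L Pr \<eta>) - (S + T) = ((a o\<^sub>L Pr \<eta>) - S) + ((b o\<^sub>L Pr \<eta>) - T)"
      by (simp add: blinfun_compose_simps)
    have "norm (((a + b) o\<^sub>L Pr \<eta>) - (S + T)) \<le> \<epsilon>"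
      unfolding eq by (rule norm_triangle_le) (use a(2) b(2) in simp)
    moreover have "\<forall>\<omega>\<in>I. \<omega> \<noteq> \<eta> \<longrightarrow> (a + b) o\<^sub>L Pr \<omega> = 0" using a(3) b(3) by (simp add: blinfun_compose_simps)
    ultimately show "\<exists>a\<in>A. norm ((a o\<^sub>L Pr \<eta>) - (S + T)) \<le> \<epsilon> \<and> (\<forall>\<omega>\<in>I. \<omega> \<noteq> \<eta> \<longrightarrow> a o\<^sub>L Pr \<omega> = 0)"
      using A_add[OF a(1) b(1)] by blast
  qed
  show "op_scale c T \<in> approximable \<eta>" if T: "T \<in> approximable \<eta>" for c T
    unfolding approximable_def
  proof (intro CollectI allI impI)
    fix \<epsilon> :: real assume "\<epsilon> > 0"
    then have e: "\<epsilon> / (cmod c + 1) > 0" by (simp add: add_nonneg_pos)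
    then obtain a where a: "a \<in> A" "norm ((a o\<^sub>L Pr \<eta>) - T) \<le> \<epsilon> / (cmod c + 1)" "\<forall>\<omega>\<in>I. \<omega> \<noteq> \<eta> \<longrightarrow> a o\<^sub>L Pr \<omega> = 0"
      using T unfolding approximable_def by blast
    have "norm ((op_scale c a o\<^sub>L Pr \<eta>) - op_scale c T) = cmod c * norm ((a o\<^sub>L Pr \<eta>) - T)"
      by (simp add: op_scale_compose_left op_scale_simps(2)[symmetric] norm_op_scale)
    also have "\<dots> \<le> (cmod c + 1) * (\<epsilon> / (cmod c + 1))" using a(2) by (intro mult_mono) auto
    also have "\<dots> = \<epsilon>" using norm_ge_zero[of c] by (simp add: add_nonneg_eq_0_iff)
    finally have "norm ((op_scale c a o\<^sub>L Pr \<eta>) - op_scale c T) \<le> \<epsilon>" .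
    moreover have "\<forall>\<omega>\<in>I. \<omega> \<noteq> \<eta> \<longrightarrow> op_scale c a o\<^sub>L Pr \<omega> = 0" using a(3) by (simp add: op_scale_compose_left op_scale_simps)
    ultimately show "\<exists>a\<in>A. norm ((a o\<^sub>L Pr \<eta>) - op_scale c T) \<le> \<epsilon> \<and> (\<forall>\<omega>\<in>I. \<omega> \<noteq> \<eta> \<longrightarrow> a o\<^sub>L Pr \<omega> = 0)"
      using A_scale[OF a(1)] by blast
  qed
qed

text \<open>\<open>rank_one\<close> supplies an exact preimage: its other components vanish because
  distinct members of \<open>I\<close> are not linked.\<close>

lemma rank_one_approximable:
  assumes \<eta>: "\<eta> \<in> I" and fg: "f \<in> cyclic \<eta>" "g \<in> cyclic \<eta>" and T: "\<And>x. blinfun_apply T x = scaleC (cinner x g) f"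
  shows "T \<in> approximable \<eta>"
proof -
  obtain z w where zw: "z \<in> A" "f = z \<eta>" "w \<in> A" "g = w \<eta>" using fg by (auto simp: cyclic_def)
  note r = rank_one[OF I_D[OF \<eta>] zw(1,3)]
  define r where "r = (z o\<^sub>L support \<eta>) o\<^sub>L op_adj (w o\<^sub>L support \<eta>)"
  have "r o\<^sub>L Pr \<omega> = 0" if "\<omega> \<in> I" "\<omega> \<noteq> \<eta>" for \<omega>
    using r(3)[OF I_D[OF that(1)] _ Pr(2)[OF that(1)]] I_unlinked[OF \<eta> that(1)] that(2)
    by (intro blinfun_eqI) (auto simp: r_def)
  then have "r o\<^sub>L Pr \<eta> \<in> approximable \<eta>"
    using r(1) by (intro approximable_component) (simp_all add: r_def)
  moreover have "r o\<^sub>L Pr \<eta> = T"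
  proof (rule blinfun_eqI)
    fix x
    have "r (Pr \<eta> x) = scaleC (cinner (Pr \<eta> x) g) f" using r(2)[OF Pr(2)[OF \<eta>]] by (simp add: r_def zw)
    then show "blinfun_apply (r o\<^sub>L Pr \<eta>) x = T x" by (simp add: T Pr_props(1)[OF \<eta> fg(2)])
  qed
  ultimately show ?thesis by simp
qed

text \<open>For compact \<open>T\<close> the products \<open>eT\<close> with an approximate identity converge to \<open>T\<close> in norm, and \<open>bQT\<close>
  has rank one for \<open>b \<in> A\<close> and every minimal projection \<open>Q\<close>.\<close>

lemma K_ops_approximable:
  assumes \<eta>: "\<eta> \<in> I" and T: "T \<in> K_ops (cyclic \<eta>)"
  shows "T \<in> approximable \<eta>"
proof -
  have TB: "T \<in> B_ops" and Tr: "\<And>x. T x \<in> cyclic \<eta>" and T0: "\<And>x. (\<And>y. y \<in> cyclic \<eta> \<Longrightarrow> cinner x y = 0) \<Longrightarrow> T x = 0"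
    and Tc: "compact (closure (blinfun_apply T ` cball 0 1))"
    using T by (auto simp: K_ops_def)
  have "T (x - Pr \<eta> x) = 0" for x by (rule T0) (rule Pr(3)[OF \<eta>])
  then have TPr: "T (Pr \<eta> x) = T x" for x by (simp add: blinfun.diff_right)
  have bT: "b o\<^sub>L T \<in> approximable \<eta>" if b: "b \<in> A" for b
  proof -
    have "A \<subseteq> {b. b o\<^sub>L T \<in> approximable \<eta>}"
    proof (rule A_induct)
      note sub = op_subspaceD[OF approximable_subspace[of \<eta>]]
      show "op_subspace {b. b o\<^sub>L T \<in> approximable \<eta>}"
        using sub(1-3) by (auto simp: op_subspace_def blinfun_compose_simps op_scale_compose_left)
      show "closed {b. b o\<^sub>L T \<in> approximable \<eta>}"
        unfolding closed_sequential_limits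
      proof (intro allI impI, elim conjE)
        fix f l assume f: "\<forall>n. f n \<in> {b. b o\<^sub>L T \<in> approximable \<eta>}" "f \<longlonglongrightarrow> l"
        have lim: "(\<lambda>n. f n o\<^sub>L T) \<longlonglongrightarrow> (l o\<^sub>L T)" by (intro tendsto_blinfun_compose f(2) tendsto_const)
        have "l o\<^sub>L T \<in> approximable \<eta>"
        proof (rule approximableI)
          fix \<epsilon> :: real assume "\<epsilon> > 0"
          then obtain n where "dist (f n o\<^sub>L T) (l o\<^sub>L T) < \<epsilon>" using metric_LIMSEQ_D[OF lim] by blast
          then show "\<exists>S\<in>approximable \<eta>. norm (S - (l o\<^sub>L T)) \<le> \<epsilon>"
            using f(1) by (intro bexI[of _ "f n o\<^sub>L T"]) (auto simp: dist_norm)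
        qed
        then show "l \<in> {b. b o\<^sub>L T \<in> approximable \<eta>}" by simp
      qed
      fix c Q assume c: "c \<in> A" and Q: "Q \<in> minimal_projections"
      have "(c o\<^sub>L Q) o\<^sub>L T \<in> approximable \<eta>"
      proof (cases "linked Q (support \<eta>)")
        case True
        obtain \<xi> where \<xi>: "\<xi> \<in> cyclic \<eta>" "\<And>v. v \<in> cyclic \<eta> \<Longrightarrow> Q v = scaleC (cinner v \<xi>) \<xi>"
          using linked_vector[OF Q I_D[OF \<eta>] True] by metis
        show ?thesis
        proof (rule rank_one_approximable[OF \<eta> cyclic_invariant[OF c \<xi>(1)] Pr(2)[OF \<eta>]])
          fix x
          \<comment> \<open>Projecting the vector \<open>op_adj T \<xi>\<close> changes nothing,
            because \<open>T\<close> factors through \<open>Pr \<eta>\<close>, and it puts the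
            vector in the cyclic subspace as \<open>rank_one_approximable\<close> demands.\<close>
          have "cinner (T x) \<xi> = cinner x (Pr \<eta> (op_adj T \<xi>))"
            by (simp add: Pr_props(6)[OF \<eta>, symmetric] cinner_op_adj_right[OF TB] TPr)
          then show "blinfun_apply ((c o\<^sub>L Q) o\<^sub>L T) x = scaleC (cinner x (Pr \<eta> (op_adj T \<xi>))) (c \<xi>)"
            by (simp add: \<xi>(2)[OF Tr] B_opsD[OF A_B[OF c]])
        qed
      next
        case False
        have "(c o\<^sub>L Q) o\<^sub>L T = 0"
          by (rule blinfun_eqI) (simp add: not_linked_zero[OF I_D[OF \<eta>] False Tr])
        then show ?thesis using sub(1) by simp
      qed
      then show "c o\<^sub>L Q \<in> {b. b o\<^sub>L T \<in> approximable \<eta>}" by simp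
    qed
    then show ?thesis using b by blast
  qed
  show ?thesis
  proof (rule approximableI)
    fix \<epsilon> :: real assume e: "\<epsilon> > 0"
    let ?K = "closure (blinfun_apply T ` cball 0 1)"
    have KS: "?K \<subseteq> cyclic \<eta>" by (rule closure_minimal) (use Tr closed_cyclic[OF I_D[OF \<eta>]] in auto)
    have e3: "\<epsilon> / 3 > 0" using e by simp
    \<comment> \<open>The centres are taken in the closed image, hence in the cyclic subspace; each
      is some \<open>z \<eta>\<close> with \<open>z\<close> in \<open>A\<close>, on which the
      approximate identity converges.\<close>
    obtain k where k: "finite k" "k \<subseteq> ?K" "?K \<subseteq> (\<Union>x\<in>k. ball x (\<epsilon> / 3))"
      using compactE_image[OF Tc, of ?K "\<lambda>x. ball x (\<epsilon> / 3)"] e3 by (metis (no_types, lifting) UN_I centre_in_ball open_ball subsetI)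
    have "\<forall>\<^sub>F e in U. dist (blinfun_apply e f) f < \<epsilon> / 3" if f: "f \<in> k" for f
    proof -
      obtain z where z: "z \<in> A" "f = z \<eta>" using f k(2) KS by (auto simp: cyclic_def)
      have "((\<lambda>e. (e o\<^sub>L z) \<eta>) \<longlongrightarrow> z \<eta>) U" by (intro blinfun.tendsto U_left z tendsto_const)
      from tendstoD[OF this e3] show ?thesis by (simp add: z(2))
    qed
    then have "\<forall>\<^sub>F e in U. \<forall>f\<in>k. dist (blinfun_apply e f) f < \<epsilon> / 3" using k(1) by (simp add: eventually_ball_finite)
    from eventually_happens'[OF U_nonbot eventually_conj[OF this U_ev]]
    obtain u where u: "\<forall>f\<in>k. dist (blinfun_apply u f) f < \<epsilon> / 3" "u \<in> A" "norm u \<le> 1" by blast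
    have uc: "norm (u y) \<le> norm y" for y
      using order_trans[OF norm_blinfun mult_right_mono[OF u(3) norm_ge_zero]] by simp
    have unit: "norm ((u o\<^sub>L T) x - T x) \<le> \<epsilon>" if x: "norm x \<le> 1" for x
    proof -
      have "T x \<in> ?K" using x by (rule apply_in_closure_ball)
      then obtain f where f: "f \<in> k" "dist f (T x) < \<epsilon> / 3" using k(3) by auto
      have "(u o\<^sub>L T) x - T x = (u (T x - f) + (u f - f)) + (f - T x)" by (simp add: blinfun.diff_right)
      also have "norm \<dots> \<le> (norm (u (T x - f)) + norm (u f - f)) + norm (f - T x)"
        by (intro norm_triangle_le add_right_mono norm_triangle_ineq)
      also have "\<dots> \<le> \<epsilon>"
      proof -
        have "norm (u f - f) < \<epsilon> / 3" "norm (T x - f) < \<epsilon> / 3" "norm (f - T x) < \<epsilon> / 3"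
          using u(1) f by (auto simp: dist_norm norm_minus_commute)
        then show ?thesis using uc[of "T x - f"] by linarith
      qed
      finally show ?thesis .
    qed
    have "norm ((u o\<^sub>L T) - T) \<le> \<epsilon>"
    proof (rule norm_blinfun_bound)
      fix x :: 'h
      show "norm (blinfun_apply ((u o\<^sub>L T) - T) x) \<le> \<epsilon> * norm x"
      proof (cases "x = 0")
        case False
        have "norm ((u o\<^sub>L T) ((1 / norm x) *\<^sub>R x) - T ((1 / norm x) *\<^sub>R x)) \<le> \<epsilon>"
          using False by (intro unit) simp
        then have "norm ((1 / norm x) *\<^sub>R ((u o\<^sub>L T) x - T x)) \<le> \<epsilon>"
          by (simp only: blinfun.scaleR_right scaleR_diff_right)
        then have "norm ((u o\<^sub>L T) x - T x) / norm x \<le> \<epsilon>" by (simp only: norm_scaleR) simp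
        then have "norm ((u o\<^sub>L T) x - T x) \<le> \<epsilon> * norm x" using False by (simp add: pos_divide_le_eq)
        then show ?thesis by (simp only: blinfun.diff_left)
      qed simp
    qed (use e in simp)
    then show "\<exists>S\<in>approximable \<eta>. norm (S - T) \<le> \<epsilon>" using bT[OF u(2)] by blast
  qed
qed

text \<open>Only finitely many components exceed a given \<epsilon>, and a sum of approximants
  handles them while the remaining ones are approximated by 0. The norm of \<open>A\<close> is
  controlled by components, so such approximations form a Cauchy sequence.\<close>

lemma components_surjective:
  assumes x: "\<And>\<eta>. \<eta> \<in> I \<Longrightarrow> x \<eta> \<in> K_ops (cyclic \<eta>)" and fin: "\<And>\<epsilon>. \<epsilon> > 0 \<Longrightarrow> finite {\<eta> \<in> I. norm (x \<eta>) \<ge> \<epsilon>}"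
  obtains a where "a \<in> A" "\<And>\<eta>. \<eta> \<in> I \<Longrightarrow> a o\<^sub>L Pr \<eta> = x \<eta>"
proof -
  have approx: "\<exists>a\<in>A. \<forall>\<eta>\<in>I. norm ((a o\<^sub>L Pr \<eta>) - x \<eta>) \<le> \<epsilon>" if e: "\<epsilon> > 0" for \<epsilon>
  proof -
    let ?F = "{\<eta> \<in> I. norm (x \<eta>) \<ge> \<epsilon>}"
    have "\<forall>\<eta>. \<exists>a. \<eta> \<in> I \<longrightarrow> a \<in> A \<and> norm ((a o\<^sub>L Pr \<eta>) - x \<eta>) \<le> \<epsilon> \<and> (\<forall>\<omega>\<in>I. \<omega> \<noteq> \<eta> \<longrightarrow> a o\<^sub>L Pr \<omega> = 0)"
      using K_ops_approximable[OF _ x] e unfolding approximable_def by blast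
    then obtain a where a: "\<And>\<eta>. \<eta> \<in> I \<Longrightarrow> a \<eta> \<in> A" "\<And>\<eta>. \<eta> \<in> I \<Longrightarrow> norm ((a \<eta> o\<^sub>L Pr \<eta>) - x \<eta>) \<le> \<epsilon>"
      "\<And>\<eta> \<omega>. \<eta> \<in> I \<Longrightarrow> \<omega> \<in> I \<Longrightarrow> \<omega> \<noteq> \<eta> \<Longrightarrow> a \<eta> o\<^sub>L Pr \<omega> = 0" by metis
    define b where "b = (\<Sum>\<eta>\<in>?F. a \<eta>)"
    have bA: "b \<in> A" unfolding b_def using a(1) by (intro A_sum) auto
    have bPr: "b o\<^sub>L Pr \<omega> = (\<Sum>\<eta>\<in>?F. a \<eta> o\<^sub>L Pr \<omega>)" for \<omega>
      by (rule blinfun_eqI) (simp add: b_def blinfun_sum_apply)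
    have "norm ((b o\<^sub>L Pr \<omega>) - x \<omega>) \<le> \<epsilon>" if \<omega>: "\<omega> \<in> I" for \<omega>
    proof (cases "\<omega> \<in> ?F")
      case True
      have "(\<Sum>\<eta>\<in>?F. a \<eta> o\<^sub>L Pr \<omega>) = a \<omega> o\<^sub>L Pr \<omega> + 0"
        using True fin[OF e] a(3)[OF _ \<omega>] by (subst sum.remove[of _ \<omega>]) (auto intro!: sum.neutral)
      then show ?thesis using a(2)[OF \<omega>] by (simp add: bPr)
    next
      case False
      have "(\<Sum>\<eta>\<in>?F. a \<eta> o\<^sub>L Pr \<omega>) = 0"
        using False \<omega> a(3)[OF _ \<omega>] by (intro sum.neutral) auto
      then show ?thesis using False \<omega> by (simp add: bPr)
    qed
    then show ?thesis using bA by blast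
  qed
  have "\<forall>n. \<exists>a. a \<in> A \<and> (\<forall>\<eta>\<in>I. norm ((a o\<^sub>L Pr \<eta>) - x \<eta>) \<le> 1 / real (Suc n))"
    using approx by (simp add: Bex_def)
  then obtain a where a: "\<And>n. a n \<in> A" "\<And>n \<eta>. \<eta> \<in> I \<Longrightarrow> norm ((a n o\<^sub>L Pr \<eta>) - x \<eta>) \<le> 1 / real (Suc n)"
    by metis
  have dist_le: "norm (a n - a m) \<le> 1 / real (Suc n) + 1 / real (Suc m)" for n m
  proof (rule norm_le_if_components)
    fix \<eta> assume \<eta>: "\<eta> \<in> I"
    have "(a n - a m) o\<^sub>L Pr \<eta> = ((a n o\<^sub>L Pr \<eta>) - x \<eta>) - ((a m o\<^sub>L Pr \<eta>) - x \<eta>)" by (simp add: blinfun_compose_simps)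
    also have "norm \<dots> \<le> 1 / real (Suc n) + 1 / real (Suc m)"
      by (intro order_trans[OF norm_triangle_ineq4] add_mono a(2) \<eta>)
    finally show "norm ((a n - a m) o\<^sub>L Pr \<eta>) \<le> 1 / real (Suc n) + 1 / real (Suc m)" .
  qed (simp_all add: A_diff a)
  have "Cauchy a"
  proof (rule metric_CauchyI)
    fix e :: real assume e: "e > 0"
    then obtain N where N: "1 / real (Suc N) < e / 2" using nat_approx_posE[of "e / 2"] by auto
    have small: "1 / real (Suc n) < e / 2" if "n \<ge> N" for n
      using that by (intro le_less_trans[OF _ N] divide_left_mono) auto
    have "dist (a m) (a n) < e" if "m \<ge> N" "n \<ge> N" for m n
      using dist_le[of m n] small[OF that(1)] small[OF that(2)] unfolding dist_norm by linarith
    then show "\<exists>M. \<forall>m\<ge>M. \<forall>n\<ge>M. dist (a m) (a n) < e" by blast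
  qed
  then obtain l where l: "a \<longlonglongrightarrow> l" by (metis Cauchy_convergent convergent_def)
  have lA: "l \<in> A" using closed_sequentially[OF A_closed _ l] a(1) by blast
  have "l o\<^sub>L Pr \<eta> = x \<eta>" if \<eta>: "\<eta> \<in> I" for \<eta>
  proof -
    have "(\<lambda>n. (a n o\<^sub>L Pr \<eta>) - x \<eta>) \<longlonglongrightarrow> 0"
    proof (rule Lim_null_comparison)
      show "\<forall>\<^sub>F n in sequentially. norm ((a n o\<^sub>L Pr \<eta>) - x \<eta>) \<le> inverse (real (Suc n))"
        using a(2)[OF \<eta>] by (simp add: inverse_eq_divide)
    qed (rule LIMSEQ_inverse_real_of_nat)
    then have "(\<lambda>n. a n o\<^sub>L Pr \<eta>) \<longlonglongrightarrow> x \<eta>" by (rule LIM_zero_cancel)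
    moreover have "(\<lambda>n. a n o\<^sub>L Pr \<eta>) \<longlonglongrightarrow> (l o\<^sub>L Pr \<eta>)" by (intro tendsto_blinfun_compose l tendsto_const)
    ultimately show ?thesis by (metis LIMSEQ_unique)
  qed
  with lA show ?thesis by (rule that)
qed

lemma isomorphic_c0_sum: "completely_isometrically_isomorphic (op_alg A) (c0_sum_compacts I cyclic)"
proof -
  \<comment> \<open>The value 0 off \<open>I\<close> is the convention of the carrier of the
    sum.\<close>
  define \<theta> where "\<theta> a = (\<lambda>\<eta>. if \<eta> \<in> I then a o\<^sub>L Pr \<eta> else 0)" for a :: "'h \<Rightarrow>\<^sub>L 'h"
  have inv: "Pr \<eta> (b (Pr \<eta> x)) = b (Pr \<eta> x)" if "\<eta> \<in> I" "b \<in> A" for \<eta> b x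
    using Pr_props(2)[OF that(1)] cyclic_invariant[OF that(2) Pr(2)[OF that(1)]] by blast
  have inj: "inj_on \<theta> A"
  proof (rule inj_onI)
    fix a b assume ab: "a \<in> A" "b \<in> A" "\<theta> a = \<theta> b"
    have "norm (a - b) \<le> 0"
    proof (rule norm_le_if_components)
      fix \<eta> assume "\<eta> \<in> I"
      then have "a o\<^sub>L Pr \<eta> = b o\<^sub>L Pr \<eta>" using fun_cong[OF ab(3), of \<eta>] by (simp add: \<theta>_def)
      then show "norm ((a - b) o\<^sub>L Pr \<eta>) \<le> 0" by (simp add: blinfun_compose_simps)
    qed (simp_all add: A_diff ab)
    then show "a = b" by simp
  qed
  have im: "\<theta> ` A = carr (c0_sum_compacts I cyclic)"
  proof
    show "\<theta> ` A \<subseteq> carr (c0_sum_compacts I cyclic)"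
    proof
      fix y assume "y \<in> \<theta> ` A"
      then obtain a where a: "a \<in> A" "y = \<theta> a" by blast
      have "{\<eta> \<in> I. \<epsilon> \<le> norm (\<theta> a \<eta>)} = {\<eta> \<in> I. \<epsilon> \<le> norm (a o\<^sub>L Pr \<eta>)}" for \<epsilon>
        by (auto simp: \<theta>_def)
      then show "y \<in> carr (c0_sum_compacts I cyclic)"
        using components_vanish[OF a(1)] component_K_ops[OF _ a(1)]
        by (simp add: c0_sum_compacts_def a(2)) (simp add: \<theta>_def)
    qed
    show "carr (c0_sum_compacts I cyclic) \<subseteq> \<theta> ` A"
    proof
      fix x assume "x \<in> carr (c0_sum_compacts I cyclic)"
      then have x: "\<And>\<eta>. \<eta> \<in> I \<Longrightarrow> x \<eta> \<in> K_ops (cyclic \<eta>)" "\<And>\<eta>. \<eta> \<notin> I \<Longrightarrow> x \<eta> = 0"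
        "\<And>\<epsilon>. \<epsilon> > 0 \<Longrightarrow> finite {\<eta> \<in> I. norm (x \<eta>) \<ge> \<epsilon>}"
        by (simp_all add: c0_sum_compacts_def)
      obtain a where a: "a \<in> A" "\<And>\<eta>. \<eta> \<in> I \<Longrightarrow> a o\<^sub>L Pr \<eta> = x \<eta>"
        using components_surjective[OF x(1,3)] by blast
      then have "x = \<theta> a" using x(2) by (auto simp: \<theta>_def)
      then show "x \<in> \<theta> ` A" using a(1) by blast
    qed
  qed
  \<comment> \<open>Invariance of the cyclic subspace makes the inner projection redundant.\<close>
  have mult: "\<theta> (a o\<^sub>L b) = (\<lambda>\<eta>. \<theta> a \<eta> o\<^sub>L \<theta> b \<eta>)" if "a \<in> A" "b \<in> A" for a b
    using inv[OF _ that(2)] by (auto simp: \<theta>_def intro!: blinfun_eqI)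
  have norm: "Sup (insert 0 ((\<lambda>k. op_mat_norm n (\<lambda>i j. \<theta> (m i j) k)) ` I)) = op_mat_norm n m"
    if "\<forall>i<n. \<forall>j<n. m i j \<in> A" for n and m :: "nat \<Rightarrow> nat \<Rightarrow> 'h \<Rightarrow>\<^sub>L 'h"
    using op_mat_norm_components[of n m] that by (simp add: \<theta>_def cong: image_cong_simp)
  show ?thesis
    unfolding completely_isometrically_isomorphic_def
  proof (intro exI[of _ \<theta>] conjI ballI allI impI)
    show "bij_betw \<theta> (carr (op_alg A)) (carr (c0_sum_compacts I cyclic))"
      using inj im by (simp add: bij_betw_def op_alg_def)
  next
    fix a b assume "a \<in> carr (op_alg A)" "b \<in> carr (op_alg A)"
    then have ab: "a \<in> A" "b \<in> A" by (simp_all add: op_alg_def)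
    show "\<theta> (add_op (op_alg A) a b) = add_op (c0_sum_compacts I cyclic) (\<theta> a) (\<theta> b)"
      by (auto simp: \<theta>_def op_alg_def c0_sum_compacts_def blinfun_compose_simps)
    show "\<theta> (mult_op (op_alg A) a b) = mult_op (c0_sum_compacts I cyclic) (\<theta> a) (\<theta> b)"
      using mult[OF ab] by (simp add: op_alg_def c0_sum_compacts_def)
  next
    fix c a
    show "\<theta> (scale_op (op_alg A) c a) = scale_op (c0_sum_compacts I cyclic) c (\<theta> a)"
      by (auto simp: \<theta>_def op_alg_def c0_sum_compacts_def op_scale_compose_left op_scale_simps)
  next
    fix n :: nat and m :: "nat \<Rightarrow> nat \<Rightarrow> 'h \<Rightarrow>\<^sub>L 'h"
    assume "\<forall>i<n. \<forall>j<n. m i j \<in> carr (op_alg A)"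
    then show "mat_norm (c0_sum_compacts I cyclic) n (\<lambda>i j. \<theta> (m i j)) = mat_norm (op_alg A) n m"
      using norm[of n m] by (simp add: op_alg_def c0_sum_compacts_def)
  qed
qed

lemma annihilator_c0_sum: "annihilator_cstar_algebra (c0_sum_compacts I cyclic)"
  unfolding annihilator_cstar_algebra_def using csubspace_cyclic closed_cyclic[OF I_D] by blast

end

theorem corollary5p3:
  fixes A :: "('h::complex_hilbert_space \<Rightarrow>\<^sub>L 'h) set"
  assumes "operator_algebra A"
    and "approximately_unital A"
    and "semisimple A"
  shows "(\<forall>J. left_ideal A J \<and> closed J \<longrightarrow>
            (contractively_complemented A J \<longleftrightarrow>
             (\<exists>p\<in>multiplier_algebra A. orth_projection A p \<and>
                canon A ` J = (\<lambda>a. arens A (canon A a) p) ` A))) \<and>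
         ((\<forall>J. left_ideal A J \<and> closed J \<longrightarrow> contractively_complemented A J) \<longrightarrow>
          (\<exists>X :: ('h \<Rightarrow> ('h \<Rightarrow>\<^sub>L 'h)) matrix_normed_algebra.
             annihilator_cstar_algebra X \<and>
             completely_isometrically_isomorphic (op_alg A) X))"
proof -
  obtain F where F: "F \<noteq> bot" "\<forall>\<^sub>F e in F. e \<in> A \<and> norm e \<le> 1"
    "\<forall>a\<in>A. ((\<lambda>e. e o\<^sub>L a) \<longlongrightarrow> a) F \<and> ((\<lambda>e. a o\<^sub>L e) \<longlongrightarrow> a) F"
    using assms(2) by (auto simp: approximately_unital_def)
  \<comment> \<open>Refining the filter keeps both limits of the approximate identity.\<close>
  obtain U where U: "U \<le> F" "ultra U" using ultrafilter_exists[OF F(1)] by blast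
  interpret approx_op_algebra A U
  proof
    show "\<forall>\<^sub>F e in U. e \<in> A \<and> norm e \<le> 1" using filter_leD[OF U(1) F(2)] .
    show "((\<lambda>e. e o\<^sub>L a) \<longlongrightarrow> a) U" "((\<lambda>e. a o\<^sub>L e) \<longlongrightarrow> a) U" if "a \<in> A" for a
      using F(3) that tendsto_mono[OF U(1)] by blast+
  qed (use assms(1) U(2) in auto)
  show ?thesis
  proof (intro conjI allI impI, elim conjE)
    fix J assume "left_ideal A J" "closed J"
    then show "contractively_complemented A J \<longleftrightarrow>
        (\<exists>p\<in>multiplier_algebra A. orth_projection A p \<and> canon A ` J = (\<lambda>a. arens A (canon A a) p) ` A)"
      using contractively_complemented_of_multiplier multiplier_of_contractively_complemented by metis
  next
    assume compl: "\<forall>J. left_ideal A J \<and> closed J \<longrightarrow> contractively_complemented A J"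
    interpret complemented_algebra A U
      by unfold_locales (use assms(3) compl in auto)
    obtain \<Omega> I where "cyclic_decomposition A U \<Omega> I" using cyclic_decomposition_exists .
    then interpret cyclic_decomposition A U \<Omega> I .
    show "\<exists>X :: ('h \<Rightarrow> ('h \<Rightarrow>\<^sub>L 'h)) matrix_normed_algebra.
        annihilator_cstar_algebra X \<and> completely_isometrically_isomorphic (op_alg A) X"
      using annihilator_c0_sum isomorphic_c0_sum by blast
  qed
qed

end
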